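(* Let $p=(\alpha,\theta,\xi)$ be a Weyl preseed of rank $n$ in the skew-field $\mathcal{D}$, let $\mathcal{H}(p)$ be its Weyl cluster algebra, and let $\mathfrak{C}(\mathcal{W}_0)$ be the associated clustered hyperbolic category (the category of all hyperbolic objects of the categorical preseed $\mathcal{W}_0$ induced by $p$). Then $\mathfrak{C}(\mathcal{W}_0)$ is generated by (possibly infinitely many) equivalent hyperbolic categories, each of which is equivalent to the category $\mathcal{H}(p)\text{-mod}$ of representations of $\mathcal{H}(p)$.
   Context: Weyl preseeds. $K$ is a field of characteristic zero. $\mathbb{P}$ is a finitely generated free abelian group (written multiplicatively) with generating set $F=\bigcup_{i=1}^nF_i$, $F_i=\{f_{i1},\dots,f_{im_i}\}$; $R=K[\mathbb{P}]$; $\mathcal{D}=R(t_1,\dots,t_n)$ is the skew-field of rational functions in $n$ mutually commuting variables, which need not commute with $R$; $\mathcal{D}$ is assumed to be an Ore domain. A cluster is a set $X=\{x_1,\dots,x_n\}$ of algebraically independent rational functions generating $\mathcal{D}$ with $x_ix_j=x_jx_i$ and $x_if=fx_i$ for $f\in F_j$, $i\ne j$. A Weyl preseed of rank $n$ is a triple $p=(X,\theta,\xi)$ with $X$ a cluster, $\theta=(\theta_1,\dots,\theta_n)$ automorphisms of $R$ with $x_i^{\pm1}f=\theta_i^{\pm1}(f)x_i^{\pm1}$ for $f\in F_i$, and $\xi=(\xi_1,\dots,\xi_n)$ with each $\xi_i\in R$ a binomial (sum of two monomials) in the elements of $F_i$. Right (resp. left) mutation $\mu^R_k$ (resp. $\mu_k^L$)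 of $p$ replaces $x_k$ by $\xi_kx_k^{-1}$ (resp. $x_k^{-1}\xi_k$), $\theta_k$ by $\theta_k^{-1}$, and leaves everything else unchanged. A cluster variable of $p$ is an element of the cluster of some preseed obtained from $p$ by a sequence of right or left mutations; $\mathcal{X}(p)$ is the set of cluster variables; the Weyl cluster algebra $\mathcal{H}(p)$ is the $R$-subalgebra of $\mathcal{D}$ generated by $\mathcal{X}(p)$. Here $X=\alpha=\{\alpha_1,\dots,\alpha_n\}$. Categorical preseeds. All categories are small with non-empty object sets. Let $\mathcal{A}$ be an additive category. An endomorphism of $\mathrm{Id}_{\mathcal{A}}$ is a natural transformation $\tau:\mathrm{Id}_{\mathcal{A}}\to\mathrm{Id}_{\mathcal{A}}$ with components $\tau_W$. A categorical preseed of rank $n$ in $\mathcal{A}$ is $\mathcal{P}=(\Theta,\xi,\mathcal{A}\langle\Theta\rangle)$ with $\Theta=(\Theta_1,\dots,\Theta_n)$ invertible functors $\mathcal{A}\to\mathcal{A}$, $\xi=(\xi_1,\dots,\xi_n)$ endomorphisms of $\mathrm{Id}_{\mathcal{A}}$, and $\mathcal{A}\langle\Theta\rangle$ (skew Laurent category) a category with objects (all, or where indicated some, of the) pairs $(M,f)$, $f=(f_1,\dots,f_n)$, $f_i:\Theta_i(M)\to M$ invertible; morphisms $(M,f)\to(M',f')$ are $n$-tuples $(h_1,\dots,h_n)$, $h_i:M\to M'$, with $h_i f_i=f_i'\Theta_i(h_i)$. Put $\varepsilon_i=\Theta_i^{-1}(\xi_i)$ (for the initial preseed). Categorical mutations.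 $\mu_k^R$ and $\mu_k^L$ ($k\in[1,n]$) keep $\xi$, replace $\Theta_k$ by its inverse, and mutate skew Laurent objects as follows. Suppose the current triple was obtained from the initial preseed by a sequence of mutations containing exactly $t\ge0$ copies of $\mu_k^R$ (when applying $\mu_k^R$), resp. of $\mu_k^L$ (when applying $\mu_k^L$). Then $(W,\nu)$ is sent to the object with underlying object the image of $W$ under the current $k$-th auto-equivalence, with components $\nu_i$, $i\neq k$, unchanged, and with $k$-th component: for $\mu_k^R$, $\varepsilon_k\circ\nu_k^{-1}$ ($t$ even) or $\xi_k\circ\nu_k^{-1}$ ($t$ odd); for $\mu_k^L$, $\nu_k^{-1}\circ\varepsilon_k$ ($t$ even) or $\nu_k^{-1}\circ\xi_k$ ($t$ odd), with $\varepsilon_k,\xi_k$ evaluated at the appropriate object. Morphisms are transported by the current $k$-th auto-equivalence. Inverses of $\xi_k,\varepsilon_k$ are understood to exist where they occur. Preseeds obtained from each other by sequences of mutations are mutationally equivalent. Hyperbolic categories. Given $\mathcal{A},\Theta,\xi$ with $\varepsilon_i=\Theta_i^{-1}(\xi_i)$, the hyperbolic category $\mathcal{A}_n\{\Theta,\xi\}$ has objects $(\gamma,M,\eta)$, with $M$ in $\mathcal{A}$, $\gamma_i:M\to\Theta_i(M)$, $\eta_i:\Theta_i(M)\to M$, $\eta_i\gamma_i=\xi_{i,M}$, $\gamma_i\eta_i=\varepsilon_{i,\Theta_i(M)}$, $i\in[1,n]$; morphisms $(\gamma,M,\eta)\to(\gamma',M',\eta')$ are $n$-tuples $f_i:M\to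 M'$ with $\Theta_i(f_i)\gamma_i=\gamma_i'f_i$ and $f_i\eta_i=\eta_i'\Theta_i(f_i)$. For $\mathcal{S}$ mutationally equivalent to $\mathcal{P}$, $\mathcal{H}^R(\mathcal{S})$ (the right hyperbolic category of $\mathcal{S}$) has objects $(g',M,g)$ with $(M,g)$ a skew Laurent object of $\mathcal{S}$ and $g_i'=\mu_i^R(g_i)$ the $i$-th component of the right mutation $\mu_i^R$ of $(M,g)$; its morphisms $(g',M,g)\to(h',M',h)$ are the morphisms $(M,g)\to(M',h)$ in the skew Laurent category of $\mathcal{S}$. $\mathcal{H}^L(\mathcal{S})$ is defined likewise with left mutations. Hyperbolic objects of $\mathcal{P}$ are the objects of all the $\mathcal{H}^R(\mathcal{S}),\mathcal{H}^L(\mathcal{S})$. The mutation category $\mathcal{H}(\mathcal{P})$ has these as objects, and morphisms $(f',M,f)\to(g',W,g)$ the $n$-tuples $h_i\in\mathrm{Mor}_{\mathcal{A}}(M,W)$ with $\Theta_i(h_i)f_i'=g_i'h_i$ and $h_if_i=g_i\Theta_i(h_i)$. A clustered hyperbolic category in $\mathcal{P}$ is a full subcategory of $\mathcal{H}(\mathcal{P})$ such that for each of its objects $(f',M,f)$ the pair $(M,f)$ lies in the skew Laurent category of exactly one categorical preseed mutationally equivalent to $\mathcal{P}$. That a category is generated by a family of full subcategories means that each of its objects belongs to at least one of them. The category $\mathfrak{C}(\mathcal{W}_0)$. Let $\psi_*:\mathcal{H}(p)\text{-mod}\to R\text{-mod}$ be the functor sending each $\mathcal{H}(p)$-module to itself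 as an $R$-module, forgetting the action of $\mathcal{X}(p)$, and let $\mathcal{A}_p=\psi_*(\mathcal{H}(p)\text{-mod})$, regarded as a full subcategory of $R\text{-mod}$. The categorical preseed $\mathcal{W}_0=(\Theta,\xi,\mathcal{A}_p\langle\Theta\rangle)$ in $\mathcal{A}_p$ has: $\Theta_i$ the auto-equivalence of $\mathcal{A}_p$ induced by $\theta_i$ (twisting the $R$-action on a module so that multiplication by $\alpha_i$ is an $R$-linear map $\Theta_i(M)\to M$, i.e. $r\cdot_{\Theta_i(M)}m=\theta_i^{-1}(r)m$); $\xi_{i,M}:M\to M$, $m\mapsto\xi_i m$; and the objects of $\mathcal{A}_p\langle\Theta\rangle$ are the pairs $(M,\overline{\alpha})$, $M$ in $\mathcal{A}_p$, $\overline\alpha=(\overline\alpha_1,\dots,\overline\alpha_n)$, $\overline\alpha_i:\Theta_i(M)\to M$, $\overline\alpha_i(m)=\alpha_i m$, with morphisms $(M,\overline\alpha)\to(M',\overline\alpha)$ the $\mathcal{H}(p)$-module homomorphisms $M\to M'$. $\mathfrak{C}(\mathcal{W}_0)$ is the category $\mathcal{H}(\mathcal{W}_0)$ of all hyperbolic objects of $\mathcal{W}_0$, which is a clustered hyperbolic category.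
   Formalization: Morphisms of the category of hyperbolic objects are single homomorphisms h, i.e. tuples (h,...,h), not arbitrary n-tuples; with arbitrary n-tuples the claim fails for n ≥ 2, as endomorphism rings would split as products. Inverses of all ξ_i, ε_i are assumed, as the setting does. *)

theory Defs
  imports
    "HOL-Algebra.Free_Abelian_Groups"
    "HOL-Algebra.Generated_Groups"
    "HOL-Algebra.Module"
    HOL.Hull
begin

section \<open>Categories\<close>

text \<open>Small categories with hom-sets; \<open>Cmp C g f\<close> is \<open>g\<close> after \<open>f\<close>.  Hom-sets are required to be
  disjoint, so that an arrow determines its source and its target.\<close>

record ('o, 'a) category =
  Obj :: "'o set"
  Hom :: "'o \<Rightarrow> 'o \<Rightarrow> 'a set"
  Idt :: "'o \<Rightarrow> 'a"
  Cmp :: "'a \<Rightarrow> 'a \<Rightarrow> 'a"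

definition is_category :: "('o, 'a) category \<Rightarrow> bool" where
  "is_category C \<longleftrightarrow>
     Obj C \<noteq> {} \<and>
     (\<forall>x\<in>Obj C. Idt C x \<in> Hom C x x) \<and>
     (\<forall>x\<in>Obj C. \<forall>y\<in>Obj C. \<forall>z\<in>Obj C. \<forall>f\<in>Hom C x y. \<forall>g\<in>Hom C y z. Cmp C g f \<in> Hom C x z) \<and>
     (\<forall>x\<in>Obj C. \<forall>y\<in>Obj C. \<forall>f\<in>Hom C x y. Cmp C f (Idt C x) = f \<and> Cmp C (Idt C y) f = f) \<and>
     (\<forall>w\<in>Obj C. \<forall>x\<in>Obj C. \<forall>y\<in>Obj C. \<forall>z\<in>Obj C.
        \<forall>f\<in>Hom C w x. \<forall>g\<in>Hom C x y. \<forall>h\<in>Hom C y z. Cmp C h (Cmp C g f) = Cmp C (Cmp C h g) f) \<and>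
     (\<forall>x\<in>Obj C. \<forall>y\<in>Obj C. \<forall>x'\<in>Obj C. \<forall>y'\<in>Obj C.
        Hom C x y \<inter> Hom C x' y' \<noteq> {} \<longrightarrow> x = x' \<and> y = y')"

definition Arr :: "('o, 'a) category \<Rightarrow> 'a set" where
  "Arr C = (\<Union>x\<in>Obj C. \<Union>y\<in>Obj C. Hom C x y)"

definition inverse_arrows :: "('o, 'a) category \<Rightarrow> 'o \<Rightarrow> 'o \<Rightarrow> 'a \<Rightarrow> 'a \<Rightarrow> bool" where
  "inverse_arrows C x y f g \<longleftrightarrow>
     f \<in> Hom C x y \<and> g \<in> Hom C y x \<and> Cmp C g f = Idt C x \<and> Cmp C f g = Idt C y"

definition invertible :: "('o, 'a) category \<Rightarrow> 'o \<Rightarrow> 'o \<Rightarrow> 'a \<Rightarrow> bool" where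
  "invertible C x y f \<longleftrightarrow> (\<exists>g. inverse_arrows C x y f g)"

definition inv_arrow :: "('o, 'a) category \<Rightarrow> 'o \<Rightarrow> 'o \<Rightarrow> 'a \<Rightarrow> 'a" where
  "inv_arrow C x y f = (THE g. inverse_arrows C x y f g)"

record ('o, 'a, 'p, 'b) ftr =
  FObj :: "'o \<Rightarrow> 'p"
  FArr :: "'a \<Rightarrow> 'b"

type_synonym ('o, 'a) endoftr = "('o, 'a, 'o, 'a) ftr"

definition is_functor ::
    "('o, 'a) category \<Rightarrow> ('p, 'b) category \<Rightarrow> ('o, 'a, 'p, 'b) ftr \<Rightarrow> bool" where
  "is_functor C D T \<longleftrightarrow>
     (\<forall>x\<in>Obj C. FObj T x \<in> Obj D) \<and>
     (\<forall>x\<in>Obj C. \<forall>y\<in>Obj C. \<forall>f\<in>Hom C x y. FArr T f \<in> Hom D (FObj T x) (FObj T y)) \<and>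
     (\<forall>x\<in>Obj C. FArr T (Idt C x) = Idt D (FObj T x)) \<and>
     (\<forall>x\<in>Obj C. \<forall>y\<in>Obj C. \<forall>z\<in>Obj C. \<forall>f\<in>Hom C x y. \<forall>g\<in>Hom C y z.
        FArr T (Cmp C g f) = Cmp D (FArr T g) (FArr T f))"

definition id_ftr :: "('o, 'a) endoftr" where
  "id_ftr = \<lparr>FObj = (\<lambda>x. x), FArr = (\<lambda>f. f)\<rparr>"

definition comp_ftr ::
    "('p, 'b, 'q, 'c) ftr \<Rightarrow> ('o, 'a, 'p, 'b) ftr \<Rightarrow> ('o, 'a, 'q, 'c) ftr" where
  "comp_ftr S T = \<lparr>FObj = FObj S \<circ> FObj T, FArr = FArr S \<circ> FArr T\<rparr>"

definition natural_iso ::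
    "('o, 'a) category \<Rightarrow> ('p, 'b) category \<Rightarrow> ('o, 'a, 'p, 'b) ftr \<Rightarrow> ('o, 'a, 'p, 'b) ftr
       \<Rightarrow> ('o \<Rightarrow> 'b) \<Rightarrow> bool" where
  "natural_iso C D S T \<tau> \<longleftrightarrow>
     (\<forall>x\<in>Obj C. invertible D (FObj S x) (FObj T x) (\<tau> x)) \<and>
     (\<forall>x\<in>Obj C. \<forall>y\<in>Obj C. \<forall>f\<in>Hom C x y. Cmp D (\<tau> y) (FArr S f) = Cmp D (FArr T f) (\<tau> x))"

definition equivalent_categories :: "('o, 'a) category \<Rightarrow> ('p, 'b) category \<Rightarrow> bool" where
  "equivalent_categories C D \<longleftrightarrow>
     is_category C \<and> is_category D \<and>
     (\<exists>S T \<eta> \<epsilon>. is_functor C D S \<and> is_functor D C T \<and>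
        natural_iso C C id_ftr (comp_ftr T S) \<eta> \<and> natural_iso D D (comp_ftr S T) id_ftr \<epsilon>)"

definition full_subcategory :: "('o, 'a) category \<Rightarrow> ('o, 'a) category \<Rightarrow> bool" where
  "full_subcategory B C \<longleftrightarrow>
     is_category B \<and> is_category C \<and> Obj B \<subseteq> Obj C \<and>
     (\<forall>x\<in>Obj B. \<forall>y\<in>Obj B. Hom B x y = Hom C x y) \<and>
     (\<forall>x\<in>Obj B. Idt B x = Idt C x) \<and>
     (\<forall>x\<in>Obj B. \<forall>y\<in>Obj B. \<forall>z\<in>Obj B. \<forall>f\<in>Hom B x y. \<forall>g\<in>Hom B y z. Cmp B g f = Cmp C g f)"

definition generated_by :: "('o, 'a) category \<Rightarrow> ('o, 'a) category set \<Rightarrow> bool" where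
  "generated_by C \<G> \<longleftrightarrow> (\<forall>B\<in>\<G>. full_subcategory B C) \<and> (\<forall>x\<in>Obj C. \<exists>B\<in>\<G>. x \<in> Obj B)"

text \<open>The inverse of an invertible endofunctor.  On extensional functors (value \<^const>\<open>undefined\<close>
  outside \<open>Obj C\<close>, \<open>Arr C\<close>) it is an involution, so that equality of functors on \<open>C\<close> is
  equality in HOL.\<close>

definition inv_ftr :: "('o, 'a) category \<Rightarrow> ('o, 'a) endoftr \<Rightarrow> ('o, 'a) endoftr" where
  "inv_ftr C T =
     \<lparr>FObj = restrict (inv_into (Obj C) (FObj T)) (Obj C),
      FArr = restrict (inv_into (Arr C) (FArr T)) (Arr C)\<rparr>"


section \<open>Categorical preseeds, mutations and hyperbolic categories\<close>

text \<open>An \<open>n\<close>-tuple is a function on \<open>nat\<close> that is extensional on \<open>{1..n}\<close>.  A skew Laurent object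
  is a pair \<open>(M, f)\<close>, and an arrow between such objects carries its source and target along with
  the \<open>n\<close>-tuple.\<close>

type_synonym 'a tuple = "nat \<Rightarrow> 'a"
type_synonym ('o, 'a) laurent_obj = "'o \<times> 'a tuple"
type_synonym ('x, 'a) tuple_arrow = "'x \<times> 'a tuple \<times> 'x"

text \<open>The data of a categorical preseed in \<open>A\<close>: invertible functors \<open>\<Theta>\<^sub>i\<close>, endomorphisms \<open>\<xi>\<^sub>i\<close> of the
  identity functor, and the skew Laurent category.\<close>

record ('o, 'a) preseed =
  Theta :: "nat \<Rightarrow> ('o, 'a) endoftr"
  Xi :: "nat \<Rightarrow> 'o \<Rightarrow> 'a"
  Laurent :: "(('o, 'a) laurent_obj, (('o, 'a) laurent_obj, 'a) tuple_arrow) category"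

definition tuple_cmp ::
    "nat \<Rightarrow> ('o, 'a) category \<Rightarrow> ('x, 'a) tuple_arrow \<Rightarrow> ('x, 'a) tuple_arrow \<Rightarrow> ('x, 'a) tuple_arrow" where
  "tuple_cmp n A g f =
     (fst f, (\<lambda>i\<in>{1..n}. Cmp A (fst (snd g) i) (fst (snd f) i)), snd (snd g))"

text \<open>The endomorphism \<open>\<epsilon>\<^sub>i = \<Theta>\<^sub>i\<^sup>-\<^sup>1(\<xi>\<^sub>i)\<close> of the identity functor:
  its component at \<open>V\<close> is \<open>\<Theta>\<^sub>i\<^sup>-\<^sup>1\<close> applied to \<open>\<xi>\<^sub>i : \<Theta>\<^sub>i(V) \<rightarrow> \<Theta>\<^sub>i(V)\<close>.\<close>

definition eps :: "('o, 'a) category \<Rightarrow> ('o, 'a) preseed \<Rightarrow> nat \<Rightarrow> 'o \<Rightarrow> 'a" where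
  "eps A P i V = FArr (inv_ftr A (Theta P i)) (Xi P i (FObj (Theta P i) V))"

text \<open>Standing assumption on a preseed: the inverses of all \<open>\<xi>\<^sub>i\<close> and \<open>\<epsilon>\<^sub>i\<close> exist.  They occur as soon as
  a mutation in direction \<open>i\<close> is repeated, since the inverse of \<open>\<epsilon>\<^sub>i \<circ> \<nu>\<^sub>i\<^sup>-\<^sup>1\<close> is \<open>\<nu>\<^sub>i \<circ> \<epsilon>\<^sub>i\<^sup>-\<^sup>1\<close>.
  For the preseed \<open>W0\<close> below it also makes every component \<open>\<alpha>\<^sub>i : \<Theta>\<^sub>i(M) \<rightarrow> M\<close> invertible:
  \<open>\<alpha>\<^sub>i (\<alpha>\<^sub>i\<^sup>-\<^sup>1 \<xi>\<^sub>i) = \<xi>\<^sub>i = (\<xi>\<^sub>i \<alpha>\<^sub>i\<^sup>-\<^sup>1) \<alpha>\<^sub>i\<close>, where both bracketed elements are cluster variables.\<close>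

definition inverses_exist :: "nat \<Rightarrow> ('o, 'a) category \<Rightarrow> ('o, 'a) preseed \<Rightarrow> bool" where
  "inverses_exist n A P \<longleftrightarrow>
     (\<forall>i\<in>{1..n}. \<forall>W\<in>Obj A. invertible A W W (Xi P i W) \<and> invertible A W W (eps A P i W))"

datatype side = RightSide | LeftSide

text \<open>A history is the list of mutations already applied, the latest one first.\<close>

type_synonym history = "(side \<times> nat) list"

text \<open>The \<open>k\<close>-th component of the mutation of the skew Laurent object \<open>(W, \<nu>)\<close> of \<open>S\<close>, where \<open>S\<close>
  is reached from the initial preseed \<open>P\<close> through the history \<open>w\<close>.  The new component is an arrow
  from \<open>W\<close> to \<open>\<Theta>\<^sub>k(W)\<close>, which determines the object at which \<open>\<epsilon>\<^sub>k\<close> or \<open>\<xi>\<^sub>k\<close> is evaluated.\<close>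

definition mutated_component ::
    "('o, 'a) category \<Rightarrow> ('o, 'a) preseed \<Rightarrow> history \<Rightarrow> ('o, 'a) preseed \<Rightarrow> side \<Rightarrow> nat
       \<Rightarrow> ('o, 'a) laurent_obj \<Rightarrow> 'a" where
  "mutated_component A P w S s k X =
     (let W = fst X;
          V = FObj (Theta S k) W;
          back = inv_arrow A V W (snd X k);
          e = (if even (count_list w (s, k)) then eps A P k else Xi P k)
      in case s of
           RightSide \<Rightarrow> Cmp A (e V) back
         | LeftSide \<Rightarrow> Cmp A back (e W))"

text \<open>A component \<open>\<nu>\<^sub>i : \<Theta>\<^sub>i(W) \<rightarrow> W\<close> with \<open>i \<noteq> k\<close> is left unchanged by a mutation in direction \<open>k\<close>,
  but must become an arrow to the new underlying object \<open>\<Theta>\<^sub>k(W)\<close>; this arrow is \<open>\<Theta>\<^sub>k(\<nu>\<^sub>i)\<close>.  When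
  \<open>\<Theta>\<^sub>k\<close> twists modules, \<open>\<Theta>\<^sub>k(\<nu>\<^sub>i)\<close> and \<open>\<nu>\<^sub>i\<close> are the same map.\<close>

definition mutate_object ::
    "nat \<Rightarrow> ('o, 'a) category \<Rightarrow> ('o, 'a) preseed \<Rightarrow> history \<Rightarrow> ('o, 'a) preseed \<Rightarrow> side \<Rightarrow> nat
       \<Rightarrow> ('o, 'a) laurent_obj \<Rightarrow> ('o, 'a) laurent_obj" where
  "mutate_object n A P w S s k X =
     (FObj (Theta S k) (fst X),
      (\<lambda>i\<in>{1..n}. if i = k then mutated_component A P w S s k X
                  else FArr (Theta S k) (snd X i)))"

definition mutate ::
    "nat \<Rightarrow> ('o, 'a) category \<Rightarrow> ('o, 'a) preseed \<Rightarrow> history \<Rightarrow> ('o, 'a) preseed \<Rightarrow> side \<Rightarrow> nat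
       \<Rightarrow> ('o, 'a) preseed" where
  "mutate n A P w S s k =
     (let m = mutate_object n A P w S s k in
      \<lparr>Theta = (Theta S)(k := inv_ftr A (Theta S k)),
       Xi = Xi S,
       Laurent =
         \<lparr>Obj = m ` Obj (Laurent S),
          Hom = (\<lambda>X Y. {(X, (\<lambda>i\<in>{1..n}. FArr (Theta S k) (h i)), Y) | X0 Y0 h.
                   X0 \<in> Obj (Laurent S) \<and> Y0 \<in> Obj (Laurent S) \<and> X = m X0 \<and> Y = m Y0 \<and>
                   (X0, h, Y0) \<in> Hom (Laurent S) X0 Y0}),
          Idt = (\<lambda>X. (X, (\<lambda>i\<in>{1..n}. Idt A (fst X)), X)),
          Cmp = tuple_cmp n A\<rparr>\<rparr>)"

primrec mutations ::
    "nat \<Rightarrow> ('o, 'a) category \<Rightarrow> ('o, 'a) preseed \<Rightarrow> history \<Rightarrow> ('o, 'a) preseed" where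
  "mutations n A P [] = P"
| "mutations n A P (m # w) = mutate n A P w (mutations n A P w) (fst m) (snd m)"

definition histories :: "nat \<Rightarrow> history set" where
  "histories n = {w. snd ` set w \<subseteq> {1..n}}"

text \<open>A hyperbolic object \<open>(g', M, g)\<close> is stored as \<open>(\<Theta>, g', M, g)\<close> with the tuple of functors for
  which \<open>g\<^sub>i : \<Theta>\<^sub>i(M) \<rightarrow> M\<close> and \<open>g'\<^sub>i : M \<rightarrow> \<Theta>\<^sub>i(M)\<close>.  These are the functors in the two defining
  equations of a morphism; the arrows alone do not determine them (\<open>M = 0\<close>), and without them
  morphisms would not compose.\<close>

type_synonym ('o, 'a) hyperbolic_obj = "(nat \<Rightarrow> ('o, 'a) endoftr) \<times> 'a tuple \<times> 'o \<times> 'a tuple"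
type_synonym ('o, 'a) hyperbolic_category =
  "(('o, 'a) hyperbolic_obj, (('o, 'a) hyperbolic_obj, 'a) tuple_arrow) category"

fun laurent_part :: "('o, 'a) hyperbolic_obj \<Rightarrow> ('o, 'a) laurent_obj" where
  "laurent_part (T, g', M, g) = (M, g)"

definition hyperbolic_obj ::
    "nat \<Rightarrow> ('o, 'a) category \<Rightarrow> ('o, 'a) preseed \<Rightarrow> history \<Rightarrow> side
       \<Rightarrow> ('o, 'a) laurent_obj \<Rightarrow> ('o, 'a) hyperbolic_obj" where
  "hyperbolic_obj n A P w s X =
     (let S = mutations n A P w in
      (Theta S, (\<lambda>i\<in>{1..n}. mutated_component A P w S s i X), fst X, snd X))"

text \<open>The right or left hyperbolic category of the preseed reached from \<open>P\<close> through \<open>w\<close>.\<close>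

definition hyperbolic_category_of ::
    "nat \<Rightarrow> ('o, 'a) category \<Rightarrow> ('o, 'a) preseed \<Rightarrow> history \<Rightarrow> side
       \<Rightarrow> ('o, 'a) hyperbolic_category" where
  "hyperbolic_category_of n A P w s =
     (let L = Laurent (mutations n A P w) in
      \<lparr>Obj = hyperbolic_obj n A P w s ` Obj L,
       Hom = (\<lambda>X Y. {(X, h, Y) | h.
                (laurent_part X, h, laurent_part Y) \<in> Hom L (laurent_part X) (laurent_part Y)}),
       Idt = (\<lambda>X. (X, (\<lambda>i\<in>{1..n}. Idt A (fst (laurent_part X))), X)),
       Cmp = tuple_cmp n A\<rparr>)"

definition hyperbolic_categories ::
    "nat \<Rightarrow> ('o, 'a) category \<Rightarrow> ('o, 'a) preseed \<Rightarrow> ('o, 'a) hyperbolic_category set" where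
  "hyperbolic_categories n A P =
     {hyperbolic_category_of n A P w s | w s. w \<in> histories n}"

definition hyperbolic_hom ::
    "nat \<Rightarrow> ('o, 'a) category \<Rightarrow> ('o, 'a) hyperbolic_obj \<Rightarrow> ('o, 'a) hyperbolic_obj
       \<Rightarrow> 'a tuple set" where
  "hyperbolic_hom n A X Y =
     (case (X, Y) of ((T, f', M, f), (U, g', W, g)) \<Rightarrow>
        {h. T = U \<and> h \<in> extensional {1..n} \<and>
            (\<forall>i\<in>{1..n}. h i \<in> Hom A M W \<and>
               Cmp A (FArr (T i) (h i)) (f' i) = Cmp A (g' i) (h i) \<and>
               Cmp A (h i) (f i) = Cmp A (g i) (FArr (T i) (h i)))})"

definition mutation_category ::
    "nat \<Rightarrow> ('o, 'a) category \<Rightarrow> ('o, 'a) preseed \<Rightarrow> ('o, 'a) hyperbolic_category" where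
  "mutation_category n A P =
     \<lparr>Obj = (\<Union>B\<in>hyperbolic_categories n A P. Obj B),
      Hom = (\<lambda>X Y. {(X, h, Y) | h. h \<in> hyperbolic_hom n A X Y}),
      Idt = (\<lambda>X. (X, (\<lambda>i\<in>{1..n}. Idt A (fst (laurent_part X))), X)),
      Cmp = tuple_cmp n A\<rparr>"

text \<open>In the preseed attached to a Weyl preseed, a morphism of skew Laurent objects is one module
  homomorphism \<open>h\<close>, that is the tuple \<open>(h, \<dots>, h)\<close>.  The same convention for the category of its
  hyperbolic objects: all components of a morphism are the same arrow of \<open>A\<close>.\<close>

definition constant_tuples ::
    "nat \<Rightarrow> ('x, ('x, 'a) tuple_arrow) category \<Rightarrow> ('x, ('x, 'a) tuple_arrow) category" where
  "constant_tuples n C =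
     C\<lparr>Hom := (\<lambda>X Y. {(X, h, Y) | h. (X, h, Y) \<in> Hom C X Y \<and> (\<exists>a. h = (\<lambda>i\<in>{1..n}. a))})\<rparr>"


section \<open>Weyl preseeds and Weyl cluster algebras\<close>

text \<open>The ambient skew-field is the type \<open>'d\<close>.  A division ring is an Ore domain.\<close>

definition is_subring :: "'d::ring_1 set \<Rightarrow> bool" where
  "is_subring T \<longleftrightarrow> 0 \<in> T \<and> 1 \<in> T \<and>
     (\<forall>a\<in>T. \<forall>b\<in>T. a + b \<in> T \<and> a - b \<in> T \<and> a * b \<in> T)"

definition is_skew_subfield :: "'d::division_ring set \<Rightarrow> bool" where
  "is_skew_subfield T \<longleftrightarrow> is_subring T \<and> (\<forall>a\<in>T. inverse a \<in> T)"

definition left_independent :: "'d::ring_1 set \<Rightarrow> ('i \<Rightarrow> 'd) \<Rightarrow> 'i set \<Rightarrow> bool" where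
  "left_independent S v I \<longleftrightarrow>
     (\<forall>J c. finite J \<and> J \<subseteq> I \<and> c ` J \<subseteq> S \<and> (\<Sum>j\<in>J. c j * v j) = 0 \<longrightarrow> (\<forall>j\<in>J. c j = 0))"

definition left_span :: "'d::ring_1 set \<Rightarrow> 'd set \<Rightarrow> 'd set" where
  "left_span S V = {(\<Sum>v\<in>J. c v * v) | J c. finite J \<and> J \<subseteq> V \<and> c ` J \<subseteq> S}"

definition mult_group :: "'d::ring_1 set \<Rightarrow> 'd monoid" where
  "mult_group P = \<lparr>carrier = P, mult = (*), one = 1\<rparr>"

text \<open>\<open>R = K[\<P>]\<close> is the \<open>K\<close>-span of \<open>\<P>\<close> in \<open>'d\<close>; it is the group ring because \<open>\<P>\<close> is required
  to be independent over \<open>K\<close>.\<close>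

definition group_ring :: "'d::ring_1 set \<Rightarrow> 'd set \<Rightarrow> 'd set" where
  "group_ring K P = left_span K P"

definition coefficients :: "nat \<Rightarrow> 'd::division_ring set \<Rightarrow> 'd set \<Rightarrow> (nat \<Rightarrow> 'd set) \<Rightarrow> bool" where
  "coefficients n K P F \<longleftrightarrow>
     is_skew_subfield K \<and> (\<forall>c\<in>K. \<forall>d. c * d = d * c) \<and>
     0 \<notin> P \<and> comm_group (mult_group P) \<and>
     (\<exists>B::nat set. finite B \<and> mult_group P \<cong> free_Abelian_group B) \<and>
     (\<forall>i\<in>{1..n}. finite (F i)) \<and>
     (\<Union>i\<in>{1..n}. F i) \<subseteq> P \<and> generate (mult_group P) (\<Union>i\<in>{1..n}. F i) = P \<and>
     left_independent K (\<lambda>p. p) P"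

text \<open>Commuting elements \<open>x\<^sub>1, \<dots>, x\<^sub>n\<close>, algebraically independent over \<open>R\<close> (the monomials are
  independent over \<open>R\<close>), such that \<open>'d\<close> is the smallest skew-field containing \<open>R\<close> and all \<open>x\<^sub>i\<close>.\<close>

definition var_monomial :: "nat \<Rightarrow> (nat \<Rightarrow> 'd::monoid_mult) \<Rightarrow> (nat \<Rightarrow> nat) \<Rightarrow> 'd" where
  "var_monomial n x a = prod_list (map (\<lambda>i. x i ^ a i) [1..<Suc n])"

definition free_generators :: "nat \<Rightarrow> 'd::division_ring set \<Rightarrow> (nat \<Rightarrow> 'd) \<Rightarrow> bool" where
  "free_generators n R x \<longleftrightarrow>
     (\<forall>i\<in>{1..n}. \<forall>j\<in>{1..n}. x i * x j = x j * x i) \<and>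
     left_independent R (var_monomial n x) {a. \<forall>i. i \<notin> {1..n} \<longrightarrow> a i = 0} \<and>
     is_skew_subfield hull (R \<union> x ` {1..n}) = UNIV"

definition is_cluster ::
    "nat \<Rightarrow> 'd::division_ring set \<Rightarrow> (nat \<Rightarrow> 'd set) \<Rightarrow> (nat \<Rightarrow> 'd) \<Rightarrow> bool" where
  "is_cluster n R F x \<longleftrightarrow>
     free_generators n R x \<and>
     (\<forall>i\<in>{1..n}. \<forall>j\<in>{1..n}. i \<noteq> j \<longrightarrow> (\<forall>f\<in>F j. x i * f = f * x i))"

definition group_ring_automorphism :: "'d::ring_1 set \<Rightarrow> 'd set \<Rightarrow> ('d \<Rightarrow> 'd) \<Rightarrow> bool" where
  "group_ring_automorphism K R \<phi> \<longleftrightarrow>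
     bij_betw \<phi> R R \<and> (\<forall>c\<in>K. \<phi> c = c) \<and>
     (\<forall>a\<in>R. \<forall>b\<in>R. \<phi> (a + b) = \<phi> a + \<phi> b \<and> \<phi> (a * b) = \<phi> a * \<phi> b)"

record 'd weyl_triple =
  Var :: "nat \<Rightarrow> 'd"
  Aut :: "nat \<Rightarrow> 'd \<Rightarrow> 'd"
  Bin :: "nat \<Rightarrow> 'd"

text \<open>The condition \<open>\<theta>\<^sub>i(f) = f\<close> for \<open>f \<in> F\<^sub>j\<close>, \<open>j \<noteq> i\<close>, expresses that \<open>x\<^sub>i r = \<theta>\<^sub>i(r) x\<^sub>i\<close> on all of
  \<open>R\<close>, given that \<open>x\<^sub>i\<close> commutes with \<open>F\<^sub>j\<close>; without it multiplication by \<open>x\<^sub>i\<close> is not \<open>R\<close>-linear on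
  the twisted module.  The subgroup generated by \<open>F\<^sub>i\<close> is the set of monomials in \<open>F\<^sub>i\<close>.\<close>

definition weyl_preseed ::
    "nat \<Rightarrow> 'd::division_ring set \<Rightarrow> 'd set \<Rightarrow> (nat \<Rightarrow> 'd set) \<Rightarrow> 'd weyl_triple \<Rightarrow> bool" where
  "weyl_preseed n K P F p \<longleftrightarrow>
     (let R = group_ring K P in
      is_cluster n R F (Var p) \<and>
      (\<forall>i\<in>{1..n}.
         group_ring_automorphism K R (Aut p i) \<and>
         (\<forall>f\<in>F i. Var p i * f = Aut p i f * Var p i \<and>
                  inverse (Var p i) * f = inv_into R (Aut p i) f * inverse (Var p i)) \<and>
         (\<forall>j\<in>{1..n}. j \<noteq> i \<longrightarrow> (\<forall>f\<in>F j. Aut p i f = f)) \<and>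
         (\<exists>u\<in>generate (mult_group P) (F i). \<exists>v\<in>generate (mult_group P) (F i). Bin p i = u + v)))"

definition weyl_mutate ::
    "'d::division_ring set \<Rightarrow> side \<Rightarrow> nat \<Rightarrow> 'd weyl_triple \<Rightarrow> 'd weyl_triple" where
  "weyl_mutate R s k p =
     \<lparr>Var = (Var p)(k := (case s of RightSide \<Rightarrow> Bin p k * inverse (Var p k)
                                  | LeftSide \<Rightarrow> inverse (Var p k) * Bin p k)),
      Aut = (Aut p)(k := inv_into R (Aut p k)),
      Bin = Bin p\<rparr>"

primrec weyl_mutations ::
    "'d::division_ring set \<Rightarrow> 'd weyl_triple \<Rightarrow> history \<Rightarrow> 'd weyl_triple" where
  "weyl_mutations R p [] = p"
| "weyl_mutations R p (m # w) = weyl_mutate R (fst m) (snd m) (weyl_mutations R p w)"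

definition cluster_variables ::
    "nat \<Rightarrow> 'd::division_ring set \<Rightarrow> 'd weyl_triple \<Rightarrow> 'd set" where
  "cluster_variables n R p = {Var (weyl_mutations R p w) i | w i. w \<in> histories n \<and> i \<in> {1..n}}"

definition weyl_cluster_algebra ::
    "nat \<Rightarrow> 'd::division_ring set \<Rightarrow> 'd weyl_triple \<Rightarrow> 'd set" where
  "weyl_cluster_algebra n R p = is_subring hull (R \<union> cluster_variables n R p)"


section \<open>Modules\<close>

text \<open>Left modules over a subring \<open>S\<close> of \<open>'d\<close>, with underlying set in the universe \<open>'m\<close>.  (The
  library's locale for modules requires a commutative ring.)  The fields \<open>mult\<close> and \<open>one\<close> of the
  library's record are irrelevant.\<close>

definition left_module :: "'d::ring_1 set \<Rightarrow> ('d, 'm) module \<Rightarrow> bool" where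
  "left_module S M \<longleftrightarrow>
     abelian_group M \<and>
     (\<forall>r\<in>S. \<forall>m\<in>carrier M. r \<odot>\<^bsub>M\<^esub> m \<in> carrier M) \<and>
     (\<forall>r\<in>S. \<forall>m\<in>carrier M. \<forall>m'\<in>carrier M.
        r \<odot>\<^bsub>M\<^esub> (m \<oplus>\<^bsub>M\<^esub> m') = r \<odot>\<^bsub>M\<^esub> m \<oplus>\<^bsub>M\<^esub> r \<odot>\<^bsub>M\<^esub> m') \<and>
     (\<forall>r\<in>S. \<forall>r'\<in>S. \<forall>m\<in>carrier M.
        (r + r') \<odot>\<^bsub>M\<^esub> m = r \<odot>\<^bsub>M\<^esub> m \<oplus>\<^bsub>M\<^esub> r' \<odot>\<^bsub>M\<^esub> m \<and>
        (r * r') \<odot>\<^bsub>M\<^esub> m = r \<odot>\<^bsub>M\<^esub> (r' \<odot>\<^bsub>M\<^esub> m)) \<and>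
     (\<forall>m\<in>carrier M. 1 \<odot>\<^bsub>M\<^esub> m = m)"

definition module_maps ::
    "'d::ring_1 set \<Rightarrow> ('d, 'm) module \<Rightarrow> ('d, 'm) module \<Rightarrow> ('m \<Rightarrow> 'm) set" where
  "module_maps S M N =
     {h \<in> carrier M \<rightarrow>\<^sub>E carrier N.
        (\<forall>m\<in>carrier M. \<forall>m'\<in>carrier M. h (m \<oplus>\<^bsub>M\<^esub> m') = h m \<oplus>\<^bsub>N\<^esub> h m') \<and>
        (\<forall>r\<in>S. \<forall>m\<in>carrier M. h (r \<odot>\<^bsub>M\<^esub> m) = r \<odot>\<^bsub>N\<^esub> h m)}"

type_synonym ('d, 'm) module_arrow = "('d, 'm) module \<times> ('m \<Rightarrow> 'm) \<times> ('d, 'm) module"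
type_synonym ('d, 'm) module_category = "(('d, 'm) module, ('d, 'm) module_arrow) category"
type_synonym ('d, 'm) module_preseed = "(('d, 'm) module, ('d, 'm) module_arrow) preseed"

definition modules_over :: "'d::ring_1 set \<Rightarrow> ('d, 'm) module_category" where
  "modules_over S =
     \<lparr>Obj = {M. left_module S M},
      Hom = (\<lambda>M N. {(M, h, N) | h. h \<in> module_maps S M N}),
      Idt = (\<lambda>M. (M, (\<lambda>m\<in>carrier M. m), M)),
      Cmp = (\<lambda>g f. (fst f, compose (carrier (fst f)) (fst (snd g)) (fst (snd f)), snd (snd g)))\<rparr>"

definition with_action :: "'d set \<Rightarrow> ('d \<Rightarrow> 'm \<Rightarrow> 'm) \<Rightarrow> ('d, 'm) module \<Rightarrow> ('d, 'm) module" where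
  "with_action R act M =
     M\<lparr>smult := (\<lambda>r m. if r \<in> R \<and> m \<in> carrier M then act r m else undefined)\<rparr>"

text \<open>\<open>\<psi>\<^sub>*\<close> on objects: the action is cut down to \<open>R\<close>, so that modules over the cluster algebra with
  the same underlying \<open>R\<close>-module have the same image.\<close>

definition forget_to :: "'d set \<Rightarrow> ('d, 'm) module \<Rightarrow> ('d, 'm) module" where
  "forget_to R M = with_action R (smult M) M"

definition A_cat :: "nat \<Rightarrow> 'd::division_ring set \<Rightarrow> 'd weyl_triple \<Rightarrow> ('d, 'm) module_category" where
  "A_cat n R p = (modules_over R)\<lparr>Obj := forget_to R ` Obj (modules_over (weyl_cluster_algebra n R p))\<rparr>"

text \<open>The auto-equivalence induced by \<open>\<theta>\<^sub>i\<close>, extensional on \<open>A_cat n R p\<close>.\<close>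

definition twist :: "'d set \<Rightarrow> ('d \<Rightarrow> 'd) \<Rightarrow> ('d, 'm) module \<Rightarrow> ('d, 'm) module" where
  "twist R \<phi> M = with_action R (\<lambda>r m. inv_into R \<phi> r \<odot>\<^bsub>M\<^esub> m) M"

definition twist_ftr ::
    "nat \<Rightarrow> 'd::division_ring set \<Rightarrow> 'd weyl_triple \<Rightarrow> nat
       \<Rightarrow> (('d, 'm) module, ('d, 'm) module_arrow) endoftr" where
  "twist_ftr n R p i =
     \<lparr>FObj = restrict (twist R (Aut p i)) (Obj (A_cat n R p)),
      FArr = restrict (\<lambda>(M, h, N). (twist R (Aut p i) M, h, twist R (Aut p i) N)) (Arr (A_cat n R p))\<rparr>"

definition action_map :: "('d, 'm) module \<Rightarrow> 'd \<Rightarrow> 'm \<Rightarrow> 'm" where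
  "action_map M d = (\<lambda>m\<in>carrier M. d \<odot>\<^bsub>M\<^esub> m)"

text \<open>The pair \<open>(M, \<alpha>-bar)\<close> given by a module \<open>N\<close> over the cluster algebra, \<open>M = \<psi>\<^sub>*(N)\<close>.\<close>

definition alpha_obj ::
    "nat \<Rightarrow> 'd::division_ring set \<Rightarrow> 'd weyl_triple \<Rightarrow> ('d, 'm) module
       \<Rightarrow> (('d, 'm) module, ('d, 'm) module_arrow) laurent_obj" where
  "alpha_obj n R p N =
     (forget_to R N,
      (\<lambda>i\<in>{1..n}. (twist R (Aut p i) (forget_to R N), action_map N (Var p i), forget_to R N)))"

definition W0 :: "nat \<Rightarrow> 'd::division_ring set \<Rightarrow> 'd weyl_triple \<Rightarrow> ('d, 'm) module_preseed" where
  "W0 n R p =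
     (let H = weyl_cluster_algebra n R p in
      \<lparr>Theta = twist_ftr n R p,
       Xi = (\<lambda>i M. (M, action_map M (Bin p i), M)),
       Laurent =
         \<lparr>Obj = alpha_obj n R p ` Obj (modules_over H),
          Hom = (\<lambda>X Y. {(X, (\<lambda>i\<in>{1..n}. (fst X, h, fst Y)), Y) | h N N'.
                   left_module H N \<and> left_module H N' \<and>
                   X = alpha_obj n R p N \<and> Y = alpha_obj n R p N' \<and> h \<in> module_maps H N N'}),
          Idt = (\<lambda>X. (X, (\<lambda>i\<in>{1..n}. Idt (modules_over R) (fst X)), X)),
          Cmp = tuple_cmp n (modules_over R)\<rparr>\<rparr>)"

definition clustered_category ::
    "nat \<Rightarrow> ('d, 'm) module_category \<Rightarrow> ('d, 'm) module_preseed
       \<Rightarrow> (('d, 'm) module, ('d, 'm) module_arrow) hyperbolic_category" where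
  "clustered_category n A W = constant_tuples n (mutation_category n A W)"

end

theory Submission
  imports Defs
begin

text \<open>The family of all right and left hyperbolic categories, one for each sequence of mutations and each
  side, has the required properties.  It covers all hyperbolic objects by definition, so the
  content is that each member is a full subcategory of the clustered category and is equivalent
  to the category of modules over the cluster algebra \<open>H\<close>.

  The part about mutations holds for any category \<open>A\<close> with commuting automorphisms \<open>\<Theta>\<^sub>i\<close> and natural
  automorphisms \<open>\<xi>\<^sub>i\<close>, \<open>\<epsilon>\<^sub>i\<close> of the identity.  A mutation replaces a component \<open>\<nu>\<close> by \<open>e \<circ> \<nu>\<^sup>-\<^sup>1\<close> or \<open>\<nu>\<^sup>-\<^sup>1 \<circ> e\<close>
  with \<open>e\<close> one of these natural automorphisms.  Hence an arrow of \<open>A\<close> is compatible with the old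
  component if and only if it is compatible with the new one, whatever \<open>e\<close> and the side are
  (\<open>mutated_component_square\<close>).  It follows that a mutation induces a fully faithful functor onto the mutated skew Laurent
  category (\<open>mutation_ftr_ff_onto\<close>).  It also follows that in a hyperbolic object the condition on the
  components \<open>g'\<^sub>i\<close> is implied by the one on \<open>g\<^sub>i\<close>, which gives fullness (\<open>hyperbolic_full_subcategory\<close>) and a
  fully faithful functor from the skew Laurent category onto the hyperbolic one (\<open>hyp_ftr_ff_onto\<close>).

  It remains to compare the initial skew Laurent category with the category of \<open>H\<close>-modules.  As \<open>\<xi>\<^sub>i\<close> acts
  bijectively on every \<open>H\<close>-module, the exchange relations force all cluster variables to act
  bijectively (\<open>cv_bij\<close>), and determine their actions from those of \<open>R\<close> and of the initial
  variables.  So an \<open>R\<close>-linear map that commutes with the initial variables is \<open>H\<close>-linear (\<open>H_linear\<close>), and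
  sending a module to the object built from the initial variables is fully faithful (\<open>alpha_ftr_ff_onto\<close>).
  That the twists are automorphisms of \<open>A\<close> at all is due to the bijectivity of the initial variables,
  too (\<open>twist_in_A\<close>).

  Every hyperbolic category thus receives a fully faithful functor from the \<open>H\<close>-modules that is onto on objects,
  and two categories with such functors from a common source are equivalent
  (\<open>equivalent_if_common_source\<close>).\<close>


section \<open>Small categories and functors\<close>

locale small_category =
  fixes C :: "('o, 'a) category"
  assumes category: "is_category C"
begin

lemma idt_hom [intro]: "x \<in> Obj C \<Longrightarrow> Idt C x \<in> Hom C x x"
  using category by (simp add: is_category_def)

lemma cmp_hom [intro]:
  "\<lbrakk>x \<in> Obj C; y \<in> Obj C; z \<in> Obj C; f \<in> Hom C x y; g \<in> Hom C y z\<rbrakk> \<Longrightarrow> Cmp C g f \<in> Hom C x z"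
  using category unfolding is_category_def by blast

lemma cmp_idt:
  assumes "x \<in> Obj C" "y \<in> Obj C" "f \<in> Hom C x y"
  shows "Cmp C f (Idt C x) = f" "Cmp C (Idt C y) f = f"
  using category assms unfolding is_category_def by blast+

lemma cmp_assoc:
  "\<lbrakk>w \<in> Obj C; x \<in> Obj C; y \<in> Obj C; z \<in> Obj C; f \<in> Hom C w x; g \<in> Hom C x y; h \<in> Hom C y z\<rbrakk>
    \<Longrightarrow> Cmp C h (Cmp C g f) = Cmp C (Cmp C h g) f"
  using category unfolding is_category_def by blast

lemma hom_disjoint:
  "\<lbrakk>x \<in> Obj C; y \<in> Obj C; x' \<in> Obj C; y' \<in> Obj C; f \<in> Hom C x y; f \<in> Hom C x' y'\<rbrakk> \<Longrightarrow> x = x' \<and> y = y'"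
  using category unfolding is_category_def by (metis IntI empty_iff)

lemma hom_arr: "\<lbrakk>x \<in> Obj C; y \<in> Obj C; f \<in> Hom C x y\<rbrakk> \<Longrightarrow> f \<in> Arr C"
  unfolding Arr_def by blast

lemma inverse_arrows_sym: "inverse_arrows C x y f g \<Longrightarrow> inverse_arrows C y x g f"
  by (auto simp: inverse_arrows_def)

lemma inverse_arrows_unique:
  assumes "x \<in> Obj C" "y \<in> Obj C" "inverse_arrows C x y f g" "inverse_arrows C x y f g'"
  shows "g = g'"
proof -
  have "g = Cmp C g (Cmp C f g')"
    using assms cmp_idt(1)[of y x g] by (simp add: inverse_arrows_def)
  also have "\<dots> = Cmp C (Cmp C g f) g'"
    using assms by (intro cmp_assoc[of y x y x]) (auto simp: inverse_arrows_def)
  also have "\<dots> = g'"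
    using assms cmp_idt(2)[of y x g'] by (simp add: inverse_arrows_def)
  finally show ?thesis .
qed

lemma inverse_arrows_inv_arrow:
  assumes "x \<in> Obj C" "y \<in> Obj C" "invertible C x y f"
  shows "inverse_arrows C x y f (inv_arrow C x y f)"
proof -
  obtain g where g: "inverse_arrows C x y f g"
    using assms(3) by (auto simp: invertible_def)
  show ?thesis
    unfolding inv_arrow_def
    by (rule theI[of _ g]) (use g assms inverse_arrows_unique in blast)+
qed

lemma inverse_arrows_cmp:
  assumes o: "x \<in> Obj C" "y \<in> Obj C" "z \<in> Obj C"
    and f: "inverse_arrows C x y f f'" and g: "inverse_arrows C y z g g'"
  shows "inverse_arrows C x z (Cmp C g f) (Cmp C f' g')"
proof -
  have h: "f \<in> Hom C x y" "f' \<in> Hom C y x" "g \<in> Hom C y z" "g' \<in> Hom C z y"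
    and e: "Cmp C f' f = Idt C x" "Cmp C f f' = Idt C y" "Cmp C g' g = Idt C y" "Cmp C g g' = Idt C z"
    using f g by (auto simp: inverse_arrows_def)
  have "Cmp C (Cmp C f' g') (Cmp C g f) = Cmp C f' (Cmp C (Cmp C g' g) f)"
    using o h cmp_assoc[of x z y x "Cmp C g f" g' f'] cmp_assoc[of x y z y f g g'] cmp_hom[of x y z f g]
    by simp
  moreover have "Cmp C (Cmp C g f) (Cmp C f' g') = Cmp C g (Cmp C (Cmp C f f') g')"
    using o h cmp_assoc[of z x y z "Cmp C f' g'" f g] cmp_assoc[of z y x y g' f' f] cmp_hom[of z y x g' f']
    by simp
  ultimately show ?thesis
    using o h e cmp_idt[of x y f] cmp_idt[of z y g'] unfolding inverse_arrows_def by auto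
qed

lemma invertible_cmp:
  "\<lbrakk>x \<in> Obj C; y \<in> Obj C; z \<in> Obj C; invertible C x y f; invertible C y z g\<rbrakk>
    \<Longrightarrow> invertible C x z (Cmp C g f)"
  unfolding invertible_def using inverse_arrows_cmp by blast

lemma invertible_inv_arrow:
  "\<lbrakk>x \<in> Obj C; y \<in> Obj C; invertible C x y f\<rbrakk> \<Longrightarrow> invertible C y x (inv_arrow C x y f)"
  using inverse_arrows_inv_arrow inverse_arrows_sym unfolding invertible_def by blast

lemma invertible_hom: "invertible C x y f \<Longrightarrow> f \<in> Hom C x y"
  unfolding invertible_def inverse_arrows_def by blast

lemma cancel_left:
  assumes "x \<in> Obj C" "y \<in> Obj C" "z \<in> Obj C" "invertible C y z e" "u \<in> Hom C x y" "v \<in> Hom C x y"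
  shows "Cmp C e u = Cmp C e v \<longleftrightarrow> u = v"
proof -
  obtain d where d: "inverse_arrows C y z e d"
    using assms by (auto simp: invertible_def)
  have "Cmp C d (Cmp C e w) = w" if "w \<in> Hom C x y" for w
    using that assms(1-3) d cmp_assoc[of x y z y w e d] cmp_idt(2)[of x y w] by (simp add: inverse_arrows_def)
  then show ?thesis using assms by metis
qed

lemma cancel_right:
  assumes "x \<in> Obj C" "y \<in> Obj C" "z \<in> Obj C" "invertible C x y e" "u \<in> Hom C y z" "v \<in> Hom C y z"
  shows "Cmp C u e = Cmp C v e \<longleftrightarrow> u = v"
proof -
  obtain d where d: "inverse_arrows C x y e d"
    using assms by (auto simp: invertible_def)
  have "Cmp C (Cmp C w e) d = w" if "w \<in> Hom C y z" for w
    using that assms(1-3) d cmp_assoc[of y x y z d e w] cmp_idt(1)[of y z w] by (simp add: inverse_arrows_def)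
  then show ?thesis using assms by metis
qed

text \<open>Mutation inverts the component \<open>\<nu>\<close> of a skew Laurent object; this equivalence carries the
  compatibility of an arrow with \<open>\<nu>\<close> over to the inverse \<open>\<mu>\<close>.\<close>

lemma invert_square:
  assumes o: "V \<in> Obj C" "W \<in> Obj C" "V' \<in> Obj C" "W' \<in> Obj C"
    and \<nu>: "inverse_arrows C V W \<nu> \<mu>" "inverse_arrows C V' W' \<nu>' \<mu>'"
    and ab: "a \<in> Hom C W W'" "b \<in> Hom C V V'"
  shows "Cmp C b \<mu> = Cmp C \<mu>' a \<longleftrightarrow> Cmp C a \<nu> = Cmp C \<nu>' b"
proof -
  have h: "\<nu> \<in> Hom C V W" "\<mu> \<in> Hom C W V" "\<nu>' \<in> Hom C V' W'" "\<mu>' \<in> Hom C W' V'"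
    and e: "Cmp C \<mu> \<nu> = Idt C V" "Cmp C \<nu> \<mu> = Idt C W"
      "Cmp C \<mu>' \<nu>' = Idt C V'" "Cmp C \<nu>' \<mu>' = Idt C W'"
    using \<nu> by (auto simp: inverse_arrows_def)
  have inv: "invertible C V W \<nu>" "invertible C V' W' \<nu>'"
    using \<nu> by (auto simp: invertible_def)
  have "Cmp C b \<mu> = Cmp C \<mu>' a \<longleftrightarrow> Cmp C \<nu>' (Cmp C (Cmp C b \<mu>) \<nu>) = Cmp C \<nu>' (Cmp C (Cmp C \<mu>' a) \<nu>)"
    using o h ab inv cancel_left[of V V' W' \<nu>' "Cmp C (Cmp C b \<mu>) \<nu>" "Cmp C (Cmp C \<mu>' a) \<nu>"]
      cancel_right[of V W V' \<nu> "Cmp C b \<mu>" "Cmp C \<mu>' a"] by (auto 4 3)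
  also have "Cmp C \<nu>' (Cmp C (Cmp C b \<mu>) \<nu>) = Cmp C \<nu>' b"
    using o h ab e cmp_assoc[of V W V V' \<nu> \<mu> b] cmp_idt(1)[of V V' b] by simp
  also have "Cmp C \<nu>' (Cmp C (Cmp C \<mu>' a) \<nu>) = Cmp C a \<nu>"
    using o h ab e cmp_assoc[of V W W' V' \<nu> a \<mu>'] cmp_assoc[of V W' V' W' "Cmp C a \<nu>" \<mu>' \<nu>']
      cmp_idt(2)[of V W' "Cmp C a \<nu>"] cmp_hom[of V W W' \<nu> a] by simp
  finally show ?thesis by metis
qed

end

lemma functorD:
  assumes "is_functor C D T"
  shows "x \<in> Obj C \<Longrightarrow> FObj T x \<in> Obj D"
    and "\<lbrakk>x \<in> Obj C; y \<in> Obj C; f \<in> Hom C x y\<rbrakk> \<Longrightarrow> FArr T f \<in> Hom D (FObj T x) (FObj T y)"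
    and "x \<in> Obj C \<Longrightarrow> FArr T (Idt C x) = Idt D (FObj T x)"
    and "\<lbrakk>x \<in> Obj C; y \<in> Obj C; z \<in> Obj C; f \<in> Hom C x y; g \<in> Hom C y z\<rbrakk>
      \<Longrightarrow> FArr T (Cmp C g f) = Cmp D (FArr T g) (FArr T f)"
  using assms unfolding is_functor_def by blast+

lemma is_functor_comp:
  assumes "is_functor C D T" "is_functor D E S"
  shows "is_functor C E (comp_ftr S T)"
proof -
  note T = functorD[OF assms(1)] and S = functorD[OF assms(2)]
  show ?thesis
    unfolding is_functor_def[of C E]
  proof (intro conjI ballI)
    fix x y z f g
    assume o: "x \<in> Obj C" "y \<in> Obj C" "z \<in> Obj C" and h: "f \<in> Hom C x y" "g \<in> Hom C y z"
    show "FArr (comp_ftr S T) (Cmp C g f) = Cmp E (FArr (comp_ftr S T) g) (FArr (comp_ftr S T) f)"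
      using S(4)[OF T(1)[OF o(1)] T(1)[OF o(2)] T(1)[OF o(3)] T(2)[OF o(1,2) h(1)] T(2)[OF o(2,3) h(2)]]
        T(4)[OF o h] by (simp add: comp_ftr_def)
  qed (use S T in \<open>simp_all add: comp_ftr_def\<close>)
qed

lemma functor_inverse_arrows:
  assumes "is_functor C D T" "x \<in> Obj C" "y \<in> Obj C" "inverse_arrows C x y f g"
  shows "inverse_arrows D (FObj T x) (FObj T y) (FArr T f) (FArr T g)"
  using assms functorD[OF assms(1)] unfolding inverse_arrows_def by metis

lemma functor_invertible:
  "\<lbrakk>is_functor C D T; x \<in> Obj C; y \<in> Obj C; invertible C x y f\<rbrakk>
    \<Longrightarrow> invertible D (FObj T x) (FObj T y) (FArr T f)"
  unfolding invertible_def using functor_inverse_arrows by meson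


section \<open>Functors that are full, faithful and onto objects\<close>

text \<open>All equivalences of the theorem come from functors of this kind.  The categories involved are obtained
  from one another by a map that is onto on objects but may identify some of them: two
  modules over a ring with equal actions of the ring are different records if the action
  outside the ring differs.  Isomorphism of categories would therefore be too much to ask.\<close>

definition ff_onto :: "('o, 'a) category \<Rightarrow> ('p, 'b) category \<Rightarrow> ('o, 'a, 'p, 'b) ftr \<Rightarrow> bool" where
  "ff_onto D C F \<longleftrightarrow> is_category D \<and> is_category C \<and> is_functor D C F \<and> FObj F ` Obj D = Obj C \<and>
     (\<forall>x\<in>Obj D. \<forall>y\<in>Obj D. bij_betw (FArr F) (Hom D x y) (Hom C (FObj F x) (FObj F y)))"

lemma ff_onto_id: "is_category C \<Longrightarrow> ff_onto C C id_ftr"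
  unfolding ff_onto_def is_functor_def id_ftr_def by (simp add: bij_betw_def)

lemma ff_onto_comp:
  assumes "ff_onto D C F" "ff_onto C B G"
  shows "ff_onto D B (comp_ftr G F)"
proof -
  have "bij_betw (FArr G \<circ> FArr F) (Hom D x y) (Hom B (FObj G (FObj F x)) (FObj G (FObj F y)))"
    if "x \<in> Obj D" "y \<in> Obj D" for x y
    using that assms functorD(1) unfolding ff_onto_def by (metis bij_betw_trans)
  moreover have "(\<lambda>x. FObj G (FObj F x)) ` Obj D = Obj B"
    using assms unfolding ff_onto_def by (metis image_image)
  ultimately show ?thesis
    using assms is_functor_comp[of D C F B G] unfolding ff_onto_def
    by (simp add: comp_ftr_def o_def)
qed

text \<open>Objects go to a chosen preimage and arrows to their unique lift.  The source and the target of the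
  lift need not be passed as arguments, since an arrow of \<open>C\<close> determines its own.\<close>

definition section_ftr :: "('p, 'b) category \<Rightarrow> ('o, 'a) category \<Rightarrow> ('p, 'b, 'o, 'a) ftr \<Rightarrow> ('o, 'a, 'p, 'b) ftr" where
  "section_ftr D C F =
     (let s = inv_into (Obj D) (FObj F) in
      \<lparr>FObj = s,
       FArr = (\<lambda>f. SOME g. \<exists>x\<in>Obj C. \<exists>y\<in>Obj C. g \<in> Hom D (s x) (s y) \<and> FArr F g = f)\<rparr>)"

locale ff_onto_functor =
  fixes D :: "('p, 'b) category" and C :: "('o, 'a) category" and F :: "('p, 'b, 'o, 'a) ftr"
  assumes ff_onto: "ff_onto D C F"
begin

sublocale D: small_category D by standard (use ff_onto in \<open>simp add: ff_onto_def\<close>)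
sublocale C: small_category C by standard (use ff_onto in \<open>simp add: ff_onto_def\<close>)

abbreviation sec where "sec \<equiv> section_ftr D C F"

lemma F: "is_functor D C F"
  using ff_onto by (simp add: ff_onto_def)

lemma bij: "x \<in> Obj D \<Longrightarrow> y \<in> Obj D \<Longrightarrow> bij_betw (FArr F) (Hom D x y) (Hom C (FObj F x) (FObj F y))"
  using ff_onto by (simp add: ff_onto_def)

lemma faithful:
  "\<lbrakk>x \<in> Obj D; y \<in> Obj D; f \<in> Hom D x y; g \<in> Hom D x y; FArr F f = FArr F g\<rbrakk> \<Longrightarrow> f = g"
  using bij unfolding bij_betw_def inj_on_def by blast

lemma full:
  assumes "x \<in> Obj D" "y \<in> Obj D" "f \<in> Hom C (FObj F x) (FObj F y)"
  obtains g where "g \<in> Hom D x y" "FArr F g = f"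
proof -
  have "f \<in> FArr F ` Hom D x y"
    using bij_betw_imp_surj_on[OF bij] assms by simp
  then show thesis using that by blast
qed

lemma sec_obj: "x \<in> Obj C \<Longrightarrow> FObj sec x \<in> Obj D" "x \<in> Obj C \<Longrightarrow> FObj F (FObj sec x) = x"
  using ff_onto unfolding ff_onto_def section_ftr_def Let_def
  by (simp_all add: inv_into_into f_inv_into_f)

lemma sec_arr:
  assumes "x \<in> Obj C" "y \<in> Obj C" "f \<in> Hom C x y"
  shows "FArr sec f \<in> Hom D (FObj sec x) (FObj sec y)" "FArr F (FArr sec f) = f"
proof -
  let ?P = "\<lambda>g. \<exists>x\<in>Obj C. \<exists>y\<in>Obj C. g \<in> Hom D (FObj sec x) (FObj sec y) \<and> FArr F g = f"
  have "\<exists>g. ?P g"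
    using assms sec_obj full by metis
  then have "?P (SOME g. ?P g)" by (rule someI_ex)
  moreover have "FArr sec f = (SOME g. ?P g)"
    by (simp add: section_ftr_def Let_def)
  ultimately have "?P (FArr sec f)" by simp
  then obtain x' y' where xy: "x' \<in> Obj C" "y' \<in> Obj C"
      and g: "FArr sec f \<in> Hom D (FObj sec x') (FObj sec y')" and lift: "FArr F (FArr sec f) = f" by blast
  have "f \<in> Hom C x' y'"
    using functorD(2)[OF F, of "FObj sec x'" "FObj sec y'" "FArr sec f"] xy g lift sec_obj by simp
  then show "FArr sec f \<in> Hom D (FObj sec x) (FObj sec y)" "FArr F (FArr sec f) = f"
    using C.hom_disjoint[of x y x' y' f] xy assms g lift by auto
qed

lemma sec_functor: "is_functor C D sec"
  unfolding is_functor_def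
proof (intro conjI ballI)
  fix x assume x: "x \<in> Obj C"
  show "FArr sec (Idt C x) = Idt D (FObj sec x)"
    using x sec_obj[OF x] sec_arr[of x x "Idt C x"] C.idt_hom[OF x] D.idt_hom[OF sec_obj(1)[OF x]]
      functorD(3)[OF F sec_obj(1)[OF x]]
    by (intro faithful[of "FObj sec x" "FObj sec x"]) simp_all
next
  fix x y z f g
  assume o: "x \<in> Obj C" "y \<in> Obj C" "z \<in> Obj C" and h: "f \<in> Hom C x y" "g \<in> Hom C y z"
  note fs = sec_arr[OF o(1,2) h(1)] and gs = sec_arr[OF o(2,3) h(2)]
    and gf = sec_arr[OF o(1,3) C.cmp_hom[OF o h]]
  show "FArr sec (Cmp C g f) = Cmp D (FArr sec g) (FArr sec f)"
    using o sec_obj fs gs gf D.cmp_hom[OF sec_obj(1)[OF o(1)] sec_obj(1)[OF o(2)] sec_obj(1)[OF o(3)] fs(1) gs(1)]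
      functorD(4)[OF F sec_obj(1)[OF o(1)] sec_obj(1)[OF o(2)] sec_obj(1)[OF o(3)] fs(1) gs(1)]
    by (intro faithful[of "FObj sec x" "FObj sec z"]) simp_all
qed (use sec_obj sec_arr in auto)

text \<open>An object \<open>d\<close> and the chosen preimage of \<open>F(d)\<close> have the same image; the lift of the identity
  of \<open>F(d)\<close> is a natural isomorphism between them.\<close>

lemma unit:
  obtains j j' where "natural_iso D D id_ftr (comp_ftr sec F) j" "natural_iso D D (comp_ftr sec F) id_ftr j'"
proof -
  let ?s = "\<lambda>d. FObj sec (FObj F d)"
  have s: "?s d \<in> Obj D" "FObj F (?s d) = FObj F d" if "d \<in> Obj D" for d
    using that sec_obj functorD(1)[OF F] by auto
  have "\<exists>j. j \<in> Hom D d (?s d) \<and> FArr F j = Idt C (FObj F d)" if "d \<in> Obj D" for d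
    using full[of d "?s d" "Idt C (FObj F d)"] that s C.idt_hom functorD(1)[OF F] by metis
  then obtain j where j: "j d \<in> Hom D d (?s d)" "FArr F (j d) = Idt C (FObj F d)" if "d \<in> Obj D" for d
    by metis
  have "\<exists>j. j \<in> Hom D (?s d) d \<and> FArr F j = Idt C (FObj F d)" if "d \<in> Obj D" for d
    using full[of "?s d" d "Idt C (FObj F d)"] that s C.idt_hom functorD(1)[OF F] by metis
  then obtain j' where j': "j' d \<in> Hom D (?s d) d" "FArr F (j' d) = Idt C (FObj F d)" if "d \<in> Obj D" for d
    by metis
  have inv: "inverse_arrows D d (?s d) (j d) (j' d)" if d: "d \<in> Obj D" for d
  proof -
    note o = functorD(1)[OF F d]
    have "Cmp D (j' d) (j d) = Idt D d"
      using d s[OF d] j[OF d] j'[OF d] o functorD(3,4)[OF F] C.cmp_idt(1)[OF o o] C.idt_hom[OF o]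
      by (intro faithful[of d d]) auto
    moreover have "Cmp D (j d) (j' d) = Idt D (?s d)"
      using d s[OF d] j[OF d] j'[OF d] o functorD(3,4)[OF F] C.cmp_idt(1)[OF o o] C.idt_hom[OF o]
      by (intro faithful[of "?s d" "?s d"]) auto
    ultimately show ?thesis
      using j[OF d] j'[OF d] by (simp add: inverse_arrows_def)
  qed
  have nat: "Cmp D (j y) f = Cmp D (FArr sec (FArr F f)) (j x)"
      "Cmp D (j' y) (FArr sec (FArr F f)) = Cmp D f (j' x)"
    if o: "x \<in> Obj D" "y \<in> Obj D" and f: "f \<in> Hom D x y" for x y f
  proof -
    note Fo = functorD(1)[OF F o(1)] functorD(1)[OF F o(2)] and Ff = functorD(2)[OF F o f]
    note sf = sec_arr[OF Fo Ff]
    show "Cmp D (j y) f = Cmp D (FArr sec (FArr F f)) (j x)"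
      using o f s j Fo Ff sf C.cmp_idt[OF Fo Ff]
        functorD(4)[OF F, of x y "?s y" f "j y"] functorD(4)[OF F, of x "?s x" "?s y" "j x" "FArr sec (FArr F f)"]
        D.cmp_hom[of x y "?s y" f "j y"] D.cmp_hom[of x "?s x" "?s y" "j x" "FArr sec (FArr F f)"]
      by (intro faithful[of x "?s y"]) simp_all
    show "Cmp D (j' y) (FArr sec (FArr F f)) = Cmp D f (j' x)"
      using o f s j' Fo Ff sf C.cmp_idt[OF Fo Ff]
        functorD(4)[OF F, of "?s x" x y "j' x" f] functorD(4)[OF F, of "?s x" "?s y" y "FArr sec (FArr F f)" "j' y"]
        D.cmp_hom[of "?s x" x y "j' x" f] D.cmp_hom[of "?s x" "?s y" y "FArr sec (FArr F f)" "j' y"]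
      by (intro faithful[of "?s x" y]) simp_all
  qed
  have "natural_iso D D id_ftr (comp_ftr sec F) j"
    using inv nat(1) unfolding natural_iso_def id_ftr_def comp_ftr_def invertible_def by auto
  moreover have "natural_iso D D (comp_ftr sec F) id_ftr j'"
    using inv nat(2) D.inverse_arrows_sym unfolding natural_iso_def id_ftr_def comp_ftr_def invertible_def
    by (metis comp_apply ftr.select_convs(1,2))
  ultimately show thesis by (rule that)
qed

end

lemma natural_iso_whisker:
  assumes F: "is_functor D C F" and U: "is_functor C D U" and t: "natural_iso D D S T \<tau>"
    and S: "is_functor D D S" and T: "is_functor D D T"
  shows "natural_iso C C (comp_ftr F (comp_ftr S U)) (comp_ftr F (comp_ftr T U)) (\<lambda>x. FArr F (\<tau> (FObj U x)))"
  unfolding natural_iso_def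
proof (intro conjI ballI)
  fix x assume "x \<in> Obj C"
  then show "invertible C (FObj (comp_ftr F (comp_ftr S U)) x) (FObj (comp_ftr F (comp_ftr T U)) x) (FArr F (\<tau> (FObj U x)))"
    using functor_invertible[OF F] t functorD(1)[OF U] functorD(1)[OF S] functorD(1)[OF T]
    unfolding natural_iso_def comp_ftr_def by simp
next
  fix x y f assume o: "x \<in> Obj C" "y \<in> Obj C" and f: "f \<in> Hom C x y"
  let ?x = "FObj U x" and ?y = "FObj U y" and ?f = "FArr U f"
  have Uo: "?x \<in> Obj D" "?y \<in> Obj D" and Uf: "?f \<in> Hom D ?x ?y"
    using functorD(1,2)[OF U] o f by auto
  have \<tau>: "\<tau> z \<in> Hom D (FObj S z) (FObj T z)" if "z \<in> Obj D" for z
    using t that unfolding natural_iso_def invertible_def inverse_arrows_def by blast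
  have "FArr F (Cmp D (\<tau> ?y) (FArr S ?f)) = FArr F (Cmp D (FArr T ?f) (\<tau> ?x))"
    using t Uo Uf unfolding natural_iso_def by metis
  then show "Cmp C (FArr F (\<tau> ?y)) (FArr (comp_ftr F (comp_ftr S U)) f) =
        Cmp C (FArr (comp_ftr F (comp_ftr T U)) f) (FArr F (\<tau> ?x))"
    using Uo Uf \<tau> functorD(1,2)[OF S] functorD(1,2)[OF T]
      functorD(4)[OF F, of "FObj S ?x" "FObj S ?y" "FObj T ?y" "FArr S ?f" "\<tau> ?y"]
      functorD(4)[OF F, of "FObj S ?x" "FObj T ?x" "FObj T ?y" "\<tau> ?x" "FArr T ?f"]
    by (simp add: comp_ftr_def)
qed

lemma natural_iso_cong:
  assumes "natural_iso C D S T \<tau>"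
    and "\<And>x. x \<in> Obj C \<Longrightarrow> FObj S x = FObj S' x" "\<And>x. x \<in> Obj C \<Longrightarrow> FObj T x = FObj T' x"
    and "\<And>x y f. \<lbrakk>x \<in> Obj C; y \<in> Obj C; f \<in> Hom C x y\<rbrakk> \<Longrightarrow> FArr S f = FArr S' f \<and> FArr T f = FArr T' f"
  shows "natural_iso C D S' T' \<tau>"
  using assms unfolding natural_iso_def by metis

text \<open>Two quotients of the same category \<open>D\<close> in this sense are equivalent: go from the first to \<open>D\<close> by the
  section and on to the second by the given functor.  The two composites differ from the
  identity by images of the natural isomorphisms \<open>id \<cong> sec \<circ> F\<close> on \<open>D\<close>.\<close>

lemma equivalent_if_common_source:
  assumes "ff_onto D C F" "ff_onto D B G"
  shows "equivalent_categories C B"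
proof -
  interpret F: ff_onto_functor D C F by standard (fact assms)
  interpret G: ff_onto_functor D B G by standard (fact assms)
  let ?S = "comp_ftr G F.sec" and ?T = "comp_ftr F G.sec"
  obtain j where j: "natural_iso D D id_ftr (comp_ftr G.sec G) j" using G.unit by metis
  obtain i where i: "natural_iso D D (comp_ftr F.sec F) id_ftr i" using F.unit by metis
  have id: "is_functor D D id_ftr"
    using ff_onto_id[OF F.D.category] by (simp add: ff_onto_def)
  have "natural_iso C C (comp_ftr F (comp_ftr id_ftr F.sec)) (comp_ftr F (comp_ftr (comp_ftr G.sec G) F.sec))
      (\<lambda>x. FArr F (j (FObj F.sec x)))"
    by (rule natural_iso_whisker[OF F.F F.sec_functor j id is_functor_comp[OF G.F G.sec_functor]])
  then have 1: "natural_iso C C id_ftr (comp_ftr ?T ?S) (\<lambda>x. FArr F (j (FObj F.sec x)))"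
    by (rule natural_iso_cong) (auto simp: comp_ftr_def id_ftr_def F.sec_obj F.sec_arr)
  have "natural_iso B B (comp_ftr G (comp_ftr (comp_ftr F.sec F) G.sec)) (comp_ftr G (comp_ftr id_ftr G.sec))
      (\<lambda>x. FArr G (i (FObj G.sec x)))"
    by (rule natural_iso_whisker[OF G.F G.sec_functor i is_functor_comp[OF F.F F.sec_functor] id])
  then have 2: "natural_iso B B (comp_ftr ?S ?T) id_ftr (\<lambda>x. FArr G (i (FObj G.sec x)))"
    by (rule natural_iso_cong) (auto simp: comp_ftr_def id_ftr_def G.sec_obj G.sec_arr)
  show ?thesis
    unfolding equivalent_categories_def
    using F.C.category G.C.category 1 2 is_functor_comp[OF F.sec_functor G.F] is_functor_comp[OF G.sec_functor F.F]
    by blast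
qed

section \<open>Commuting automorphisms of a category\<close>

definition automorphism :: "('o, 'a) category \<Rightarrow> ('o, 'a) endoftr \<Rightarrow> bool" where
  "automorphism A T \<longleftrightarrow> is_functor A A T \<and> bij_betw (FObj T) (Obj A) (Obj A) \<and> bij_betw (FArr T) (Arr A) (Arr A)"

definition commuting :: "('o, 'a) category \<Rightarrow> ('o, 'a) endoftr \<Rightarrow> ('o, 'a) endoftr \<Rightarrow> bool" where
  "commuting A S T \<longleftrightarrow>
     (\<forall>x\<in>Obj A. FObj S (FObj T x) = FObj T (FObj S x)) \<and>
     (\<forall>f\<in>Arr A. FArr S (FArr T f) = FArr T (FArr S f))"

lemma commuting_sym: "commuting A S T \<Longrightarrow> commuting A T S"
  by (simp add: commuting_def)

locale category_automorphism = small_category A for A :: "('o, 'a) category" +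
  fixes T :: "('o, 'a) endoftr"
  assumes automorphism: "automorphism A T"
begin

lemma T_functor: "is_functor A A T" and bij_obj: "bij_betw (FObj T) (Obj A) (Obj A)"
  and bij_arr: "bij_betw (FArr T) (Arr A) (Arr A)"
  using automorphism by (auto simp: automorphism_def)

lemmas T = functorD[OF T_functor]

lemma arr_image: "f \<in> Arr A \<Longrightarrow> FArr T f \<in> Arr A"
  using bij_arr by (auto simp: bij_betw_def)

lemma inv_obj:
  "x \<in> Obj A \<Longrightarrow> FObj (inv_ftr A T) x \<in> Obj A"
  "x \<in> Obj A \<Longrightarrow> FObj T (FObj (inv_ftr A T) x) = x"
  "x \<in> Obj A \<Longrightarrow> FObj (inv_ftr A T) (FObj T x) = x"
  using bij_obj T(1) by (simp_all add: inv_ftr_def bij_betw_def inv_into_into f_inv_into_f)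

lemma inv_arr:
  "f \<in> Arr A \<Longrightarrow> FArr (inv_ftr A T) f \<in> Arr A"
  "f \<in> Arr A \<Longrightarrow> FArr T (FArr (inv_ftr A T) f) = f"
  "f \<in> Arr A \<Longrightarrow> FArr (inv_ftr A T) (FArr T f) = f"
  using bij_arr arr_image by (simp_all add: inv_ftr_def bij_betw_def inv_into_into f_inv_into_f)

lemma T_inj: "\<lbrakk>f \<in> Arr A; g \<in> Arr A; FArr T f = FArr T g\<rbrakk> \<Longrightarrow> f = g"
  using inv_arr(3) by metis

lemma hom_reflect:
  assumes "x \<in> Obj A" "y \<in> Obj A" "f \<in> Arr A" "FArr T f \<in> Hom A (FObj T x) (FObj T y)"
  shows "f \<in> Hom A x y"
proof -
  obtain x' y' where f: "x' \<in> Obj A" "y' \<in> Obj A" "f \<in> Hom A x' y'"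
    using assms(3) by (auto simp: Arr_def)
  then have "FObj T x' = FObj T x \<and> FObj T y' = FObj T y"
    using assms T(1,2) by (intro hom_disjoint[of _ _ _ _ "FArr T f"]) simp_all
  then show ?thesis
    using f assms inv_obj(3) by metis
qed

lemma hom_preimage:
  assumes "x \<in> Obj A" "y \<in> Obj A" "g \<in> Hom A (FObj T x) (FObj T y)"
  obtains f where "f \<in> Hom A x y" "FArr T f = g"
proof -
  have "g \<in> Arr A" using assms T(1) hom_arr by metis
  then show thesis
    using hom_reflect[of x y "FArr (inv_ftr A T) g"] assms inv_arr that by metis
qed

lemma inv_hom:
  assumes "x \<in> Obj A" "y \<in> Obj A" "f \<in> Hom A x y"
  shows "FArr (inv_ftr A T) f \<in> Hom A (FObj (inv_ftr A T) x) (FObj (inv_ftr A T) y)"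
  using assms hom_arr[OF assms] inv_obj inv_arr by (intro hom_reflect[of _ _ "FArr (inv_ftr A T) f"]) simp_all

lemma automorphism_inv: "automorphism A (inv_ftr A T)"
  unfolding automorphism_def
proof (intro conjI)
  let ?U = "inv_ftr A T"
  show "bij_betw (FObj ?U) (Obj A) (Obj A)"
    by (rule bij_betw_byWitness[of _ "FObj T"]) (use inv_obj T(1) in auto)
  show "bij_betw (FArr ?U) (Arr A) (Arr A)"
    by (rule bij_betw_byWitness[of _ "FArr T"]) (use inv_arr arr_image in auto)
  show "is_functor A A ?U"
    unfolding is_functor_def
  proof (intro conjI ballI)
    fix x assume x: "x \<in> Obj A"
    have "FArr ?U (Idt A x) = FArr ?U (FArr T (Idt A (FObj ?U x)))"
      using x T(3) inv_obj by simp
    then show "FArr ?U (Idt A x) = Idt A (FObj ?U x)"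
      using x inv_obj inv_arr(3) hom_arr idt_hom by metis
  next
    fix x y z f g assume o: "x \<in> Obj A" "y \<in> Obj A" "z \<in> Obj A" and h: "f \<in> Hom A x y" "g \<in> Hom A y z"
    note Uo = inv_obj(1)[OF o(1)] inv_obj(1)[OF o(2)] inv_obj(1)[OF o(3)]
    note Uh = inv_hom[OF o(1,2) h(1)] inv_hom[OF o(2,3) h(2)]
    have "FArr T (Cmp A (FArr ?U g) (FArr ?U f)) = Cmp A g f"
      using T(4)[OF Uo Uh] inv_arr(2) hom_arr[OF o(1,2) h(1)] hom_arr[OF o(2,3) h(2)] by simp
    moreover have "Cmp A (FArr ?U g) (FArr ?U f) \<in> Arr A"
      using cmp_hom[OF Uo Uh] hom_arr Uo by blast
    ultimately show "FArr ?U (Cmp A g f) = Cmp A (FArr ?U g) (FArr ?U f)"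
      using inv_arr(3) by metis
  qed (use inv_obj inv_hom in auto)
qed

lemma commuting_inv:
  assumes "automorphism A S" "commuting A S T"
  shows "commuting A S (inv_ftr A T)"
proof -
  interpret S: category_automorphism A S by standard (fact assms)
  have "FObj S (FObj (inv_ftr A T) x) = FObj (inv_ftr A T) (FObj S x)" if "x \<in> Obj A" for x
    using that assms(2) S.T(1) inv_obj unfolding commuting_def by metis
  moreover have "FArr S (FArr (inv_ftr A T) f) = FArr (inv_ftr A T) (FArr S f)" if "f \<in> Arr A" for f
    using that assms(2) S.arr_image inv_arr unfolding commuting_def by metis
  ultimately show ?thesis by (simp add: commuting_def)
qed

text \<open>For \<open>T = \<Theta>\<^sub>i\<close> and \<open>e = \<xi>\<^sub>i\<close> the conjugate is \<open>\<epsilon>\<^sub>i\<close>.  Naturality can be checked after applying \<open>T\<close>,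
  where it is naturality of \<open>e\<close> at the arrow \<open>T(f)\<close>.\<close>

lemma conjugate_natural:
  assumes nat: "\<And>x y f. \<lbrakk>x \<in> Obj A; y \<in> Obj A; f \<in> Hom A x y\<rbrakk> \<Longrightarrow> Cmp A (e y) f = Cmp A f (e x)"
    and e: "\<And>x. x \<in> Obj A \<Longrightarrow> e x \<in> Hom A x x"
    and o: "x \<in> Obj A" "y \<in> Obj A" and f: "f \<in> Hom A x y"
  shows "Cmp A (FArr (inv_ftr A T) (e (FObj T y))) f = Cmp A f (FArr (inv_ftr A T) (e (FObj T x)))"
proof -
  let ?d = "\<lambda>x. FArr (inv_ftr A T) (e (FObj T x))"
  have d: "?d z \<in> Hom A z z" "FArr T (?d z) = e (FObj T z)" if "z \<in> Obj A" for z
    using inv_hom[of "FObj T z" "FObj T z"] that T(1) e inv_obj(3) inv_arr(2)[OF hom_arr[of "FObj T z" "FObj T z"]]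
    by simp_all
  have "FArr T (Cmp A (?d y) f) = FArr T (Cmp A f (?d x))"
    using nat[OF T(1) T(1) T(2)[OF o f]] T(4)[OF o(1,2,2) f d(1)] T(4)[OF o(1,1,2) d(1) f] d(2) o by simp
  moreover have "Cmp A (?d y) f \<in> Arr A" "Cmp A f (?d x) \<in> Arr A"
    using o f d(1) cmp_hom hom_arr by metis+
  ultimately show ?thesis by (metis T_inj)
qed

end


section \<open>Mutation of skew Laurent categories\<close>

text \<open>Arrows are stored as \<open>n\<close>-tuples, but in all categories below the tuple repeats a single arrow of
  \<open>A\<close>, so the category axioms are inherited from \<open>A\<close>.\<close>

lemma tuple_cmp_const:
  "tuple_cmp n A (Y, (\<lambda>i\<in>{1..n}. b), Z) (X, (\<lambda>i\<in>{1..n}. a), Y') = (X, (\<lambda>i\<in>{1..n}. Cmp A b a), Z)"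
  by (auto simp: tuple_cmp_def fun_eq_iff)

lemma tuple_category:
  fixes A :: "('o, 'a) category" and C :: "('x, ('x, 'a) tuple_arrow) category"
  assumes A: "is_category A" and n: "n \<ge> 1" and ne: "Obj C \<noteq> {}"
    and Hom: "\<And>X Y. \<lbrakk>X \<in> Obj C; Y \<in> Obj C\<rbrakk> \<Longrightarrow> Hom C X Y = {(X, (\<lambda>i\<in>{1..n}. a), Y) | a. a \<in> H X Y}"
    and H: "\<And>X Y. \<lbrakk>X \<in> Obj C; Y \<in> Obj C\<rbrakk> \<Longrightarrow> H X Y \<subseteq> Hom A (u X) (u Y)"
    and u: "\<And>X. X \<in> Obj C \<Longrightarrow> u X \<in> Obj A"
    and H_idt: "\<And>X. X \<in> Obj C \<Longrightarrow> Idt A (u X) \<in> H X X"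
    and H_cmp: "\<And>X Y Z a b. \<lbrakk>X \<in> Obj C; Y \<in> Obj C; Z \<in> Obj C; a \<in> H X Y; b \<in> H Y Z\<rbrakk> \<Longrightarrow> Cmp A b a \<in> H X Z"
    and Idt: "\<And>X. X \<in> Obj C \<Longrightarrow> Idt C X = (X, (\<lambda>i\<in>{1..n}. Idt A (u X)), X)"
    and Cmp: "Cmp C = tuple_cmp n A"
  shows "is_category C"
proof -
  interpret A: small_category A by standard (fact A)
  have cmp: "Cmp C (Y, (\<lambda>i\<in>{1..n}. b), Z) (X, (\<lambda>i\<in>{1..n}. a), Y') = (X, (\<lambda>i\<in>{1..n}. Cmp A b a), Z)" for X Y Y' Z a b
    by (simp only: Cmp tuple_cmp_const)
  have h: "a \<in> Hom A (u X) (u Y)" if "X \<in> Obj C" "Y \<in> Obj C" "a \<in> H X Y" for X Y a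
    using H that by blast
  show ?thesis
    unfolding is_category_def
  proof (intro conjI ballI impI)
    fix X assume "X \<in> Obj C"
    then show "Idt C X \<in> Hom C X X"
      using Hom Idt H_idt by blast
  next
    fix X Y Z f g
    assume o: "X \<in> Obj C" "Y \<in> Obj C" "Z \<in> Obj C" and "f \<in> Hom C X Y" "g \<in> Hom C Y Z"
    then obtain a b where "f = (X, (\<lambda>i\<in>{1..n}. a), Y)" "g = (Y, (\<lambda>i\<in>{1..n}. b), Z)" "a \<in> H X Y" "b \<in> H Y Z"
      using Hom by auto
    then show "Cmp C g f \<in> Hom C X Z"
      using H_cmp[OF o, of a b] unfolding Hom[OF o(1,3)] by (auto simp only: cmp)
  next
    fix X Y f assume o: "X \<in> Obj C" "Y \<in> Obj C" and "f \<in> Hom C X Y"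
    then obtain a where "f = (X, (\<lambda>i\<in>{1..n}. a), Y)" "a \<in> H X Y"
      using Hom by auto
    then show "Cmp C f (Idt C X) = f" "Cmp C (Idt C Y) f = f"
      using A.cmp_idt[of "u X" "u Y" a] u h o by (simp_all only: cmp Idt)
  next
    fix X Y Z V f g k
    assume o: "X \<in> Obj C" "Y \<in> Obj C" "Z \<in> Obj C" "V \<in> Obj C"
      and "f \<in> Hom C X Y" "g \<in> Hom C Y Z" "k \<in> Hom C Z V"
    then obtain a b c where "f = (X, (\<lambda>i\<in>{1..n}. a), Y)" "g = (Y, (\<lambda>i\<in>{1..n}. b), Z)"
        "k = (Z, (\<lambda>i\<in>{1..n}. c), V)" "a \<in> H X Y" "b \<in> H Y Z" "c \<in> H Z V"
      using Hom by auto
    moreover from this have "Cmp A c (Cmp A b a) = Cmp A (Cmp A c b) a"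
      using A.cmp_assoc[of "u X" "u Y" "u Z" "u V" a b c] o u h by simp
    ultimately show "Cmp C k (Cmp C g f) = Cmp C (Cmp C k g) f"
      by (simp only: cmp)
  qed (use ne Hom in auto)
qed

text \<open>A compatible tuple \<open>(a, \<dots>, a)\<close> is represented by its entry \<open>a\<close>.\<close>

definition laurent_hom ::
    "nat \<Rightarrow> ('o, 'a) category \<Rightarrow> (nat \<Rightarrow> ('o, 'a) endoftr) \<Rightarrow> ('o, 'a) laurent_obj \<Rightarrow> ('o, 'a) laurent_obj \<Rightarrow> 'a set" where
  "laurent_hom n A T X Y =
     {a \<in> Hom A (fst X) (fst Y). \<forall>i\<in>{1..n}. Cmp A a (snd X i) = Cmp A (snd Y i) (FArr (T i) a)}"

text \<open>The invariant of a sequence of mutations.  The functors have to commute because the component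
  \<open>\<nu>\<^sub>i : \<Theta>\<^sub>i(M) \<rightarrow> M\<close> becomes \<open>\<Theta>\<^sub>k(\<nu>\<^sub>i) : \<Theta>\<^sub>k(\<Theta>\<^sub>i(M)) \<rightarrow> \<Theta>\<^sub>k(M)\<close>, whose source must be \<open>\<Theta>\<^sub>i(\<Theta>\<^sub>k(M))\<close>.  The
  arrows between two objects depend only on the objects themselves, not on how these were
  reached; this is what makes the skew Laurent categories of all mutations comparable.\<close>

definition skew_laurent_seed :: "nat \<Rightarrow> ('o, 'a) category \<Rightarrow> ('o, 'a) preseed \<Rightarrow> bool" where
  "skew_laurent_seed n A S \<longleftrightarrow>
     (\<forall>i\<in>{1..n}. automorphism A (Theta S i)) \<and>
     (\<forall>i\<in>{1..n}. \<forall>j\<in>{1..n}. commuting A (Theta S i) (Theta S j)) \<and>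
     Obj (Laurent S) \<noteq> {} \<and>
     (\<forall>X\<in>Obj (Laurent S). fst X \<in> Obj A \<and>
        (\<forall>i\<in>{1..n}. invertible A (FObj (Theta S i) (fst X)) (fst X) (snd X i))) \<and>
     (\<forall>X\<in>Obj (Laurent S). \<forall>Y\<in>Obj (Laurent S).
        Hom (Laurent S) X Y = {(X, (\<lambda>i\<in>{1..n}. a), Y) | a. a \<in> laurent_hom n A (Theta S) X Y}) \<and>
     (\<forall>X\<in>Obj (Laurent S). Idt (Laurent S) X = (X, (\<lambda>i\<in>{1..n}. Idt A (fst X)), X)) \<and>
     Cmp (Laurent S) = tuple_cmp n A"

locale seed_mutation = small_category A for A :: "('o, 'a) category" +
  fixes n :: nat and P :: "('o, 'a) preseed"
  assumes n: "n \<ge> 1"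
    and xi_iso: "i \<in> {1..n} \<Longrightarrow> natural_iso A A id_ftr id_ftr (Xi P i)"
    and eps_iso: "i \<in> {1..n} \<Longrightarrow> natural_iso A A id_ftr id_ftr (eps A P i)"
begin

lemma natural_idD:
  assumes "natural_iso A A id_ftr id_ftr e"
  shows "x \<in> Obj A \<Longrightarrow> invertible A x x (e x)"
    and "\<lbrakk>x \<in> Obj A; y \<in> Obj A; f \<in> Hom A x y\<rbrakk> \<Longrightarrow> Cmp A (e y) f = Cmp A f (e x)"
  using assms by (auto simp: natural_iso_def id_ftr_def)

lemma const_tuple_eq: "(\<lambda>i\<in>{1..n}. a) = (\<lambda>i\<in>{1..n}. b) \<longleftrightarrow> a = b"
proof
  assume "(\<lambda>i\<in>{1..n}. a) = (\<lambda>i\<in>{1..n}. b)"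
  then have "(\<lambda>i\<in>{1..n}. a) 1 = (\<lambda>i\<in>{1..n}. b) 1" by simp
  then show "a = b" using n by simp
qed simp

end

locale laurent_seed = seed_mutation A n P
  for A :: "('o, 'a) category" and n P +
  fixes S :: "('o, 'a) preseed"
  assumes seed: "skew_laurent_seed n A S"
begin

abbreviation "L \<equiv> Laurent S"
abbreviation "\<Theta> \<equiv> Theta S"

lemma theta: "i \<in> {1..n} \<Longrightarrow> category_automorphism A (\<Theta> i)"
  using seed category by (simp add: skew_laurent_seed_def category_automorphism_def small_category_def category_automorphism_axioms_def)

lemma theta_commute: "i \<in> {1..n} \<Longrightarrow> j \<in> {1..n} \<Longrightarrow> commuting A (\<Theta> i) (\<Theta> j)"
  using seed by (simp add: skew_laurent_seed_def)

lemma L_nonempty: "Obj L \<noteq> {}"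
  using seed by (simp add: skew_laurent_seed_def)

lemma L_obj: "X \<in> Obj L \<Longrightarrow> fst X \<in> Obj A"
  using seed by (simp add: skew_laurent_seed_def)

lemma theta_obj: "i \<in> {1..n} \<Longrightarrow> X \<in> Obj L \<Longrightarrow> FObj (\<Theta> i) (fst X) \<in> Obj A"
  using category_automorphism.T(1)[OF theta] L_obj by blast

lemma L_comp: "X \<in> Obj L \<Longrightarrow> i \<in> {1..n} \<Longrightarrow> invertible A (FObj (\<Theta> i) (fst X)) (fst X) (snd X i)"
  using seed by (simp add: skew_laurent_seed_def)

lemma L_comp_hom: "X \<in> Obj L \<Longrightarrow> i \<in> {1..n} \<Longrightarrow> snd X i \<in> Hom A (FObj (\<Theta> i) (fst X)) (fst X)"
  using L_comp invertible_hom by blast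

lemma L_hom: "X \<in> Obj L \<Longrightarrow> Y \<in> Obj L \<Longrightarrow> Hom L X Y = {(X, (\<lambda>i\<in>{1..n}. a), Y) | a. a \<in> laurent_hom n A \<Theta> X Y}"
  using seed by (simp add: skew_laurent_seed_def)

lemma L_idt: "X \<in> Obj L \<Longrightarrow> Idt L X = (X, (\<lambda>i\<in>{1..n}. Idt A (fst X)), X)"
  using seed by (simp add: skew_laurent_seed_def)

lemma L_cmp: "Cmp L = tuple_cmp n A"
  using seed by (simp add: skew_laurent_seed_def)

lemma laurent_hom_idt:
  assumes "X \<in> Obj L"
  shows "Idt A (fst X) \<in> laurent_hom n A \<Theta> X X"
proof -
  have "Cmp A (Idt A (fst X)) (snd X i) = Cmp A (snd X i) (FArr (\<Theta> i) (Idt A (fst X)))" if i: "i \<in> {1..n}" for i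
    using cmp_idt[OF theta_obj[OF i assms] L_obj[OF assms] L_comp_hom[OF assms i]]
      category_automorphism.T(3)[OF theta[OF i] L_obj[OF assms]] by simp
  then show ?thesis
    using idt_hom[OF L_obj[OF assms]] by (simp add: laurent_hom_def)
qed

lemma laurent_hom_cmp:
  assumes o: "X \<in> Obj L" "Y \<in> Obj L" "Z \<in> Obj L"
    and a: "a \<in> laurent_hom n A \<Theta> X Y" and b: "b \<in> laurent_hom n A \<Theta> Y Z"
  shows "Cmp A b a \<in> laurent_hom n A \<Theta> X Z"
proof -
  note oA = L_obj[OF o(1)] L_obj[OF o(2)] L_obj[OF o(3)]
  have ab: "a \<in> Hom A (fst X) (fst Y)" "b \<in> Hom A (fst Y) (fst Z)"
    using a b by (auto simp: laurent_hom_def)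
  have "Cmp A (Cmp A b a) (snd X i) = Cmp A (snd Z i) (FArr (\<Theta> i) (Cmp A b a))" if i: "i \<in> {1..n}" for i
  proof -
    interpret T: category_automorphism A "\<Theta> i" using theta[OF i] .
    note x = T.T(1)[OF oA(1)] L_comp_hom[OF o(1) i] and y = T.T(1)[OF oA(2)] L_comp_hom[OF o(2) i]
      and z = T.T(1)[OF oA(3)] L_comp_hom[OF o(3) i]
    note Ta = T.T(2)[OF oA(1,2) ab(1)] and Tb = T.T(2)[OF oA(2,3) ab(2)]
    have "Cmp A (Cmp A b a) (snd X i) = Cmp A b (Cmp A (snd Y i) (FArr (\<Theta> i) a))"
      using cmp_assoc[OF x(1) oA(1,2,3) x(2) ab] a i by (simp add: laurent_hom_def)
    also have "\<dots> = Cmp A (Cmp A (snd Z i) (FArr (\<Theta> i) b)) (FArr (\<Theta> i) a)"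
      using cmp_assoc[OF x(1) y(1) oA(2,3) Ta y(2) ab(2)] b i by (simp add: laurent_hom_def)
    also have "\<dots> = Cmp A (snd Z i) (FArr (\<Theta> i) (Cmp A b a))"
      using cmp_assoc[OF x(1) y(1) z(1) oA(3) Ta Tb z(2)] T.T(4)[OF oA ab] by simp
    finally show ?thesis .
  qed
  then show ?thesis
    using cmp_hom[OF oA ab] by (simp add: laurent_hom_def)
qed

lemma L_category: "is_category L"
  by (rule tuple_category[where u = fst and H = "laurent_hom n A \<Theta>", OF category n L_nonempty L_hom])
    (use L_obj L_idt L_cmp laurent_hom_idt laurent_hom_cmp in \<open>auto simp: laurent_hom_def\<close>)

lemma multiplier:
  assumes "i \<in> {1..n}"
  shows "natural_iso A A id_ftr id_ftr (if even (count_list w (s, i)) then eps A P i else Xi P i)"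
  using xi_iso eps_iso assms by simp

lemma mutated_component_invertible:
  assumes k: "k \<in> {1..n}" and X: "X \<in> Obj L"
  shows "invertible A (fst X) (FObj (\<Theta> k) (fst X)) (mutated_component A P w S s k X)"
proof -
  note o = theta_obj[OF k X] L_obj[OF X]
  note e = natural_idD(1)[OF multiplier[OF k, of w s]]
  note inv = invertible_inv_arrow[OF o L_comp[OF X k]]
  show ?thesis
    using invertible_cmp[OF o(2,1,1) inv e[OF o(1)]] invertible_cmp[OF o(2,2,1) e[OF o(2)] inv]
    by (cases s) (simp_all add: mutated_component_def Let_def)
qed

text \<open>Whatever the history and the side, the new component is the old one inverted and composed with a
  natural automorphism of the identity.  By naturality this automorphism can be moved past \<open>a\<close> or
  \<open>\<Theta>\<^sub>k(a)\<close> and cancelled.\<close>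

lemma mutated_component_square:
  assumes k: "k \<in> {1..n}" and X: "X \<in> Obj L" and Y: "Y \<in> Obj L" and a: "a \<in> Hom A (fst X) (fst Y)"
  shows "Cmp A (FArr (\<Theta> k) a) (mutated_component A P w S s k X) = Cmp A (mutated_component A P w S s k Y) a
    \<longleftrightarrow> Cmp A a (snd X k) = Cmp A (snd Y k) (FArr (\<Theta> k) a)"
proof -
  interpret T: category_automorphism A "\<Theta> k" using theta[OF k] .
  note x = theta_obj[OF k X] L_obj[OF X] and y = theta_obj[OF k Y] L_obj[OF Y]
  let ?V = "FObj (\<Theta> k) (fst X)" and ?W = "fst X" and ?V' = "FObj (\<Theta> k) (fst Y)" and ?W' = "fst Y"
  note b = T.T(2)[OF x(2) y(2) a]
  let ?b = "FArr (\<Theta> k) a"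
  define \<mu> where "\<mu> = inv_arrow A ?V ?W (snd X k)"
  define \<mu>' where "\<mu>' = inv_arrow A ?V' ?W' (snd Y k)"
  define e where "e = (if even (count_list w (s, k)) then eps A P k else Xi P k)"
  have \<mu>: "inverse_arrows A ?V ?W (snd X k) \<mu>" "inverse_arrows A ?V' ?W' (snd Y k) \<mu>'"
    unfolding \<mu>_def \<mu>'_def by (intro inverse_arrows_inv_arrow x y L_comp X Y k)+
  then have m: "\<mu> \<in> Hom A ?W ?V" "\<mu>' \<in> Hom A ?W' ?V'"
    by (auto simp: inverse_arrows_def)
  have e_inv: "invertible A z z (e z)" "e z \<in> Hom A z z" if "z \<in> Obj A" for z
    using natural_idD(1)[OF multiplier[OF k, of w s]] that invertible_hom unfolding e_def by blast+
  have e_nat: "Cmp A (e y) f = Cmp A f (e x)" if "x \<in> Obj A" "y \<in> Obj A" "f \<in> Hom A x y" for x y f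
    using natural_idD(2)[OF multiplier[OF k, of w s] that] unfolding e_def .
  have "Cmp A ?b (mutated_component A P w S s k X) = Cmp A (mutated_component A P w S s k Y) a
    \<longleftrightarrow> Cmp A ?b \<mu> = Cmp A \<mu>' a"
  proof (cases s)
    case RightSide
    then have c: "mutated_component A P w S s k X = Cmp A (e ?V) \<mu>"
        "mutated_component A P w S s k Y = Cmp A (e ?V') \<mu>'"
      by (simp_all add: mutated_component_def Let_def e_def \<mu>_def \<mu>'_def)
    have "Cmp A ?b (Cmp A (e ?V) \<mu>) = Cmp A (e ?V') (Cmp A ?b \<mu>)"
      using cmp_assoc[OF x(2,1,1) y(1) m(1) e_inv(2)[OF x(1)] b] cmp_assoc[OF x(2,1) y(1,1) m(1) b e_inv(2)[OF y(1)]]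
        e_nat[OF x(1) y(1) b] by simp
    moreover have "Cmp A (Cmp A (e ?V') \<mu>') a = Cmp A (e ?V') (Cmp A \<mu>' a)"
      using cmp_assoc[OF x(2) y(2,1,1) a m(2) e_inv(2)[OF y(1)]] by simp
    ultimately show ?thesis
      using cancel_left[OF x(2) y(1,1) e_inv(1)[OF y(1)] cmp_hom[OF x(2,1) y(1) m(1) b] cmp_hom[OF x(2) y(2,1) a m(2)]] c
      by simp
  next
    case LeftSide
    then have c: "mutated_component A P w S s k X = Cmp A \<mu> (e ?W)"
        "mutated_component A P w S s k Y = Cmp A \<mu>' (e ?W')"
      by (simp_all add: mutated_component_def Let_def e_def \<mu>_def \<mu>'_def)
    have "Cmp A (Cmp A \<mu>' (e ?W')) a = Cmp A (Cmp A \<mu>' a) (e ?W)"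
      using cmp_assoc[OF x(2) y(2,2,1) a e_inv(2)[OF y(2)] m(2)] cmp_assoc[OF x(2,2) y(2,1) e_inv(2)[OF x(2)] a m(2)]
        e_nat[OF x(2) y(2) a] by simp
    moreover have "Cmp A ?b (Cmp A \<mu> (e ?W)) = Cmp A (Cmp A ?b \<mu>) (e ?W)"
      using cmp_assoc[OF x(2,2,1) y(1) e_inv(2)[OF x(2)] m(1) b] by simp
    ultimately show ?thesis
      using cancel_right[OF x(2,2) y(1) e_inv(1)[OF x(2)] cmp_hom[OF x(2,1) y(1) m(1) b] cmp_hom[OF x(2) y(2,1) a m(2)]] c
      by simp
  qed
  also have "\<dots> \<longleftrightarrow> Cmp A a (snd X k) = Cmp A (snd Y k) ?b"
    by (rule invert_square[OF x y \<mu> a b])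
  finally show ?thesis .
qed

definition mutation_ftr where
  "mutation_ftr w s k =
     \<lparr>FObj = mutate_object n A P w S s k,
      FArr = (\<lambda>(X, h, Y). (mutate_object n A P w S s k X, (\<lambda>i\<in>{1..n}. FArr (\<Theta> k) (h i)),
                          mutate_object n A P w S s k Y))\<rparr>"

text \<open>In direction \<open>k\<close> this is \<open>mutated_component_square\<close>, because the new functor \<open>\<Theta>\<^sub>k\<^sup>-\<^sup>1\<close> takes \<open>\<Theta>\<^sub>k(a)\<close> back to \<open>a\<close>; in
  a direction \<open>i \<noteq> k\<close> the condition is \<open>\<Theta>\<^sub>k\<close> applied to the old one, and \<open>\<Theta>\<^sub>k\<close> is injective on arrows.\<close>

lemma laurent_hom_mutate:
  assumes k: "k \<in> {1..n}" and X: "X \<in> Obj L" and Y: "Y \<in> Obj L" and a: "a \<in> Hom A (fst X) (fst Y)"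
  shows "FArr (\<Theta> k) a \<in> laurent_hom n A (Theta (mutate n A P w S s k))
            (mutate_object n A P w S s k X) (mutate_object n A P w S s k Y)
         \<longleftrightarrow> a \<in> laurent_hom n A \<Theta> X Y"
proof -
  interpret T: category_automorphism A "\<Theta> k" using theta[OF k] .
  note x = L_obj[OF X] and y = L_obj[OF Y]
  let ?m = "mutate_object n A P w S s k" and ?T' = "Theta (mutate n A P w S s k)" and ?b = "FArr (\<Theta> k) a"
  have "Cmp A ?b (snd (?m X) i) = Cmp A (snd (?m Y) i) (FArr (?T' i) ?b)
      \<longleftrightarrow> Cmp A a (snd X i) = Cmp A (snd Y i) (FArr (\<Theta> i) a)" if i: "i \<in> {1..n}" for i
  proof (cases "i = k")
    case True
    then show ?thesis
      using mutated_component_square[OF k X Y a] T.inv_arr(3)[OF hom_arr[OF x y a]] k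
      by (simp add: mutate_object_def mutate_def Let_def)
  next
    case False
    interpret I: category_automorphism A "\<Theta> i" using theta[OF i] .
    note tx = theta_obj[OF i X] L_comp_hom[OF X i] and ty = theta_obj[OF i Y] L_comp_hom[OF Y i]
    note Ia = I.T(2)[OF x y a]
    have "FArr (\<Theta> i) ?b = FArr (\<Theta> k) (FArr (\<Theta> i) a)"
      using theta_commute[OF i k] hom_arr[OF x y a] by (simp add: commuting_def)
    then have "Cmp A ?b (snd (?m X) i) = Cmp A (snd (?m Y) i) (FArr (?T' i) ?b) \<longleftrightarrow>
        FArr (\<Theta> k) (Cmp A a (snd X i)) = FArr (\<Theta> k) (Cmp A (snd Y i) (FArr (\<Theta> i) a))"
      using i False T.T(4)[OF tx(1) x y tx(2) a] T.T(4)[OF tx(1) ty(1) y Ia ty(2)]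
      by (simp add: mutate_object_def mutate_def Let_def)
    moreover have "Cmp A a (snd X i) \<in> Arr A" "Cmp A (snd Y i) (FArr (\<Theta> i) a) \<in> Arr A"
      using hom_arr[OF tx(1) y cmp_hom[OF tx(1) x y tx(2) a]]
        hom_arr[OF tx(1) y cmp_hom[OF tx(1) ty(1) y Ia ty(2)]] by auto
    ultimately show ?thesis
      using T.T_inj by metis
  qed
  moreover have "?b \<in> Hom A (fst (?m X)) (fst (?m Y))"
    using T.T(2)[OF x y a] by (simp add: mutate_object_def)
  ultimately show ?thesis
    using a by (auto simp: laurent_hom_def)
qed

lemma mutate_seed:
  assumes k: "k \<in> {1..n}"
  shows "skew_laurent_seed n A (mutate n A P w S s k)"
proof -
  interpret T: category_automorphism A "\<Theta> k" using theta[OF k] .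
  let ?S' = "mutate n A P w S s k" and ?m = "mutate_object n A P w S s k"
  have T': "Theta ?S' i = (if i = k then inv_ftr A (\<Theta> k) else \<Theta> i)" for i
    by (simp add: mutate_def Let_def)
  have obj': "Obj (Laurent ?S') = ?m ` Obj L"
    by (simp add: mutate_def Let_def)
  have aut: "automorphism A (Theta ?S' i)" if "i \<in> {1..n}" for i
    using that theta T.automorphism_inv category_automorphism.automorphism unfolding T' by auto
  have inv_comm: "commuting A (\<Theta> i) (inv_ftr A (\<Theta> k))" if "i \<in> {1..n}" for i
    using that theta theta_commute k category_automorphism.automorphism T.commuting_inv by blast
  have comm: "commuting A (Theta ?S' i) (Theta ?S' j)" if "i \<in> {1..n}" "j \<in> {1..n}" for i j
    using that theta_commute inv_comm commuting_sym[OF inv_comm] unfolding T'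
    by (auto simp: commuting_def)
  have X': "fst (?m X) \<in> Obj A" "\<forall>i\<in>{1..n}. invertible A (FObj (Theta ?S' i) (fst (?m X))) (fst (?m X)) (snd (?m X) i)"
    if X: "X \<in> Obj L" for X
  proof -
    show "fst (?m X) \<in> Obj A"
      using theta_obj[OF k X] by (simp add: mutate_object_def)
    show "\<forall>i\<in>{1..n}. invertible A (FObj (Theta ?S' i) (fst (?m X))) (fst (?m X)) (snd (?m X) i)"
    proof
      fix i assume i: "i \<in> {1..n}"
      show "invertible A (FObj (Theta ?S' i) (fst (?m X))) (fst (?m X)) (snd (?m X) i)"
      proof (cases "i = k")
        case True
        then show ?thesis
          using mutated_component_invertible[OF k X] k T.inv_obj(3)[OF L_obj[OF X]]
          by (simp add: mutate_object_def T')
      next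
        case False
        have "FObj (\<Theta> i) (FObj (\<Theta> k) (fst X)) = FObj (\<Theta> k) (FObj (\<Theta> i) (fst X))"
          using theta_commute[OF i k] L_obj[OF X] by (simp add: commuting_def)
        then show ?thesis
          using functor_invertible[OF T.T_functor theta_obj[OF i X] L_obj[OF X] L_comp[OF X i]] False i
          by (simp add: mutate_object_def T')
      qed
    qed
  qed
  \<comment> \<open>By definition an arrow of the mutated category comes from an arrow between some preimages \<open>X0\<close>, \<open>Y0\<close>
    of its ends.  The description by compatibility shows that all choices give the same arrows.\<close>
  have hom': "Hom (Laurent ?S') (?m X) (?m Y) =
      {(?m X, (\<lambda>i\<in>{1..n}. b), ?m Y) | b. b \<in> laurent_hom n A (Theta ?S') (?m X) (?m Y)}" (is "?l = ?r")
    if XY: "X \<in> Obj L" "Y \<in> Obj L" for X Y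
  proof (intro Set.set_eqI iffI)
    fix f assume "f \<in> ?l"
    then obtain X0 Y0 h where 0: "X0 \<in> Obj L" "Y0 \<in> Obj L" "?m X = ?m X0" "?m Y = ?m Y0"
        "(X0, h, Y0) \<in> Hom L X0 Y0" "f = (?m X, (\<lambda>i\<in>{1..n}. FArr (\<Theta> k) (h i)), ?m Y)"
      by (auto simp: mutate_def Let_def)
    then obtain a where a: "h = (\<lambda>i\<in>{1..n}. a)" "a \<in> laurent_hom n A \<Theta> X0 Y0"
      using L_hom by auto
    then have "FArr (\<Theta> k) a \<in> laurent_hom n A (Theta ?S') (?m X0) (?m Y0)"
      using laurent_hom_mutate[OF k 0(1,2)] by (auto simp: laurent_hom_def)
    moreover have "(\<lambda>i\<in>{1..n}. FArr (\<Theta> k) (h i)) = (\<lambda>i\<in>{1..n}. FArr (\<Theta> k) a)"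
      using a(1) by (auto simp: fun_eq_iff)
    ultimately show "f \<in> ?r"
      using 0 by auto
  next
    fix f assume "f \<in> ?r"
    then obtain b where b: "f = (?m X, (\<lambda>i\<in>{1..n}. b), ?m Y)" "b \<in> laurent_hom n A (Theta ?S') (?m X) (?m Y)"
      by auto
    then have "b \<in> Hom A (FObj (\<Theta> k) (fst X)) (FObj (\<Theta> k) (fst Y))"
      by (simp add: laurent_hom_def mutate_object_def)
    then obtain a where a: "a \<in> Hom A (fst X) (fst Y)" "FArr (\<Theta> k) a = b"
      using T.hom_preimage L_obj XY by metis
    then have "(X, (\<lambda>i\<in>{1..n}. a), Y) \<in> Hom L X Y"
      using laurent_hom_mutate[OF k XY a(1)] b(2) L_hom[OF XY] by auto
    moreover have "(\<lambda>i\<in>{1..n}. b) = (\<lambda>i\<in>{1..n}. FArr (\<Theta> k) ((\<lambda>i\<in>{1..n}. a) i))"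
      using a(2) by (auto simp: fun_eq_iff)
    ultimately show "f \<in> ?l"
      unfolding mutate_def Let_def b(1) preseed.simps category.simps
      by (intro CollectI exI[of _ X] exI[of _ Y] exI[of _ "\<lambda>i\<in>{1..n}. a"] conjI) (use XY in simp_all)
  qed
  show ?thesis
    unfolding skew_laurent_seed_def obj'
    using aut comm X' hom' L_nonempty
    by (auto simp: mutate_def Let_def)
qed

lemma mutation_ftr_ff_onto:
  assumes k: "k \<in> {1..n}"
  shows "ff_onto L (Laurent (mutate n A P w S s k)) (mutation_ftr w s k)"
proof -
  interpret T: category_automorphism A "\<Theta> k" using theta[OF k] .
  let ?S' = "mutate n A P w S s k" and ?m = "mutate_object n A P w S s k" and ?F = "mutation_ftr w s k"
  interpret S': laurent_seed A n P ?S'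
    by standard (rule mutate_seed[OF k])
  have obj': "Obj S'.L = ?m ` Obj L"
    by (simp add: mutate_def Let_def)
  have F: "FObj ?F = ?m" "FArr ?F (X, (\<lambda>i\<in>{1..n}. a), Y) = (?m X, (\<lambda>i\<in>{1..n}. FArr (\<Theta> k) a), ?m Y)" for X Y a
    by (auto simp: mutation_ftr_def fun_eq_iff)
  have bij: "bij_betw (FArr ?F) (Hom L X Y) (Hom S'.L (?m X) (?m Y))" if XY: "X \<in> Obj L" "Y \<in> Obj L" for X Y
  proof -
    have "inj_on (FArr ?F) (Hom L X Y)"
    proof (rule inj_onI)
      fix f g assume "f \<in> Hom L X Y" "g \<in> Hom L X Y" and eq: "FArr ?F f = FArr ?F g"
      then obtain a b where ab: "f = (X, (\<lambda>i\<in>{1..n}. a), Y)" "g = (X, (\<lambda>i\<in>{1..n}. b), Y)"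
          "a \<in> Hom A (fst X) (fst Y)" "b \<in> Hom A (fst X) (fst Y)"
        unfolding L_hom[OF XY] by (auto simp: laurent_hom_def)
      then have "FArr (\<Theta> k) a = FArr (\<Theta> k) b"
        using eq by (simp only: F prod.inject const_tuple_eq)
      then show "f = g"
        using ab T.T_inj hom_arr L_obj XY by metis
    qed
    moreover have "FArr ?F ` Hom L X Y = Hom S'.L (?m X) (?m Y)"
    proof (intro Set.set_eqI iffI)
      fix g assume "g \<in> FArr ?F ` Hom L X Y"
      then obtain a where "g = FArr ?F (X, (\<lambda>i\<in>{1..n}. a), Y)" "a \<in> laurent_hom n A \<Theta> X Y"
        using L_hom[OF XY] by auto
      then show "g \<in> Hom S'.L (?m X) (?m Y)"
        using laurent_hom_mutate[OF k XY, of a w s] XY unfolding F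
        by (subst S'.L_hom) (auto simp: obj' laurent_hom_def)
    next
      fix g assume "g \<in> Hom S'.L (?m X) (?m Y)"
      then obtain b where b: "g = (?m X, (\<lambda>i\<in>{1..n}. b), ?m Y)" "b \<in> laurent_hom n A S'.\<Theta> (?m X) (?m Y)"
        using S'.L_hom[of "?m X" "?m Y"] XY by (auto simp: obj')
      then have "b \<in> Hom A (FObj (\<Theta> k) (fst X)) (FObj (\<Theta> k) (fst Y))"
        by (simp add: laurent_hom_def mutate_object_def)
      then obtain a where a: "a \<in> Hom A (fst X) (fst Y)" "FArr (\<Theta> k) a = b"
        using T.hom_preimage L_obj XY by metis
      then have "(X, (\<lambda>i\<in>{1..n}. a), Y) \<in> Hom L X Y"
        using laurent_hom_mutate[OF k XY a(1)] b(2) L_hom[OF XY] by auto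
      moreover have "FArr ?F (X, (\<lambda>i\<in>{1..n}. a), Y) = g"
        by (simp only: F a b)
      ultimately show "g \<in> FArr ?F ` Hom L X Y" by (metis imageI)
    qed
    ultimately show ?thesis by (simp add: bij_betw_def)
  qed
  have "is_functor L S'.L ?F"
    unfolding is_functor_def
  proof (intro conjI ballI)
    fix X assume X: "X \<in> Obj L"
    show "FObj ?F X \<in> Obj S'.L" using X by (simp add: F obj')
    show "FArr ?F (Idt L X) = Idt S'.L (FObj ?F X)"
      unfolding L_idt[OF X] F S'.L_idt[of "?m X", unfolded obj', OF imageI[OF X]]
      using T.T(3)[OF L_obj[OF X]] by (simp add: mutate_object_def)
  next
    fix X Y f assume "X \<in> Obj L" "Y \<in> Obj L" "f \<in> Hom L X Y"
    then show "FArr ?F f \<in> Hom S'.L (FObj ?F X) (FObj ?F Y)"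
      using bij_betwE[OF bij[of X Y]] by (simp add: F(1))
  next
    fix X Y Z f g assume o: "X \<in> Obj L" "Y \<in> Obj L" "Z \<in> Obj L" and "f \<in> Hom L X Y" "g \<in> Hom L Y Z"
    then obtain a b where ab: "f = (X, (\<lambda>i\<in>{1..n}. a), Y)" "g = (Y, (\<lambda>i\<in>{1..n}. b), Z)"
        "a \<in> Hom A (fst X) (fst Y)" "b \<in> Hom A (fst Y) (fst Z)"
      using L_hom by (auto simp: laurent_hom_def)
    then have "FArr (\<Theta> k) (Cmp A b a) = Cmp A (FArr (\<Theta> k) b) (FArr (\<Theta> k) a)"
      using T.T(4)[OF L_obj[OF o(1)] L_obj[OF o(2)] L_obj[OF o(3)]] by blast
    then show "FArr ?F (Cmp L g f) = Cmp S'.L (FArr ?F g) (FArr ?F f)"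
      by (simp only: ab(1,2) F L_cmp S'.L_cmp tuple_cmp_const)
  qed
  then show ?thesis
    unfolding ff_onto_def using bij L_category S'.L_category by (simp add: F obj')
qed

end

section \<open>Hyperbolic categories inside the mutation category\<close>

context laurent_seed
begin

text \<open>The category \<^const>\<open>hyperbolic_category_of\<close> for a preseed \<open>S\<close> that is not yet known to be the one reached
  through the history \<open>w\<close>.  Here \<open>w\<close> matters only through the parity that selects \<open>\<epsilon>\<^sub>i\<close> or \<open>\<xi>\<^sub>i\<close>.\<close>

definition hyp_obj where
  "hyp_obj w s X = (\<Theta>, (\<lambda>i\<in>{1..n}. mutated_component A P w S s i X), fst X, snd X)"

definition hyp_cat where
  "hyp_cat w s =
     \<lparr>Obj = hyp_obj w s ` Obj L,
      Hom = (\<lambda>X Y. {(X, h, Y) | h. (laurent_part X, h, laurent_part Y) \<in> Hom L (laurent_part X) (laurent_part Y)}),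
      Idt = (\<lambda>X. (X, (\<lambda>i\<in>{1..n}. Idt A (fst (laurent_part X))), X)),
      Cmp = tuple_cmp n A\<rparr>"

definition hyp_ftr where
  "hyp_ftr w s = \<lparr>FObj = hyp_obj w s, FArr = (\<lambda>(X, h, Y). (hyp_obj w s X, h, hyp_obj w s Y))\<rparr>"

lemma laurent_part_hyp_obj [simp]: "laurent_part (hyp_obj w s X) = X"
  by (cases X) (simp add: hyp_obj_def)

lemma hyp_hom:
  assumes "X \<in> Obj L" "Y \<in> Obj L"
  shows "Hom (hyp_cat w s) (hyp_obj w s X) (hyp_obj w s Y) =
     {(hyp_obj w s X, (\<lambda>i\<in>{1..n}. a), hyp_obj w s Y) | a. a \<in> laurent_hom n A \<Theta> X Y}"
  unfolding hyp_cat_def category.simps laurent_part_hyp_obj L_hom[OF assms] by auto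

lemma hyp_category: "is_category (hyp_cat w s)"
proof -
  have lp: "laurent_part X \<in> Obj L" if "X \<in> Obj (hyp_cat w s)" for X
    using that by (auto simp only: hyp_cat_def category.simps laurent_part_hyp_obj)
  show ?thesis
  proof (rule tuple_category[where u = "\<lambda>X. fst (laurent_part X)" and
        H = "\<lambda>X Y. laurent_hom n A \<Theta> (laurent_part X) (laurent_part Y)", OF category n])
    show "Obj (hyp_cat w s) \<noteq> {}"
      using L_nonempty by (simp add: hyp_cat_def)
  next
    fix X Y assume "X \<in> Obj (hyp_cat w s)" "Y \<in> Obj (hyp_cat w s)"
    then obtain X0 Y0 where "X0 \<in> Obj L" "Y0 \<in> Obj L" "X = hyp_obj w s X0" "Y = hyp_obj w s Y0"
      by (auto simp: hyp_cat_def)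
    then show "Hom (hyp_cat w s) X Y = {(X, (\<lambda>i\<in>{1..n}. a), Y) | a. a \<in> laurent_hom n A \<Theta> (laurent_part X) (laurent_part Y)}"
      by (simp only: hyp_hom laurent_part_hyp_obj)
  next
    fix X Y
    show "laurent_hom n A \<Theta> (laurent_part X) (laurent_part Y) \<subseteq> Hom A (fst (laurent_part X)) (fst (laurent_part Y))"
      by (auto simp: laurent_hom_def)
  next
    fix X
    show "Idt (hyp_cat w s) X = (X, (\<lambda>i\<in>{1..n}. Idt A (fst (laurent_part X))), X)"
      by (simp add: hyp_cat_def)
    show "Cmp (hyp_cat w s) = tuple_cmp n A"
      by (simp add: hyp_cat_def)
  next
    fix X assume "X \<in> Obj (hyp_cat w s)"
    then show "fst (laurent_part X) \<in> Obj A" "Idt A (fst (laurent_part X)) \<in> laurent_hom n A \<Theta> (laurent_part X) (laurent_part X)"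
      by (rule L_obj[OF lp], rule laurent_hom_idt[OF lp])
  next
    fix X Y Z a b
    assume "X \<in> Obj (hyp_cat w s)" "Y \<in> Obj (hyp_cat w s)" "Z \<in> Obj (hyp_cat w s)"
      and "a \<in> laurent_hom n A \<Theta> (laurent_part X) (laurent_part Y)"
      and "b \<in> laurent_hom n A \<Theta> (laurent_part Y) (laurent_part Z)"
    then show "Cmp A b a \<in> laurent_hom n A \<Theta> (laurent_part X) (laurent_part Z)"
      by (rule laurent_hom_cmp[OF lp lp lp])
  qed
qed

lemma hyp_ftr_ff_onto: "ff_onto L (hyp_cat w s) (hyp_ftr w s)"
proof -
  let ?F = "hyp_ftr w s" and ?h = "hyp_obj w s" and ?B = "hyp_cat w s"
  have F: "FObj ?F = ?h" "FArr ?F (X, h, Y) = (?h X, h, ?h Y)" for X h Y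
    by (simp_all add: hyp_ftr_def)
  have B: "Obj ?B = ?h ` Obj L" "Idt ?B (?h X) = (?h X, (\<lambda>i\<in>{1..n}. Idt A (fst X)), ?h X)" "Cmp ?B = tuple_cmp n A" for X
    by (simp_all add: hyp_cat_def)
  have bij: "bij_betw (FArr ?F) (Hom L X Y) (Hom ?B (?h X) (?h Y))" if XY: "X \<in> Obj L" "Y \<in> Obj L" for X Y
  proof -
    have "FArr ?F ` Hom L X Y = Hom ?B (?h X) (?h Y)"
      by (simp only: hyp_hom[OF XY] L_hom[OF XY] Setcompr_eq_image image_image F)
    moreover have "inj_on (FArr ?F) (Hom L X Y)"
      by (auto simp: inj_on_def L_hom[OF XY] F)
    ultimately show ?thesis by (simp add: bij_betw_def)
  qed
  have "is_functor L ?B ?F"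
    unfolding is_functor_def
  proof (intro conjI ballI)
    fix X assume X: "X \<in> Obj L"
    show "FObj ?F X \<in> Obj ?B" using X by (simp add: F B)
    show "FArr ?F (Idt L X) = Idt ?B (FObj ?F X)"
      unfolding L_idt[OF X] F B ..
  next
    fix X Y f assume "X \<in> Obj L" "Y \<in> Obj L" "f \<in> Hom L X Y"
    then show "FArr ?F f \<in> Hom ?B (FObj ?F X) (FObj ?F Y)"
      using bij_betwE[OF bij[of X Y]] by (simp add: F)
  next
    fix X Y Z f g assume "X \<in> Obj L" "Y \<in> Obj L" "Z \<in> Obj L" "f \<in> Hom L X Y" "g \<in> Hom L Y Z"
    then obtain a b where ab: "f = (X, (\<lambda>i\<in>{1..n}. a), Y)" "g = (Y, (\<lambda>i\<in>{1..n}. b), Z)"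
      using L_hom by auto
    show "FArr ?F (Cmp L g f) = Cmp ?B (FArr ?F g) (FArr ?F f)"
      by (simp only: ab F B L_cmp tuple_cmp_const)
  qed
  then show ?thesis
    unfolding ff_onto_def using bij L_category hyp_category by (simp add: F B)
qed

text \<open>A morphism of hyperbolic objects has to respect the components \<open>g\<^sub>i\<close> and \<open>g'\<^sub>i\<close>.  The second
  condition follows from the first, so the hyperbolic category of a single preseed is full.\<close>

lemma hyperbolic_hom_hyp_obj:
  assumes XY: "X \<in> Obj L" "Y \<in> Obj L"
  shows "(\<lambda>i\<in>{1..n}. a) \<in> hyperbolic_hom n A (hyp_obj w s X) (hyp_obj w s Y) \<longleftrightarrow> a \<in> laurent_hom n A \<Theta> X Y"
proof -
  have "(\<forall>i\<in>{1..n}. Q) \<longleftrightarrow> Q" for Q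
    using n by auto
  then show ?thesis
    using mutated_component_square[OF _ XY, of _ a w s]
    by (auto simp: hyperbolic_hom_def hyp_obj_def laurent_hom_def ball_conj_distrib)
qed

end

context seed_mutation
begin

lemma mutations_seed:
  assumes "skew_laurent_seed n A P" "w \<in> histories n"
  shows "skew_laurent_seed n A (mutations n A P w)"
  using assms(2)
proof (induction w)
  case Nil
  then show ?case using assms by simp
next
  case (Cons m w)
  then have w: "w \<in> histories n" "snd m \<in> {1..n}"
    by (auto simp: histories_def)
  interpret laurent_seed A n P "mutations n A P w"
    by standard (use Cons w in simp)
  show ?case
    using mutate_seed[OF w(2)] by simp
qed

lemma mutations_ff_onto:
  assumes "skew_laurent_seed n A P" "w \<in> histories n"
  shows "\<exists>F. ff_onto (Laurent P) (Laurent (mutations n A P w)) F"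
  using assms(2)
proof (induction w)
  case Nil
  interpret laurent_seed A n P P by standard (fact assms)
  show ?case
    using ff_onto_id[OF L_category] by auto
next
  case (Cons m w)
  then have w: "w \<in> histories n" "snd m \<in> {1..n}"
    by (auto simp: histories_def)
  interpret laurent_seed A n P "mutations n A P w"
    by standard (rule mutations_seed[OF assms(1) w(1)])
  obtain F where "ff_onto (Laurent P) L F" using Cons w by auto
  then show ?case
    using ff_onto_comp mutation_ftr_ff_onto[OF w(2)] by (metis mutations.simps(2))
qed

context
  assumes seed_P: "skew_laurent_seed n A P"
begin

lemma hyperbolic_category_cases:
  assumes "B \<in> hyperbolic_categories n A P"
  obtains w s where "w \<in> histories n" "laurent_seed A n P (mutations n A P w)"
    "B = laurent_seed.hyp_cat A n P (mutations n A P w) w s"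
proof -
  obtain w s where w: "w \<in> histories n" and B: "B = hyperbolic_category_of n A P w s"
    using assms by (auto simp: hyperbolic_categories_def)
  interpret laurent_seed A n P "mutations n A P w"
    by standard (rule mutations_seed[OF seed_P w])
  have "B = hyp_cat w s"
    unfolding B hyperbolic_category_of_def hyp_cat_def hyperbolic_obj_def hyp_obj_def Let_def by simp
  then show thesis using that w laurent_seed_axioms by blast
qed

lemma hyperbolic_ff_onto:
  assumes "B \<in> hyperbolic_categories n A P"
  shows "\<exists>F. ff_onto (Laurent P) B F"
proof -
  obtain w s where w: "w \<in> histories n" and S: "laurent_seed A n P (mutations n A P w)"
    and B: "B = laurent_seed.hyp_cat A n P (mutations n A P w) w s"
    using hyperbolic_category_cases[OF assms] .
  interpret laurent_seed A n P "mutations n A P w" by (fact S)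
  show ?thesis
    unfolding B using mutations_ff_onto[OF seed_P w] hyp_ftr_ff_onto ff_onto_comp by blast
qed

lemma hyperbolic_object:
  assumes "B \<in> hyperbolic_categories n A P" "X \<in> Obj B"
  obtains T f' M f where "X = (T, f', M, f)" "M \<in> Obj A" "\<And>i. i \<in> {1..n} \<Longrightarrow> category_automorphism A (T i)"
    "\<And>i. i \<in> {1..n} \<Longrightarrow> f' i \<in> Hom A M (FObj (T i) M)" "\<And>i. i \<in> {1..n} \<Longrightarrow> f i \<in> Hom A (FObj (T i) M) M"
proof -
  obtain w s where w: "w \<in> histories n" and S: "laurent_seed A n P (mutations n A P w)"
    and B: "B = laurent_seed.hyp_cat A n P (mutations n A P w) w s"
    using hyperbolic_category_cases[OF assms(1)] .
  interpret laurent_seed A n P "mutations n A P w" by (fact S)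
  obtain X0 where "X0 \<in> Obj L" "X = hyp_obj w s X0"
    using assms(2) by (auto simp: B hyp_cat_def)
  then show thesis
    using that[of \<Theta> _ "fst X0" "snd X0"] theta L_obj L_comp_hom mutated_component_invertible[THEN invertible_hom]
    by (simp add: hyp_obj_def)
qed

text \<open>In the mutation category two hyperbolic morphisms can be composed because the functors of the
  middle object are those of both ends.\<close>

lemma clustered_category: "is_category (constant_tuples n (mutation_category n A P))" (is "is_category ?C")
proof -
  define H where "H X Y = {a. (\<lambda>i\<in>{1..n}. a) \<in> hyperbolic_hom n A X Y}" for X Y
  have ob: "Obj ?C = (\<Union>B\<in>hyperbolic_categories n A P. Obj B)"
    by (simp add: constant_tuples_def mutation_category_def)
  have H: "a \<in> H (T, f', M, f) (U, g', N, g) \<longleftrightarrow> T = U \<and> a \<in> Hom A M N \<and>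
      (\<forall>i\<in>{1..n}. Cmp A (FArr (T i) a) (f' i) = Cmp A (g' i) a \<and> Cmp A a (f i) = Cmp A (g i) (FArr (T i) a))"
    for a T f' M f U g' N g
    using n by (auto simp: H_def hyperbolic_hom_def)
  have obj: thesis if "X \<in> Obj ?C"
      "\<And>T f' M f. \<lbrakk>X = (T, f', M, f); M \<in> Obj A; \<And>i. i \<in> {1..n} \<Longrightarrow> category_automorphism A (T i);
        \<And>i. i \<in> {1..n} \<Longrightarrow> f' i \<in> Hom A M (FObj (T i) M); \<And>i. i \<in> {1..n} \<Longrightarrow> f i \<in> Hom A (FObj (T i) M) M\<rbrakk>
        \<Longrightarrow> thesis" for X thesis
    using that hyperbolic_object unfolding ob by blast
  show ?thesis
  proof (rule tuple_category[where u = "\<lambda>X. fst (laurent_part X)" and H = H, OF category n])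
    have "[] \<in> histories n"
      by (simp add: histories_def)
    then have B: "hyperbolic_category_of n A P [] RightSide \<in> hyperbolic_categories n A P"
      unfolding hyperbolic_categories_def by blast
    have "Obj (hyperbolic_category_of n A P [] RightSide) \<noteq> {}"
      using hyperbolic_ff_onto[OF B] by (auto simp: ff_onto_def is_category_def)
    then show "Obj ?C \<noteq> {}"
      using B unfolding ob by blast
  next
    fix X Y
    show "Hom ?C X Y = {(X, (\<lambda>i\<in>{1..n}. a), Y) | a. a \<in> H X Y}"
      by (auto simp: constant_tuples_def mutation_category_def H_def)
  next
    fix X Y assume "X \<in> Obj ?C" "Y \<in> Obj ?C"
    then show "H X Y \<subseteq> Hom A (fst (laurent_part X)) (fst (laurent_part Y))"
      by (cases X; cases Y) (auto simp: H)
  next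
    fix X assume "X \<in> Obj ?C"
    then show "fst (laurent_part X) \<in> Obj A" by (rule obj) simp
  next
    fix X assume "X \<in> Obj ?C"
    then show "Idt A (fst (laurent_part X)) \<in> H X X"
    proof (rule obj)
      fix T f' M f
      assume X: "X = (T, f', M, f)" and M: "M \<in> Obj A" and T: "\<And>i. i \<in> {1..n} \<Longrightarrow> category_automorphism A (T i)"
        and f': "\<And>i. i \<in> {1..n} \<Longrightarrow> f' i \<in> Hom A M (FObj (T i) M)"
        and f: "\<And>i. i \<in> {1..n} \<Longrightarrow> f i \<in> Hom A (FObj (T i) M) M"
      have "Cmp A (FArr (T i) (Idt A M)) (f' i) = Cmp A (f' i) (Idt A M) \<and>
          Cmp A (Idt A M) (f i) = Cmp A (f i) (FArr (T i) (Idt A M))" if i: "i \<in> {1..n}" for i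
      proof -
        interpret T: category_automorphism A "T i" by (rule T[OF i])
        show ?thesis
          using T.T(1,3)[OF M] cmp_idt[OF M T.T(1)[OF M] f'[OF i]] cmp_idt[OF T.T(1)[OF M] M f[OF i]] by simp
      qed
      then show ?thesis
        using M by (auto simp: X H)
    qed
  next
    fix X Y Z a b
    assume "X \<in> Obj ?C" "Y \<in> Obj ?C" "Z \<in> Obj ?C" and a: "a \<in> H X Y" and b: "b \<in> H Y Z"
    from this(3) show "Cmp A b a \<in> H X Z"
    proof (rule obj)
      fix V k' N' k
      assume Z: "Z = (V, k', N', k)" and N': "N' \<in> Obj A"
        and k': "\<And>i. i \<in> {1..n} \<Longrightarrow> k' i \<in> Hom A N' (FObj (V i) N')"
        and k: "\<And>i. i \<in> {1..n} \<Longrightarrow> k i \<in> Hom A (FObj (V i) N') N'"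
      from \<open>Y \<in> Obj ?C\<close> show ?thesis
      proof (rule obj)
        fix U g' N g
        assume Y: "Y = (U, g', N, g)" and N: "N \<in> Obj A"
          and g': "\<And>i. i \<in> {1..n} \<Longrightarrow> g' i \<in> Hom A N (FObj (U i) N)"
          and g: "\<And>i. i \<in> {1..n} \<Longrightarrow> g i \<in> Hom A (FObj (U i) N) N"
        from \<open>X \<in> Obj ?C\<close> show ?thesis
        proof (rule obj)
          fix T f' M f
          assume X: "X = (T, f', M, f)" and M: "M \<in> Obj A"
            and T: "\<And>i. i \<in> {1..n} \<Longrightarrow> category_automorphism A (T i)"
            and f': "\<And>i. i \<in> {1..n} \<Longrightarrow> f' i \<in> Hom A M (FObj (T i) M)"
            and f: "\<And>i. i \<in> {1..n} \<Longrightarrow> f i \<in> Hom A (FObj (T i) M) M"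
          have TUV: "U = T" "V = T" and h: "a \<in> Hom A M N" "b \<in> Hom A N N'"
            using a b by (simp_all add: X Y Z H)
          have "Cmp A (FArr (T i) (Cmp A b a)) (f' i) = Cmp A (k' i) (Cmp A b a) \<and>
              Cmp A (Cmp A b a) (f i) = Cmp A (k i) (FArr (T i) (Cmp A b a))" if i: "i \<in> {1..n}" for i
          proof -
            interpret T: category_automorphism A "T i" by (rule T[OF i])
            note t = T.T(1)[OF M] T.T(1)[OF N] T.T(1)[OF N']
            note Ta = T.T(2)[OF M N h(1)] and Tb = T.T(2)[OF N N' h(2)]
            have ab': "Cmp A (FArr (T i) a) (f' i) = Cmp A (g' i) a" "Cmp A a (f i) = Cmp A (g i) (FArr (T i) a)"
                "Cmp A (FArr (T i) b) (g' i) = Cmp A (k' i) b" "Cmp A b (g i) = Cmp A (k i) (FArr (T i) b)"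
              using a b i by (simp_all add: X Y Z H TUV)
            note f'i = f'[OF i] and fi = f[OF i] and g'i = g'[OF i, unfolded TUV] and gi = g[OF i, unfolded TUV]
              and k'i = k'[OF i, unfolded TUV] and ki = k[OF i, unfolded TUV]
            have "Cmp A (FArr (T i) (Cmp A b a)) (f' i) = Cmp A (FArr (T i) b) (Cmp A (g' i) a)"
              using T.T(4)[OF M N N' h] cmp_assoc[OF M t f'i Ta Tb] ab'(1) by simp
            also have "\<dots> = Cmp A (k' i) (Cmp A b a)"
              using cmp_assoc[OF M N t(2,3) h(1) g'i Tb] cmp_assoc[OF M N N' t(3) h k'i] ab'(3) by simp
            finally have 1: "Cmp A (FArr (T i) (Cmp A b a)) (f' i) = Cmp A (k' i) (Cmp A b a)" .
            have "Cmp A (Cmp A b a) (f i) = Cmp A b (Cmp A (g i) (FArr (T i) a))"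
              using cmp_assoc[OF t(1) M N N' fi h] ab'(2) by simp
            also have "\<dots> = Cmp A (k i) (FArr (T i) (Cmp A b a))"
              using cmp_assoc[OF t(1,2) N N' Ta gi h(2)] cmp_assoc[OF t N' Ta Tb ki] ab'(4) T.T(4)[OF M N N' h] by simp
            finally show ?thesis using 1 by simp
          qed
          then show ?thesis
            using cmp_hom[OF M N N' h] by (simp add: X Z H TUV)
        qed
      qed
    qed
  next
    show "Idt ?C X = (X, (\<lambda>i\<in>{1..n}. Idt A (fst (laurent_part X))), X)" for X
      by (simp add: constant_tuples_def mutation_category_def)
    show "Cmp ?C = tuple_cmp n A"
      by (simp add: constant_tuples_def mutation_category_def)
  qed
qed

lemma hyperbolic_full_subcategory:
  assumes "B \<in> hyperbolic_categories n A P"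
  shows "full_subcategory B (constant_tuples n (mutation_category n A P))" (is "full_subcategory B ?C")
proof -
  obtain w s where w: "w \<in> histories n" and S: "laurent_seed A n P (mutations n A P w)"
    and B: "B = laurent_seed.hyp_cat A n P (mutations n A P w) w s"
    using hyperbolic_category_cases[OF assms] .
  interpret laurent_seed A n P "mutations n A P w" by (fact S)
  have ob: "Obj B = hyp_obj w s ` Obj L" and idt: "Idt B = Idt ?C" and cmp: "Cmp B = Cmp ?C"
    by (simp_all add: B hyp_cat_def constant_tuples_def mutation_category_def)
  have "Hom B (hyp_obj w s X) (hyp_obj w s Y) = Hom ?C (hyp_obj w s X) (hyp_obj w s Y)"
    if XY: "X \<in> Obj L" "Y \<in> Obj L" for X Y
    unfolding B hyp_hom[OF XY] constant_tuples_def mutation_category_def category.simps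
    using hyperbolic_hom_hyp_obj[OF XY, of _ w s] by auto
  moreover have "Obj B \<subseteq> Obj ?C"
    using assms by (auto simp: constant_tuples_def mutation_category_def)
  moreover have "is_category B"
    unfolding B by (rule hyp_category)
  ultimately show ?thesis
    unfolding full_subcategory_def using clustered_category by (auto simp: ob idt cmp)
qed

lemma generated_by_hyperbolic_categories:
  "generated_by (constant_tuples n (mutation_category n A P)) (hyperbolic_categories n A P)"
  unfolding generated_by_def using hyperbolic_full_subcategory
  by (auto simp: constant_tuples_def mutation_category_def)

end
end

section \<open>The group ring and the action of the variables on it\<close>

locale weyl =
  fixes n :: nat
    and K P R :: "'d::{division_ring, ring_char_0} set"
    and F :: "nat \<Rightarrow> 'd set"
    and p :: "'d weyl_triple"
  assumes n: "n \<ge> 1"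
    and coefficients: "coefficients n K P F"
    and R: "R = group_ring K P"
    and preseed: "weyl_preseed n K P F p"
begin

abbreviation "x \<equiv> Var p"
abbreviation "\<theta> \<equiv> Aut p"
abbreviation "\<xi> \<equiv> Bin p"

lemma K: "0 \<in> K" "1 \<in> K" "a \<in> K \<Longrightarrow> b \<in> K \<Longrightarrow> a + b \<in> K" "a \<in> K \<Longrightarrow> b \<in> K \<Longrightarrow> a - b \<in> K"
    "a \<in> K \<Longrightarrow> b \<in> K \<Longrightarrow> a * b \<in> K" "a \<in> K \<Longrightarrow> a * d = d * a"
  using coefficients unfolding coefficients_def is_skew_subfield_def is_subring_def by blast+

lemma P_group: "comm_group (mult_group P)"
  using coefficients by (simp add: coefficients_def)

lemma P: "1 \<in> P" "u \<in> P \<Longrightarrow> v \<in> P \<Longrightarrow> u * v \<in> P" "u \<in> P \<Longrightarrow> v \<in> P \<Longrightarrow> u * v = v * u"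
proof -
  interpret comm_group "mult_group P" by (rule P_group)
  show "1 \<in> P" using one_closed by (simp add: mult_group_def)
  show "u \<in> P \<Longrightarrow> v \<in> P \<Longrightarrow> u * v \<in> P" using m_closed[of u v] by (simp add: mult_group_def)
  show "u \<in> P \<Longrightarrow> v \<in> P \<Longrightarrow> u * v = v * u" using m_comm[of u v] by (simp add: mult_group_def)
qed

lemma P_inv: "u \<in> P \<Longrightarrow> inv\<^bsub>mult_group P\<^esub> u \<in> P" "u \<in> P \<Longrightarrow> u * inv\<^bsub>mult_group P\<^esub> u = 1"
proof -
  interpret comm_group "mult_group P" by (rule P_group)
  show "u \<in> P \<Longrightarrow> inv\<^bsub>mult_group P\<^esub> u \<in> P" using inv_closed[of u] by (simp add: mult_group_def)
  show "u \<in> P \<Longrightarrow> u * inv\<^bsub>mult_group P\<^esub> u = 1" using r_inv[of u] by (simp add: mult_group_def)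
qed

lemma F_subset: "i \<in> {1..n} \<Longrightarrow> F i \<subseteq> P" and P_generated: "generate (mult_group P) (\<Union>i\<in>{1..n}. F i) = P"
  using coefficients unfolding coefficients_def by blast+

lemma R_iff: "r \<in> R \<longleftrightarrow> (\<exists>J c. r = (\<Sum>v\<in>J. c v * v) \<and> finite J \<and> J \<subseteq> P \<and> c ` J \<subseteq> K)"
  by (auto simp: R group_ring_def left_span_def)

lemma term_in_R: "c \<in> K \<Longrightarrow> v \<in> P \<Longrightarrow> c * v \<in> R"
  unfolding R_iff by (rule exI[of _ "{v}"], rule exI[of _ "\<lambda>_. c"]) auto

lemma R_zero: "0 \<in> R"
  using term_in_R[of 0 1] K P by simp

lemma K_in_R: "c \<in> K \<Longrightarrow> c \<in> R"
  using term_in_R[of c 1] P by simp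

lemma P_in_R: "v \<in> P \<Longrightarrow> v \<in> R"
  using term_in_R[of 1 v] K by simp

lemma R_add:
  assumes "r \<in> R" "s \<in> R"
  shows "r + s \<in> R"
proof -
  obtain J c where r: "r = (\<Sum>v\<in>J. c v * v)" "finite J" "J \<subseteq> P" "c ` J \<subseteq> K"
    using assms(1) by (auto simp: R_iff)
  obtain J' c' where s: "s = (\<Sum>v\<in>J'. c' v * v)" "finite J'" "J' \<subseteq> P" "c' ` J' \<subseteq> K"
    using assms(2) by (auto simp: R_iff)
  let ?c = "\<lambda>v. (if v \<in> J then c v else 0) + (if v \<in> J' then c' v else 0)"
  have "r = (\<Sum>v\<in>J \<union> J'. (if v \<in> J then c v else 0) * v)"
    unfolding r(1) by (rule sum.mono_neutral_cong_left) (use r s in auto)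
  moreover have "s = (\<Sum>v\<in>J \<union> J'. (if v \<in> J' then c' v else 0) * v)"
    unfolding s(1) by (rule sum.mono_neutral_cong_left) (use r s in auto)
  ultimately have "r + s = (\<Sum>v\<in>J \<union> J'. ?c v * v)"
    by (simp add: sum.distrib distrib_right)
  moreover have "?c ` (J \<union> J') \<subseteq> K"
    using r(4) s(4) K(1,3) by (auto simp: image_subset_iff)
  ultimately show ?thesis
    unfolding R_iff using r s by (intro exI[of _ "J \<union> J'"] exI[of _ ?c]) auto
qed

lemma R_induct [consumes 1, case_names zero single add]:
  assumes "r \<in> R" and "Q 0" and "\<And>c v. c \<in> K \<Longrightarrow> v \<in> P \<Longrightarrow> Q (c * v)"
    and "\<And>a b. \<lbrakk>a \<in> R; b \<in> R; Q a; Q b\<rbrakk> \<Longrightarrow> Q (a + b)"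
  shows "Q r"
proof -
  obtain J c where r: "r = (\<Sum>v\<in>J. c v * v)" "finite J" "J \<subseteq> P" "c ` J \<subseteq> K"
    using assms(1) by (auto simp: R_iff)
  have "(\<Sum>v\<in>J. c v * v) \<in> R \<and> Q (\<Sum>v\<in>J. c v * v)"
    using r(2-4)
  proof (induction J rule: finite_induct)
    case empty
    then show ?case using R_zero assms(2) by simp
  next
    case (insert v J)
    then show ?case
      using assms(3,4) term_in_R R_add by simp
  qed
  then show ?thesis using r(1) by simp
qed

lemma term_mult: "\<lbrakk>c \<in> K; d \<in> K; v \<in> P; w \<in> P\<rbrakk> \<Longrightarrow> c * v * (d * w) = c * d * (v * w)"
  using K(6)[of d v] by (simp add: mult.assoc) (metis mult.assoc)

lemma R_mult: "r \<in> R \<Longrightarrow> s \<in> R \<Longrightarrow> r * s \<in> R"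
proof (induction r rule: R_induct)
  case (single c v)
  from single(3) show ?case
  proof (induction s rule: R_induct)
    case (single d w)
    then show ?case using \<open>c \<in> K\<close> \<open>v \<in> P\<close> term_mult term_in_R K(5) P(2) by simp
  qed (simp_all add: R_zero R_add distrib_left)
qed (simp_all add: R_zero R_add distrib_right)

lemma R_one: "1 \<in> R" and R_minus_one: "-1 \<in> R"
  using K_in_R[OF K(2)] K_in_R[OF K(4)[OF K(1,2)]] by simp_all

lemma \<theta>_bij: "i \<in> {1..n} \<Longrightarrow> bij_betw (\<theta> i) R R"
  and \<theta>_K: "i \<in> {1..n} \<Longrightarrow> c \<in> K \<Longrightarrow> \<theta> i c = c"
  and \<theta>_add: "i \<in> {1..n} \<Longrightarrow> a \<in> R \<Longrightarrow> b \<in> R \<Longrightarrow> \<theta> i (a + b) = \<theta> i a + \<theta> i b"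
  and \<theta>_mult: "i \<in> {1..n} \<Longrightarrow> a \<in> R \<Longrightarrow> b \<in> R \<Longrightarrow> \<theta> i (a * b) = \<theta> i a * \<theta> i b"
  using preseed by (auto simp: weyl_preseed_def Let_def group_ring_automorphism_def R)

lemma x_F:
  assumes "i \<in> {1..n}" "j \<in> {1..n}" "f \<in> F j"
  shows "x i * f = \<theta> i f * x i"
proof (cases "i = j")
  case True
  then show ?thesis using assms preseed by (auto simp: weyl_preseed_def Let_def)
next
  case False
  then have "x i * f = f * x i" "\<theta> i f = f"
    using assms preseed by (auto simp: weyl_preseed_def Let_def is_cluster_def)
  then show ?thesis by simp
qed

lemma x_commute: "i \<in> {1..n} \<Longrightarrow> j \<in> {1..n} \<Longrightarrow> x i * x j = x j * x i"
  using preseed by (auto simp: weyl_preseed_def Let_def is_cluster_def free_generators_def)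

text \<open>The commutation rule is imposed on the generators only.  It passes to products because \<open>\<theta>\<^sub>i\<close> is
  multiplicative, and to inverses because \<open>\<theta>\<^sub>i\<close> takes the inverse of \<open>f\<close> to the inverse of \<open>\<theta>\<^sub>i(f)\<close>.\<close>

lemma x_P:
  assumes i: "i \<in> {1..n}" and v: "v \<in> P"
  shows "x i * v = \<theta> i v * x i"
proof -
  have F: "f \<in> P \<and> x i * f = \<theta> i f * x i" if "f \<in> (\<Union>j\<in>{1..n}. F j)" for f
    using that F_subset x_F[OF i] by blast
  have "v \<in> generate (mult_group P) (\<Union>j\<in>{1..n}. F j)"
    using v P_generated by simp
  then have "v \<in> P \<and> x i * v = \<theta> i v * x i"
  proof (induction rule: generate.induct)
    case one
    then show ?case using P(1) \<theta>_K[OF i K(2)] by (simp add: mult_group_def)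
  next
    case (incl f)
    then show ?case using F by blast
  next
    case (inv f)
    let ?g = "inv\<^bsub>mult_group P\<^esub> f"
    have f: "f \<in> P" "x i * f = \<theta> i f * x i" using F inv by auto
    have g: "?g \<in> P" "f * ?g = 1" using P_inv f by auto
    have "\<theta> i ?g * \<theta> i f = 1"
      using \<theta>_mult[OF i P_in_R P_in_R, of ?g f] f g P(3) \<theta>_K[OF i K(2)] by metis
    moreover have "\<theta> i f * (x i * ?g) = x i"
      using f(2) g(2) by (metis mult.assoc mult.right_neutral)
    ultimately have "x i * ?g = \<theta> i ?g * x i"
      by (metis mult.assoc mult.left_neutral)
    then show ?case using g by simp
  next
    case (eng u v)
    then have "x i * (u * v) = \<theta> i u * \<theta> i v * x i"
      by (metis mult.assoc)
    then show ?case
      using eng P(2) \<theta>_mult[OF i P_in_R P_in_R, of u v] by (simp add: mult_group_def)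
  qed
  then show ?thesis by simp
qed

lemma x_R:
  assumes i: "i \<in> {1..n}" and r: "r \<in> R"
  shows "x i * r = \<theta> i r * x i"
  using r
proof (induction r rule: R_induct)
  case zero
  then show ?case using \<theta>_K[OF i K(1)] by simp
next
  case (single c v)
  have "x i * (c * v) = c * (x i * v)"
    using K(6)[of c "x i"] single by (metis mult.assoc)
  then show ?case
    using single x_P[OF i] \<theta>_mult[OF i K_in_R P_in_R] \<theta>_K[OF i] by (simp add: mult.assoc)
next
  case (add a b)
  then show ?case using \<theta>_add[OF i] by (simp add: distrib_left distrib_right)
qed

lemma x_nonzero:
  assumes i: "i \<in> {1..n}"
  shows "x i \<noteq> 0"
proof
  assume 0: "x i = 0"
  define a where "a j = (if j = i then 1 else 0 :: nat)" for j
  have "left_independent R (var_monomial n x) {a. \<forall>i. i \<notin> {1..n} \<longrightarrow> a i = 0}"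
    using preseed by (auto simp: weyl_preseed_def Let_def is_cluster_def free_generators_def R)
  moreover have "var_monomial n x a = 0"
    using i 0 by (auto simp: var_monomial_def prod_list_zero_iff a_def image_iff intro!: bexI[of _ i])
  moreover have "a \<in> {a. \<forall>i. i \<notin> {1..n} \<longrightarrow> a i = 0}"
    using i by (auto simp: a_def)
  ultimately show False
    using R_one unfolding left_independent_def
    by (elim allE[of _ "{a}"] allE[of _ "\<lambda>_. 1"]) simp
qed

lemma \<theta>_inv_in_R: "i \<in> {1..n} \<Longrightarrow> r \<in> R \<Longrightarrow> inv_into R (\<theta> i) r \<in> R"
  using \<theta>_bij by (metis bij_betw_imp_surj_on inv_into_into)

lemma \<theta>_\<theta>_inv: "i \<in> {1..n} \<Longrightarrow> r \<in> R \<Longrightarrow> \<theta> i (inv_into R (\<theta> i) r) = r"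
  using \<theta>_bij by (metis bij_betw_inv_into_right)

lemma \<theta>_inv_\<theta>: "i \<in> {1..n} \<Longrightarrow> r \<in> R \<Longrightarrow> inv_into R (\<theta> i) (\<theta> i r) = r"
  using \<theta>_bij by (metis bij_betw_inv_into_left)

lemma \<theta>_in_R: "i \<in> {1..n} \<Longrightarrow> r \<in> R \<Longrightarrow> \<theta> i r \<in> R"
  using \<theta>_bij by (metis bij_betwE)

lemma x_\<theta>_inv: "i \<in> {1..n} \<Longrightarrow> r \<in> R \<Longrightarrow> x i * inv_into R (\<theta> i) r = r * x i"
  using x_R \<theta>_inv_in_R \<theta>_\<theta>_inv by metis

text \<open>On \<open>R\<close> the automorphism \<open>\<theta>\<^sub>i\<close> is conjugation by \<open>x\<^sub>i\<close>; since the \<open>x\<^sub>i\<close> commute, so do the \<open>\<theta>\<^sub>i\<close>.\<close>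

lemma \<theta>_inv_commute:
  assumes i: "i \<in> {1..n}" and j: "j \<in> {1..n}" and r: "r \<in> R"
  shows "inv_into R (\<theta> i) (inv_into R (\<theta> j) r) = inv_into R (\<theta> j) (inv_into R (\<theta> i) r)"
proof -
  let ?i = "inv_into R (\<theta> i)" and ?j = "inv_into R (\<theta> j)"
  have "x j * x i * ?i (?j r) = r * (x j * x i)"
    using x_\<theta>_inv[OF i \<theta>_inv_in_R[OF j r]] x_\<theta>_inv[OF j r] by (metis mult.assoc)
  moreover have "x i * x j * ?j (?i r) = r * (x i * x j)"
    using x_\<theta>_inv[OF j \<theta>_inv_in_R[OF i r]] x_\<theta>_inv[OF i r] by (metis mult.assoc)
  ultimately have "x j * x i * ?i (?j r) = x j * x i * ?j (?i r)"
    using x_commute[OF i j] by simp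
  then show ?thesis
    using x_nonzero[OF i] x_nonzero[OF j] by simp
qed

lemma \<xi>_in_R: "i \<in> {1..n} \<Longrightarrow> \<xi> i \<in> R" and \<xi>_nonzero: "i \<in> {1..n} \<Longrightarrow> \<xi> i \<noteq> 0"
proof -
  assume i: "i \<in> {1..n}"
  interpret G: comm_group "mult_group P" by (rule P_group)
  have "generate (mult_group P) (F i) \<subseteq> P"
    using G.generate_incl[of "F i"] F_subset[OF i] by (simp add: mult_group_def)
  then obtain u v where uv: "u \<in> P" "v \<in> P" "\<xi> i = u + v"
    using preseed i unfolding weyl_preseed_def Let_def by blast
  then show "\<xi> i \<in> R" using P_in_R R_add by simp
  show "\<xi> i \<noteq> 0"
  proof
    assume 0: "\<xi> i = 0"
    \<comment> \<open>The relation is indexed by the set \<open>{u, v}\<close>, which has a single element if \<open>u = v\<close>.\<close>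
    define c where "c = (\<lambda>_::'d. if u = v then 2 else 1 :: 'd)"
    have "(\<Sum>w\<in>{u, v}. c w * w) = 0"
      using 0 uv by (cases "u = v") (auto simp: c_def mult_2)
    moreover have "(2::'d) \<in> K"
      using K(3)[OF K(2) K(2)] by simp
    ultimately have "c u = 0"
      using coefficients uv K(2) unfolding coefficients_def left_independent_def
      by (elim conjE allE[of _ "{u, v}"] allE[of _ c]) (auto simp: c_def split: if_splits)
    then show False by (simp add: c_def split: if_splits)
  qed
qed


section \<open>Cluster variables\<close>

abbreviation "cv w \<equiv> Var (weyl_mutations R p w)"
abbreviation "H \<equiv> weyl_cluster_algebra n R p"

lemma Bin_mutations: "Bin (weyl_mutations R p w) = \<xi>"
  by (induction w) (simp_all add: weyl_mutate_def)

text \<open>Without this the exchange relations would fail, as \<open>inverse 0 = 0\<close>; it rests on \<open>\<xi>\<^sub>i \<noteq> 0\<close>, where a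
  binomial \<open>u + u\<close> requires characteristic zero.\<close>

lemma cv_nonzero: "w \<in> histories n \<Longrightarrow> i \<in> {1..n} \<Longrightarrow> cv w i \<noteq> 0"
proof (induction w)
  case (Cons m w)
  then show ?case
    using \<xi>_nonzero by (cases "fst m") (auto simp: weyl_mutate_def Bin_mutations histories_def)
qed (simp add: x_nonzero)

text \<open>The ambient skew-field need not be commutative, and which of the two products is \<open>\<xi>\<^sub>k\<close> depends on the side.\<close>

lemma exchange:
  assumes "w \<in> histories n" "k \<in> {1..n}"
  shows "cv ((RightSide, k) # w) k * cv w k = \<xi> k" "cv w k * cv ((LeftSide, k) # w) k = \<xi> k"
proof -
  have "cv w k \<noteq> 0" using cv_nonzero assms .
  then show "cv ((RightSide, k) # w) k * cv w k = \<xi> k" "cv w k * cv ((LeftSide, k) # w) k = \<xi> k"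
    by (simp_all add: weyl_mutate_def Bin_mutations mult.assoc) (simp add: mult.assoc[symmetric])
qed

lemma cv_other: "i \<noteq> snd m \<Longrightarrow> cv (m # w) i = cv w i"
  by (simp add: weyl_mutate_def)

lemma H_contains: "R \<subseteq> H" "cluster_variables n R p \<subseteq> H"
  using hull_subset[of "R \<union> cluster_variables n R p" is_subring] by (auto simp: weyl_cluster_algebra_def)

lemma cv_in_H: "w \<in> histories n \<Longrightarrow> i \<in> {1..n} \<Longrightarrow> cv w i \<in> H"
  using H_contains(2) by (auto simp: cluster_variables_def)

lemma x_in_H: "i \<in> {1..n} \<Longrightarrow> x i \<in> H"
  using cv_in_H[of "[]" i] by (simp add: histories_def)

lemma H_subring: "is_subring H"
  unfolding weyl_cluster_algebra_def by (rule hull_in) (auto simp: is_subring_def)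

lemma H_closed: "a \<in> H \<Longrightarrow> b \<in> H \<Longrightarrow> a + b \<in> H" "a \<in> H \<Longrightarrow> b \<in> H \<Longrightarrow> a - b \<in> H" "a \<in> H \<Longrightarrow> b \<in> H \<Longrightarrow> a * b \<in> H"
  using H_subring by (auto simp: is_subring_def)

lemma H_minimal: "\<lbrakk>is_subring T; R \<subseteq> T; cluster_variables n R p \<subseteq> T\<rbrakk> \<Longrightarrow> H \<subseteq> T"
  unfolding weyl_cluster_algebra_def by (rule hull_minimal) auto

end

section \<open>Module categories\<close>

lemma left_moduleD:
  assumes "left_module S M"
  shows "abelian_group M"
    and "r \<in> S \<Longrightarrow> m \<in> carrier M \<Longrightarrow> r \<odot>\<^bsub>M\<^esub> m \<in> carrier M"
    and "r \<in> S \<Longrightarrow> m \<in> carrier M \<Longrightarrow> m' \<in> carrier M \<Longrightarrow>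
      r \<odot>\<^bsub>M\<^esub> (m \<oplus>\<^bsub>M\<^esub> m') = r \<odot>\<^bsub>M\<^esub> m \<oplus>\<^bsub>M\<^esub> r \<odot>\<^bsub>M\<^esub> m'"
    and "r \<in> S \<Longrightarrow> r' \<in> S \<Longrightarrow> m \<in> carrier M \<Longrightarrow> (r + r') \<odot>\<^bsub>M\<^esub> m = r \<odot>\<^bsub>M\<^esub> m \<oplus>\<^bsub>M\<^esub> r' \<odot>\<^bsub>M\<^esub> m"
    and "r \<in> S \<Longrightarrow> r' \<in> S \<Longrightarrow> m \<in> carrier M \<Longrightarrow> (r * r') \<odot>\<^bsub>M\<^esub> m = r \<odot>\<^bsub>M\<^esub> (r' \<odot>\<^bsub>M\<^esub> m)"
    and "m \<in> carrier M \<Longrightarrow> 1 \<odot>\<^bsub>M\<^esub> m = m"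
  using assms unfolding left_module_def by blast+

lemma module_mapsD:
  assumes "h \<in> module_maps S M N"
  shows "h \<in> carrier M \<rightarrow>\<^sub>E carrier N" "m \<in> carrier M \<Longrightarrow> h m \<in> carrier N"
    and "m \<in> carrier M \<Longrightarrow> m' \<in> carrier M \<Longrightarrow> h (m \<oplus>\<^bsub>M\<^esub> m') = h m \<oplus>\<^bsub>N\<^esub> h m'"
    and "r \<in> S \<Longrightarrow> m \<in> carrier M \<Longrightarrow> h (r \<odot>\<^bsub>M\<^esub> m) = r \<odot>\<^bsub>N\<^esub> h m"
  using assms by (auto simp: module_maps_def)

lemma abelian_group_smult_update: "abelian_group (M\<lparr>smult := f\<rparr>) \<longleftrightarrow> abelian_group M"
  by (simp add: abelian_group_def abelian_monoid_def abelian_group_axioms_def)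

lemma module_maps_compose:
  assumes h: "h \<in> module_maps S L M" and k: "k \<in> module_maps S M N" and L: "left_module S L"
  shows "compose (carrier L) k h \<in> module_maps S L N"
proof -
  have "m \<oplus>\<^bsub>L\<^esub> m' \<in> carrier L" if "m \<in> carrier L" "m' \<in> carrier L" for m m'
    using that left_moduleD(1)[OF L] by (simp add: abelian_groupE(1))
  then show ?thesis
    using module_mapsD[OF h] module_mapsD[OF k] left_moduleD(2)[OF L]
    by (auto simp: module_maps_def compose_def)
qed

lemma module_maps_id:
  assumes M: "left_module S M"
  shows "(\<lambda>m\<in>carrier M. m) \<in> module_maps S M M"
proof -
  have "m \<oplus>\<^bsub>M\<^esub> m' \<in> carrier M" if "m \<in> carrier M" "m' \<in> carrier M" for m m'
    using that left_moduleD(1)[OF M] by (simp add: abelian_groupE(1))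
  then show ?thesis
    using left_moduleD(2)[OF M] by (auto simp: module_maps_def)
qed

lemma module_subcategory:
  fixes \<O> :: "('d::ring_1, 'm) module set"
  assumes \<O>: "\<O> \<subseteq> {M. left_module S M}" "\<O> \<noteq> {}"
  shows "is_category ((modules_over S)\<lparr>Obj := \<O>\<rparr>)"
proof -
  define C where "C = (modules_over S)\<lparr>Obj := \<O>\<rparr>"
  have h: "h \<in> carrier M \<rightarrow> carrier N" "h \<in> extensional (carrier M)"
    if "h \<in> module_maps S M N" for h and M N :: "('d, 'm) module"
    using module_mapsD(1)[OF that] by (auto simp: PiE_def)
  have C: "Obj C = \<O>" "f \<in> Hom C M N \<longleftrightarrow> (\<exists>h. f = (M, h, N) \<and> h \<in> module_maps S M N)"
      "Idt C M = (M, (\<lambda>m\<in>carrier M. m), M)"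
      "Cmp C (M1, k, N) (L, h, M2) = (L, compose (carrier L) k h, N)" for f M N k h M1 M2 L
    by (auto simp: modules_over_def C_def)
  have "is_category C"
    unfolding is_category_def C(1)
  proof (intro conjI ballI impI)
    fix M assume "M \<in> \<O>"
    then show "Idt C M \<in> Hom C M M"
      using \<O> module_maps_id[of S M] by (auto simp: C)
  next
    fix L M N f g assume "L \<in> \<O>" "f \<in> Hom C L M" "g \<in> Hom C M N"
    then show "Cmp C g f \<in> Hom C L N"
      using \<O> module_maps_compose[of _ S L M _ N] by (auto simp: C)
  next
    fix M N f assume "f \<in> Hom C M N"
    then obtain h where "f = (M, h, N)" "h \<in> module_maps S M N" by (auto simp: C)
    then show "Cmp C f (Idt C M) = f" "Cmp C (Idt C N) f = f"
      using h[of h M N] by (auto simp: C Id_compose compose_Id)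
  next
    fix L M N Q f g k assume "f \<in> Hom C L M" "g \<in> Hom C M N" "k \<in> Hom C N Q"
    then obtain a b c where "f = (L, a, M)" "g = (M, b, N)" "k = (N, c, Q)" "a \<in> module_maps S L M"
      by (auto simp: C)
    then show "Cmp C k (Cmp C g f) = Cmp C (Cmp C k g) f"
      using compose_assoc[OF h(1), of a L M c b] by (auto simp: C)
  qed (use \<O> in \<open>auto simp: C\<close>)
  then show ?thesis by (simp add: C_def)
qed

lemma inverse_module_map:
  assumes M: "left_module S M" and N: "left_module S N"
    and h: "h \<in> module_maps S M N" and bij: "bij_betw h (carrier M) (carrier N)"
  shows "restrict (inv_into (carrier M) h) (carrier N) \<in> module_maps S N M"
proof -
  let ?g = "inv_into (carrier M) h"
  note Mgrp = left_moduleD(1)[OF M] and Ngrp = left_moduleD(1)[OF N]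
  have g: "?g m \<in> carrier M" "h (?g m) = m" if "m \<in> carrier N" for m
    using that bij by (auto simp: bij_betw_def inv_into_into f_inv_into_f)
  have inj: "u = v" if "h u = h v" "u \<in> carrier M" "v \<in> carrier M" for u v
    using that bij by (auto simp: bij_betw_def inj_on_def)
  have cl: "u \<oplus>\<^bsub>M\<^esub> v \<in> carrier M" if "u \<in> carrier M" "v \<in> carrier M" for u v
    using that Mgrp by (simp add: abelian_groupE(1))
  have cl': "u \<oplus>\<^bsub>N\<^esub> v \<in> carrier N" if "u \<in> carrier N" "v \<in> carrier N" for u v
    using that Ngrp by (simp add: abelian_groupE(1))
  have "?g (m \<oplus>\<^bsub>N\<^esub> m') = ?g m \<oplus>\<^bsub>M\<^esub> ?g m'" if "m \<in> carrier N" "m' \<in> carrier N" for m m'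
    using that g cl cl' module_mapsD(3)[OF h] by (intro inj[of "?g (m \<oplus>\<^bsub>N\<^esub> m')" "?g m \<oplus>\<^bsub>M\<^esub> ?g m'"]) simp_all
  moreover have "?g (r \<odot>\<^bsub>N\<^esub> m) = r \<odot>\<^bsub>M\<^esub> ?g m" if "r \<in> S" "m \<in> carrier N" for r m
    using that g left_moduleD(2)[OF M] left_moduleD(2)[OF N] module_mapsD(4)[OF h] by (intro inj[of "?g (r \<odot>\<^bsub>N\<^esub> m)" "r \<odot>\<^bsub>M\<^esub> ?g m"]) simp_all
  ultimately show ?thesis
    using g cl' left_moduleD(2)[OF N] by (auto simp: module_maps_def)
qed

text \<open>With multiplication by a variable as \<open>\<beta>\<close>, this produces modules over the cluster algebra that
  realize the twisted \<open>R\<close>-modules.\<close>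

lemma left_module_transport:
  assumes N: "left_module S N" and bij: "bij_betw \<beta> (carrier N) (carrier N)"
    and add: "\<And>m m'. m \<in> carrier N \<Longrightarrow> m' \<in> carrier N \<Longrightarrow> \<beta> (m \<oplus>\<^bsub>N\<^esub> m') = \<beta> m \<oplus>\<^bsub>N\<^esub> \<beta> m'"
  shows "left_module S (N\<lparr>smult := \<lambda>d m. inv_into (carrier N) \<beta> (d \<odot>\<^bsub>N\<^esub> \<beta> m)\<rparr>)"
proof -
  let ?\<gamma> = "inv_into (carrier N) \<beta>"
  note N' = left_moduleD[OF N]
  have cl: "u \<oplus>\<^bsub>N\<^esub> v \<in> carrier N" if "u \<in> carrier N" "v \<in> carrier N" for u v
    using that N'(1) by (simp add: abelian_groupE(1))
  have \<beta>: "\<beta> m \<in> carrier N" "?\<gamma> m \<in> carrier N" "\<beta> (?\<gamma> m) = m" "?\<gamma> (\<beta> m) = m" if "m \<in> carrier N" for m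
    using that bij by (auto simp: bij_betw_def inv_into_into f_inv_into_f)
  have \<gamma>_add: "?\<gamma> (m \<oplus>\<^bsub>N\<^esub> m') = ?\<gamma> m \<oplus>\<^bsub>N\<^esub> ?\<gamma> m'" if "m \<in> carrier N" "m' \<in> carrier N" for m m'
    using add[of "?\<gamma> m" "?\<gamma> m'"] \<beta> that cl by metis
  show ?thesis
    unfolding left_module_def abelian_group_smult_update
    by (intro conjI ballI N'(1)) (simp_all add: \<beta> add \<gamma>_add cl N')
qed

lemma with_action_cong:
  "(\<And>r m. r \<in> R \<Longrightarrow> m \<in> carrier M \<Longrightarrow> a r m = b r m) \<Longrightarrow> with_action R a M = with_action R b M"
  unfolding with_action_def by (rule arg_cong[where f = "\<lambda>s. M\<lparr>smult := s\<rparr>"]) (auto simp: fun_eq_iff)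

lemma with_action_simps [simp]:
  "carrier (with_action R a M) = carrier M" "add (with_action R a M) = add M" "zero (with_action R a M) = zero M"
  "r \<in> R \<Longrightarrow> m \<in> carrier M \<Longrightarrow> r \<odot>\<^bsub>with_action R a M\<^esub> m = a r m"
  "with_action R a (with_action R b M) = with_action R a M"
  "with_action R a (M\<lparr>smult := c\<rparr>) = with_action R a M"
  by (simp_all add: with_action_def)

lemma forget_to_simps [simp]:
  "carrier (forget_to R M) = carrier M" "add (forget_to R M) = add M" "zero (forget_to R M) = zero M"
  "r \<in> R \<Longrightarrow> m \<in> carrier M \<Longrightarrow> r \<odot>\<^bsub>forget_to R M\<^esub> m = r \<odot>\<^bsub>M\<^esub> m"
  "with_action R a (forget_to R M) = with_action R a M"
  by (simp_all add: forget_to_def)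

lemma twist_simps [simp]:
  "carrier (twist R \<phi> M) = carrier M" "add (twist R \<phi> M) = add M" "zero (twist R \<phi> M) = zero M"
  "r \<in> R \<Longrightarrow> m \<in> carrier M \<Longrightarrow> r \<odot>\<^bsub>twist R \<phi> M\<^esub> m = inv_into R \<phi> r \<odot>\<^bsub>M\<^esub> m"
  by (simp_all add: twist_def)

section \<open>Modules over the Weyl cluster algebra\<close>

lemma bij_betw_left_factor:
  assumes "bij_betw f A A" "bij_betw h A A" "\<And>a. a \<in> A \<Longrightarrow> g (f a) = h a"
  shows "bij_betw g A A"
proof -
  have "bij_betw (h \<circ> inv_into A f) A A"
    using assms(1,2) bij_betw_inv_into bij_betw_trans by blast
  then show ?thesis
    by (rule bij_betw_cong[THEN iffD1, rotated])
      (metis assms(1,3) bij_betw_inv_into_right bij_betw_def comp_apply inv_into_into)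
qed

lemma bij_betw_right_factor:
  assumes "bij_betw f A A" "bij_betw h A A" "\<And>a. a \<in> A \<Longrightarrow> f (g a) = h a" "\<And>a. a \<in> A \<Longrightarrow> g a \<in> A"
  shows "bij_betw g A A"
proof -
  have "bij_betw (inv_into A f \<circ> h) A A"
    using assms(1,2) bij_betw_inv_into bij_betw_trans by blast
  then show ?thesis
    by (rule bij_betw_cong[THEN iffD1, rotated]) (metis assms(1,3,4) bij_betw_inv_into_left comp_apply)
qed

lemma bij_betw_middle_factor:
  assumes h: "bij_betw h A A" and l: "\<And>a. a \<in> A \<Longrightarrow> f (l a) = h a" and r: "\<And>a. a \<in> A \<Longrightarrow> r (f a) = h a"
    and maps: "\<And>a. a \<in> A \<Longrightarrow> f a \<in> A" "\<And>a. a \<in> A \<Longrightarrow> l a \<in> A"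
  shows "bij_betw f A A"
proof (rule bij_betwI')
  fix a b assume "a \<in> A" "b \<in> A"
  then show "f a = f b \<longleftrightarrow> a = b"
    using r h unfolding bij_betw_def inj_on_def by metis
next
  fix b assume "b \<in> A"
  then have "b \<in> h ` A"
    by (simp add: bij_betw_imp_surj_on[OF h])
  then obtain a where "a \<in> A" "h a = b" by blast
  then show "\<exists>a\<in>A. b = f a"
    using l maps(2) by metis
qed (rule maps(1))

locale weyl_modules = weyl n K P R F p
  for n :: nat and K P R :: "'d::{division_ring, ring_char_0} set" and F p +
  fixes A :: "('d, 'm) module_category" and W :: "('d, 'm) module_preseed"
  assumes A: "A = A_cat n R p" and W: "W = W0 n R p" and inverses: "inverses_exist n A W"
begin

lemma zero_module: "\<exists>M :: ('d, 'm) module. left_module S M"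
proof
  show "left_module S \<lparr>carrier = {u :: 'm}, mult = \<lambda>_ _. u, one = u, zero = u, add = \<lambda>_ _. u, smult = \<lambda>_ _. u\<rparr>" for u
    unfolding left_module_def by (auto intro!: abelian_groupI)
qed

lemma modules_H_category: "is_category (modules_over H :: ('d, 'm) module_category)"
proof -
  have "is_category ((modules_over H)\<lparr>Obj := {M :: ('d, 'm) module. left_module H M}\<rparr>)"
    by (rule module_subcategory) (use zero_module in auto)
  moreover have "(modules_over H)\<lparr>Obj := {M :: ('d, 'm) module. left_module H M}\<rparr> = modules_over H"
    by (simp add: modules_over_def)
  ultimately show ?thesis by simp
qed

lemma left_module_forget:
  assumes "left_module H N"
  shows "left_module R (forget_to R N)"
proof -
  have "R \<subseteq> H" by (rule H_contains)
  note N = left_moduleD[OF assms]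
  have "abelian_group (forget_to R N)"
    unfolding forget_to_def with_action_def abelian_group_smult_update by (rule N(1))
  moreover have "u \<oplus>\<^bsub>N\<^esub> v \<in> carrier N" if "u \<in> carrier N" "v \<in> carrier N" for u v
    using that N(1) by (simp add: abelian_groupE(1))
  ultimately show ?thesis
    using \<open>R \<subseteq> H\<close> R_add R_mult R_one N unfolding left_module_def by (simp add: subset_iff)
qed

lemma A_simps:
  "M \<in> Obj A \<longleftrightarrow> (\<exists>N. left_module H N \<and> M = forget_to R N)"
  "f \<in> Hom A M N \<longleftrightarrow> (\<exists>h. f = (M, h, N) \<and> h \<in> module_maps R M N)"
  "Idt A M = (M, (\<lambda>m\<in>carrier M. m), M)"
  "Cmp A (M1, k, N) (M, h, M2) = (M, compose (carrier M) k h, N)"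
  by (auto simp: A A_cat_def modules_over_def)

lemma forget_in_A: "left_module H N \<Longrightarrow> forget_to R N \<in> Obj A"
  by (auto simp: A_simps)

lemma A_left_module: "M \<in> Obj A \<Longrightarrow> left_module R M"
  using left_module_forget by (auto simp: A_simps)

lemma A_forget_to: "M \<in> Obj A \<Longrightarrow> forget_to R M = M"
  by (auto simp: A_simps forget_to_def intro!: with_action_cong)

lemma A_arr: "f \<in> Arr A \<longleftrightarrow> (\<exists>M h N. f = (M, h, N) \<and> M \<in> Obj A \<and> N \<in> Obj A \<and> h \<in> module_maps R M N)"
  by (auto simp: Arr_def A_simps(2))

lemma A_category: "is_category A"
  unfolding A A_cat_def
  by (rule module_subcategory) (use left_module_forget zero_module in \<open>auto simp: modules_over_def\<close>)

lemma W_simps: "Theta W i = twist_ftr n R p i" "Xi W i M = (M, action_map M (\<xi> i), M)"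
  by (simp_all add: W W0_def Let_def)

lemma bij_invertible:
  assumes o: "M \<in> Obj A" "N \<in> Obj A" and h: "h \<in> module_maps R M N" and bij: "bij_betw h (carrier M) (carrier N)"
  shows "invertible A M N (M, h, N)"
proof -
  let ?g = "restrict (inv_into (carrier M) h) (carrier N)"
  have "?g \<in> module_maps R N M"
    by (rule inverse_module_map[OF A_left_module[OF o(1)] A_left_module[OF o(2)] h bij])
  moreover have "compose (carrier M) ?g h = (\<lambda>m\<in>carrier M. m)"
    using bij module_mapsD(2)[OF h] by (auto simp: compose_def bij_betw_inv_into_left fun_eq_iff)
  moreover have "compose (carrier N) h ?g = (\<lambda>m\<in>carrier N. m)"
    using bij by (auto simp: compose_def bij_betw_inv_into_right fun_eq_iff)
  ultimately have "inverse_arrows A M N (M, h, N) (N, ?g, M)"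
    using h by (simp add: inverse_arrows_def A_simps)
  then show ?thesis by (auto simp: invertible_def)
qed

lemma invertible_bij:
  assumes "invertible A M N (M, h, N)"
  shows "bij_betw h (carrier M) (carrier N)"
proof -
  obtain g where h: "h \<in> module_maps R M N" and g: "g \<in> module_maps R N M"
    and 1: "compose (carrier M) g h = (\<lambda>m\<in>carrier M. m)" and 2: "compose (carrier N) h g = (\<lambda>m\<in>carrier N. m)"
    using assms by (auto simp: invertible_def inverse_arrows_def A_simps)
  have "g (h m) = m" if "m \<in> carrier M" for m
    using fun_cong[OF 1, of m] that by (simp add: compose_def)
  moreover have "h (g m) = m" if "m \<in> carrier N" for m
    using fun_cong[OF 2, of m] that by (simp add: compose_def)
  ultimately show ?thesis
    using module_mapsD(2)[OF h] module_mapsD(2)[OF g] by (intro bij_betw_byWitness[of _ g]) auto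
qed

lemma \<xi>_bij:
  fixes N :: "('d, 'm) module"
  assumes N: "left_module H N" and i: "i \<in> {1..n}"
  shows "bij_betw (\<lambda>m. \<xi> i \<odot>\<^bsub>N\<^esub> m) (carrier N) (carrier N)"
proof -
  let ?M = "forget_to R N"
  have "invertible A ?M ?M (?M, action_map ?M (\<xi> i), ?M)"
    using inverses i forget_in_A[OF N] by (simp add: inverses_exist_def W_simps)
  then have "bij_betw (action_map ?M (\<xi> i)) (carrier N) (carrier N)"
    using invertible_bij by fastforce
  then show ?thesis
    by (rule bij_betw_cong[THEN iffD1, rotated]) (use \<xi>_in_R[OF i] in \<open>simp add: action_map_def\<close>)
qed

text \<open>The algebra need not contain the inverses of the cluster variables, but \<open>\<xi>\<^sub>i\<close> acts bijectively.  For the initial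
  variable this gives surjectivity by \<open>x\<^sub>i (x\<^sub>i\<^sup>-\<^sup>1 \<xi>\<^sub>i) = \<xi>\<^sub>i\<close> and injectivity by \<open>(\<xi>\<^sub>i x\<^sub>i\<^sup>-\<^sup>1) x\<^sub>i = \<xi>\<^sub>i\<close>; afterwards
  the exchange relation expresses each new variable by the old one and \<open>\<xi>\<^sub>i\<close>.\<close>

lemma cv_bij:
  fixes N :: "('d, 'm) module"
  assumes N: "left_module H N"
  shows "w \<in> histories n \<Longrightarrow> i \<in> {1..n} \<Longrightarrow> bij_betw (\<lambda>m. cv w i \<odot>\<^bsub>N\<^esub> m) (carrier N) (carrier N)"
proof (induction w)
  case Nil
  let ?r = "cv [(RightSide, i)] i" and ?l = "cv [(LeftSide, i)] i"
  have h: "[] \<in> histories n" "[(RightSide, i)] \<in> histories n" "[(LeftSide, i)] \<in> histories n"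
    using Nil by (auto simp: histories_def)
  have H: "x i \<in> H" "?r \<in> H" "?l \<in> H"
    using cv_in_H h Nil x_in_H by blast+
  have "?r \<odot>\<^bsub>N\<^esub> (x i \<odot>\<^bsub>N\<^esub> m) = \<xi> i \<odot>\<^bsub>N\<^esub> m" "x i \<odot>\<^bsub>N\<^esub> (?l \<odot>\<^bsub>N\<^esub> m) = \<xi> i \<odot>\<^bsub>N\<^esub> m" if "m \<in> carrier N" for m
    using left_moduleD(5)[OF N H(2,1) that] left_moduleD(5)[OF N H(1,3) that] exchange[OF h(1) Nil(2)] by simp_all
  moreover have "x i \<odot>\<^bsub>N\<^esub> m \<in> carrier N" "?l \<odot>\<^bsub>N\<^esub> m \<in> carrier N" if "m \<in> carrier N" for m
    using left_moduleD(2)[OF N] H that by blast+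
  ultimately show ?case
    by (intro bij_betw_middle_factor[OF \<xi>_bij[OF N Nil(2)], where r = "\<lambda>m. ?r \<odot>\<^bsub>N\<^esub> m" and l = "\<lambda>m. ?l \<odot>\<^bsub>N\<^esub> m"])
      simp_all
next
  case (Cons m w)
  then have w: "w \<in> histories n" "snd m \<in> {1..n}"
    by (auto simp: histories_def)
  show ?case
  proof (cases "i = snd m")
    case False
    then show ?thesis using cv_other Cons w by metis
  next
    case True
    have H: "cv w i \<in> H" "cv (m # w) i \<in> H"
      using cv_in_H Cons.prems w by blast+
    note v = Cons.IH[OF w(1) Cons.prems(2)] and \<xi> = \<xi>_bij[OF N Cons.prems(2)]
    show ?thesis
    proof (cases "fst m")
      case RightSide
      then have "cv (m # w) i * cv w i = \<xi> i"
        using exchange(1)[OF w] True by (metis prod.collapse)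
      then show ?thesis
        using left_moduleD(5)[OF N H(2,1)] by (intro bij_betw_left_factor[OF v \<xi>]) simp
    next
      case LeftSide
      then have "cv w i * cv (m # w) i = \<xi> i"
        using exchange(2)[OF w] True by (metis prod.collapse)
      then show ?thesis
        using left_moduleD(5)[OF N H] left_moduleD(2)[OF N H(2)] by (intro bij_betw_right_factor[OF v \<xi>]) simp_all
    qed
  qed
qed

lemma x_bij: "left_module H N \<Longrightarrow> i \<in> {1..n} \<Longrightarrow> bij_betw (\<lambda>m. x i \<odot>\<^bsub>N\<^esub> m) (carrier N) (carrier N)"
  for N :: "('d, 'm) module"
  using cv_bij[of N "[]" i] by (simp add: histories_def)

text \<open>By the exchange relation and bijectivity, the action of a new variable is \<open>\<xi>\<^sub>i\<close> composed with the inverse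
  of the action of the old one, on the side of the mutation.  A map that commutes with the latter two commutes with the former.\<close>

lemma commutes_with_cv:
  fixes N N' :: "('d, 'm) module"
  assumes N: "left_module H N" and N': "left_module H N'" and h: "h \<in> carrier N \<rightarrow> carrier N'"
    and R_lin: "\<And>r m. r \<in> R \<Longrightarrow> m \<in> carrier N \<Longrightarrow> h (r \<odot>\<^bsub>N\<^esub> m) = r \<odot>\<^bsub>N'\<^esub> h m"
    and x_lin: "\<And>i m. i \<in> {1..n} \<Longrightarrow> m \<in> carrier N \<Longrightarrow> h (x i \<odot>\<^bsub>N\<^esub> m) = x i \<odot>\<^bsub>N'\<^esub> h m"
  shows "w \<in> histories n \<Longrightarrow> i \<in> {1..n} \<Longrightarrow> m \<in> carrier N \<Longrightarrow> h (cv w i \<odot>\<^bsub>N\<^esub> m) = cv w i \<odot>\<^bsub>N'\<^esub> h m"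
proof (induction w arbitrary: m)
  case Nil
  then show ?case using x_lin by simp
next
  case (Cons \<mu> w)
  then have w: "w \<in> histories n" "snd \<mu> \<in> {1..n}"
    by (auto simp: histories_def)
  have m: "m \<in> carrier N" and i: "i \<in> {1..n}" by fact+
  show ?case
  proof (cases "i = snd \<mu>")
    case False
    then show ?thesis using cv_other Cons w by metis
  next
    case True
    let ?v = "cv w i" and ?v' = "cv (\<mu> # w) i"
    have H: "?v \<in> H" "?v' \<in> H"
      using cv_in_H Cons.prems w by blast+
    have hN: "h a \<in> carrier N'" if "a \<in> carrier N" for a
      using h that by auto
    have IH: "h (?v \<odot>\<^bsub>N\<^esub> a) = ?v \<odot>\<^bsub>N'\<^esub> h a" if "a \<in> carrier N" for a
      using Cons.IH[OF w(1) i that] .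
    have \<xi>: "h (\<xi> i \<odot>\<^bsub>N\<^esub> a) = \<xi> i \<odot>\<^bsub>N'\<^esub> h a" if "a \<in> carrier N" for a
      using R_lin \<xi>_in_R i that by simp
    show ?thesis
    proof (cases "fst \<mu>")
      case RightSide
      then have e: "?v' * ?v = \<xi> i"
        using exchange(1)[OF w] True by (metis prod.collapse)
      have "m \<in> (\<lambda>a. ?v \<odot>\<^bsub>N\<^esub> a) ` carrier N"
        using m by (simp only: bij_betw_imp_surj_on[OF cv_bij[OF N w(1) i]])
      then obtain a where a: "a \<in> carrier N" "m = ?v \<odot>\<^bsub>N\<^esub> a" by blast
      have "?v' \<odot>\<^bsub>N\<^esub> (?v \<odot>\<^bsub>N\<^esub> a) = \<xi> i \<odot>\<^bsub>N\<^esub> a"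
        using left_moduleD(5)[OF N H(2,1) a(1)] unfolding e by (rule sym)
      moreover have "?v' \<odot>\<^bsub>N'\<^esub> (?v \<odot>\<^bsub>N'\<^esub> h a) = \<xi> i \<odot>\<^bsub>N'\<^esub> h a"
        using left_moduleD(5)[OF N' H(2,1) hN[OF a(1)]] unfolding e by (rule sym)
      ultimately show ?thesis
        by (simp only: a(2) IH[OF a(1)] \<xi>[OF a(1)])
    next
      case LeftSide
      then have e: "?v * ?v' = \<xi> i"
        using exchange(2)[OF w] True by (metis prod.collapse)
      have v'm: "?v' \<odot>\<^bsub>N\<^esub> m \<in> carrier N" "?v' \<odot>\<^bsub>N'\<^esub> h m \<in> carrier N'"
        using left_moduleD(2)[OF N H(2) m] left_moduleD(2)[OF N' H(2) hN[OF m]] .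
      have "?v \<odot>\<^bsub>N'\<^esub> h (?v' \<odot>\<^bsub>N\<^esub> m) = ?v \<odot>\<^bsub>N'\<^esub> (?v' \<odot>\<^bsub>N'\<^esub> h m)"
        using left_moduleD(5)[OF N H m] left_moduleD(5)[OF N' H hN[OF m]] \<xi>[OF m] IH[OF v'm(1)]
        unfolding e by (simp only:)
      then show ?thesis
        using cv_bij[OF N' w(1) i] hN[OF v'm(1)] v'm(2) unfolding bij_betw_def inj_on_def by blast
    qed
  qed
qed

text \<open>The elements of the algebra that commute with \<open>h\<close> form a subring, so it is enough to look at
  \<open>R\<close> and the cluster variables.\<close>

lemma H_linear:
  fixes N N' :: "('d, 'm) module"
  assumes N: "left_module H N" and N': "left_module H N'"
  shows "h \<in> module_maps H N N' \<longleftrightarrow> h \<in> module_maps R (forget_to R N) (forget_to R N') \<and>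
     (\<forall>i\<in>{1..n}. \<forall>m\<in>carrier N. h (x i \<odot>\<^bsub>N\<^esub> m) = x i \<odot>\<^bsub>N'\<^esub> h m)" (is "_ \<longleftrightarrow> ?r")
proof
  assume h: "h \<in> module_maps H N N'"
  note hD = module_mapsD[OF h]
  have "h \<in> module_maps R (forget_to R N) (forget_to R N')"
    using hD H_contains(1) by (auto simp: module_maps_def subset_iff)
  then show ?r using hD x_in_H by auto
next
  assume r: ?r
  then have "h \<in> module_maps R (forget_to R N) (forget_to R N')" by simp
  note hD = module_mapsD[OF this, unfolded forget_to_simps]
  have R_lin: "h (r \<odot>\<^bsub>N\<^esub> m) = r \<odot>\<^bsub>N'\<^esub> h m" if "r \<in> R" "m \<in> carrier N" for r m
    using that hD(2)[of m] hD(4)[of r m] by simp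
  define T where "T = {d \<in> H. \<forall>m\<in>carrier N. h (d \<odot>\<^bsub>N\<^esub> m) = d \<odot>\<^bsub>N'\<^esub> h m}"
  have RT: "R \<subseteq> T"
    using R_lin H_contains by (auto simp: T_def)
  have add: "a + b \<in> T" if "a \<in> T" "b \<in> T" for a b
    using that hD(2,3) left_moduleD(2,4)[OF N] left_moduleD(4)[OF N'] H_closed(1) by (simp add: T_def)
  have mult: "a * b \<in> T" if "a \<in> T" "b \<in> T" for a b
    using that hD(2) left_moduleD(2,5)[OF N] left_moduleD(5)[OF N'] H_closed(3) by (simp add: T_def)
  have "a - b \<in> T" if "a \<in> T" "b \<in> T" for a b
    using add[OF that(1) mult[OF _ that(2), of "-1"]] RT R_minus_one by auto
  then have "is_subring T"
    using add mult RT R_zero R_one by (auto simp: is_subring_def)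
  moreover have "cluster_variables n R p \<subseteq> T"
  proof
    fix d assume d: "d \<in> cluster_variables n R p"
    then obtain w i where "w \<in> histories n" "i \<in> {1..n}" "d = cv w i"
      by (auto simp: cluster_variables_def)
    then show "d \<in> T"
      using commutes_with_cv[OF N N' _ R_lin, of w i] hD(1) r cv_in_H by (auto simp: T_def PiE_def)
  qed
  ultimately have "H \<subseteq> T"
    using H_minimal RT by blast
  then show "h \<in> module_maps H N N'"
    using hD by (auto simp: module_maps_def T_def)
qed

end

section \<open>The twists and the skew Laurent category of modules\<close>

context weyl_modules
begin

definition untwist :: "('d \<Rightarrow> 'd) \<Rightarrow> ('d, 'm) module \<Rightarrow> ('d, 'm) module" where
  "untwist \<phi> M = with_action R (\<lambda>r m. \<phi> r \<odot>\<^bsub>M\<^esub> m) M"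

lemma untwist_simps [simp]:
  "carrier (untwist \<phi> M) = carrier M" "add (untwist \<phi> M) = add M" "zero (untwist \<phi> M) = zero M"
  "r \<in> R \<Longrightarrow> m \<in> carrier M \<Longrightarrow> r \<odot>\<^bsub>untwist \<phi> M\<^esub> m = \<phi> r \<odot>\<^bsub>M\<^esub> m"
  by (simp_all add: untwist_def)

lemma x_additive:
  fixes N :: "('d, 'm) module"
  assumes "left_module H N" "i \<in> {1..n}" "m \<in> carrier N" "m' \<in> carrier N"
  shows "x i \<odot>\<^bsub>N\<^esub> (m \<oplus>\<^bsub>N\<^esub> m') = x i \<odot>\<^bsub>N\<^esub> m \<oplus>\<^bsub>N\<^esub> x i \<odot>\<^bsub>N\<^esub> m'"
  using left_moduleD(3)[OF assms(1) x_in_H[OF assms(2)]] assms by blast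

text \<open>The automorphism \<open>\<theta>\<^sub>i\<close> is given on \<open>R\<close> only, so twisting by it does not directly produce a module over
  the cluster algebra.  But \<open>x\<^sub>i : \<Theta>\<^sub>i(M) \<rightarrow> M\<close> is bijective and \<open>R\<close>-linear, so the action on \<open>M\<close> can be
  transported along it, and \<open>\<Theta>\<^sub>i\<^sup>-\<^sup>1(M)\<close> is treated in the same way with \<open>x\<^sub>i : M \<rightarrow> \<Theta>\<^sub>i\<^sup>-\<^sup>1(M)\<close>.\<close>

lemma twist_in_A:
  assumes i: "i \<in> {1..n}" and M: "M \<in> Obj A"
  shows "twist R (\<theta> i) M \<in> Obj A"
proof -
  obtain N where N: "left_module H N" and M_eq: "M = forget_to R N"
    using M by (auto simp: A_simps)
  let ?\<beta> = "\<lambda>m. x i \<odot>\<^bsub>N\<^esub> m"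
  let ?N' = "N\<lparr>smult := \<lambda>d m. inv_into (carrier N) ?\<beta> (d \<odot>\<^bsub>N\<^esub> ?\<beta> m)\<rparr>"
  have "left_module H ?N'"
    by (rule left_module_transport[OF N x_bij[OF N i] x_additive[OF N i]])
  moreover have "twist R (\<theta> i) M = forget_to R ?N'"
    unfolding twist_def forget_to_def[of R ?N'] M_eq forget_to_simps with_action_simps
  proof (rule with_action_cong)
    fix r m assume r: "r \<in> R" and m: "m \<in> carrier N"
    let ?s = "inv_into R (\<theta> i) r"
    have s: "?s \<in> R" by (rule \<theta>_inv_in_R[OF i r])
    have H: "r \<in> H" "?s \<in> H" "x i \<in> H"
      using r s H_contains x_in_H[OF i] by auto
    have "r \<odot>\<^bsub>N\<^esub> ?\<beta> m = ?\<beta> (?s \<odot>\<^bsub>N\<^esub> m)"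
      using left_moduleD(5)[OF N H(1,3) m] left_moduleD(5)[OF N H(3,2) m] x_\<theta>_inv[OF i r] by simp
    then show "?s \<odot>\<^bsub>forget_to R N\<^esub> m = smult ?N' r m"
      using s m left_moduleD(2)[OF N H(2) m] bij_betw_inv_into_left[OF x_bij[OF N i]] by simp
  qed
  ultimately show ?thesis
    using A_simps(1) by blast
qed

lemma untwist_in_A:
  assumes i: "i \<in> {1..n}" and M: "M \<in> Obj A"
  shows "untwist (\<theta> i) M \<in> Obj A"
proof -
  obtain N where N: "left_module H N" and M_eq: "M = forget_to R N"
    using M by (auto simp: A_simps)
  let ?\<beta> = "\<lambda>m. x i \<odot>\<^bsub>N\<^esub> m" let ?\<gamma> = "inv_into (carrier N) ?\<beta>"
  note \<beta> = x_bij[OF N i]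
  let ?N' = "N\<lparr>smult := \<lambda>d m. inv_into (carrier N) ?\<gamma> (d \<odot>\<^bsub>N\<^esub> ?\<gamma> m)\<rparr>"
  have cl: "u \<oplus>\<^bsub>N\<^esub> v \<in> carrier N" if "u \<in> carrier N" "v \<in> carrier N" for u v
    using that left_moduleD(1)[OF N] by (simp add: abelian_groupE(1))
  have \<gamma>: "?\<gamma> m \<in> carrier N" "?\<beta> (?\<gamma> m) = m" if "m \<in> carrier N" for m
    using that \<beta> bij_betw_inv_into_right[OF \<beta>] bij_betwE[OF bij_betw_inv_into[OF \<beta>]] by auto
  have "?\<gamma> (m \<oplus>\<^bsub>N\<^esub> m') = ?\<gamma> m \<oplus>\<^bsub>N\<^esub> ?\<gamma> m'" if "m \<in> carrier N" "m' \<in> carrier N" for m m'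
    using x_additive[OF N i \<gamma>(1)[OF that(1)] \<gamma>(1)[OF that(2)]] \<gamma>[OF that(1)] \<gamma>[OF that(2)]
      bij_betw_inv_into_left[OF \<beta> cl[OF \<gamma>(1)[OF that(1)] \<gamma>(1)[OF that(2)]]] by simp
  then have "left_module H ?N'"
    by (intro left_module_transport[OF N bij_betw_inv_into[OF \<beta>]])
  moreover have "untwist (\<theta> i) M = forget_to R ?N'"
    unfolding untwist_def forget_to_def[of R ?N'] M_eq forget_to_simps with_action_simps
  proof (rule with_action_cong)
    fix r m assume r: "r \<in> R" and m: "m \<in> carrier N"
    have H: "r \<in> H" "\<theta> i r \<in> H" "x i \<in> H"
      using r \<theta>_in_R[OF i r] H_contains x_in_H[OF i] by auto
    have "?\<beta> (r \<odot>\<^bsub>N\<^esub> ?\<gamma> m) = \<theta> i r \<odot>\<^bsub>N\<^esub> m"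
      using left_moduleD(5)[OF N H(3,1) \<gamma>(1)[OF m]] left_moduleD(5)[OF N H(2,3) \<gamma>(1)[OF m]] x_R[OF i r] \<gamma>(2)[OF m]
      by simp
    then show "\<theta> i r \<odot>\<^bsub>forget_to R N\<^esub> m = smult ?N' r m"
      using m \<theta>_in_R[OF i r] left_moduleD(2)[OF N H(1) \<gamma>(1)[OF m]] inv_into_inv_into_eq[OF \<beta>] by simp
  qed
  ultimately show ?thesis
    using A_simps(1) by blast
qed

lemma untwist_twist: "i \<in> {1..n} \<Longrightarrow> M \<in> Obj A \<Longrightarrow> untwist (\<theta> i) (twist R (\<theta> i) M) = M"
  and twist_untwist: "i \<in> {1..n} \<Longrightarrow> M \<in> Obj A \<Longrightarrow> twist R (\<theta> i) (untwist (\<theta> i) M) = M"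
proof -
  assume i: "i \<in> {1..n}" and M: "M \<in> Obj A"
  have "untwist (\<theta> i) (twist R (\<theta> i) M) = with_action R (\<lambda>r m. \<theta> i r \<odot>\<^bsub>twist R (\<theta> i) M\<^esub> m) M"
    by (simp add: untwist_def twist_def)
  also have "\<dots> = with_action R (smult M) M"
    by (rule with_action_cong) (simp add: \<theta>_in_R[OF i] \<theta>_inv_\<theta>[OF i])
  finally show "untwist (\<theta> i) (twist R (\<theta> i) M) = M"
    using A_forget_to[OF M] by (simp add: forget_to_def)
  have "twist R (\<theta> i) (untwist (\<theta> i) M) = with_action R (\<lambda>r m. inv_into R (\<theta> i) r \<odot>\<^bsub>untwist (\<theta> i) M\<^esub> m) M"
    by (simp add: untwist_def twist_def)
  also have "\<dots> = with_action R (smult M) M"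
    by (rule with_action_cong) (simp add: \<theta>_inv_in_R[OF i] \<theta>_\<theta>_inv[OF i])
  finally show "twist R (\<theta> i) (untwist (\<theta> i) M) = M"
    using A_forget_to[OF M] by (simp add: forget_to_def)
qed

lemma twist_commute:
  "\<lbrakk>i \<in> {1..n}; j \<in> {1..n}\<rbrakk> \<Longrightarrow> twist R (\<theta> i) (twist R (\<theta> j) M) = twist R (\<theta> j) (twist R (\<theta> i) M)"
  for M :: "('d, 'm) module"
  unfolding twist_def with_action_simps
  by (rule with_action_cong) (simp add: \<theta>_inv_in_R \<theta>_inv_commute[of i j])

lemma module_maps_twist:
  fixes M N :: "('d, 'm) module"
  assumes i: "i \<in> {1..n}"
  shows "module_maps R (twist R (\<theta> i) M) (twist R (\<theta> i) N) = module_maps R M N"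
proof -
  have "(\<forall>r\<in>R. \<forall>m\<in>carrier M. h (inv_into R (\<theta> i) r \<odot>\<^bsub>M\<^esub> m) = inv_into R (\<theta> i) r \<odot>\<^bsub>N\<^esub> h m)
      \<longleftrightarrow> (\<forall>r\<in>R. \<forall>m\<in>carrier M. h (r \<odot>\<^bsub>M\<^esub> m) = r \<odot>\<^bsub>N\<^esub> h m)" for h
    using \<theta>_inv_in_R[OF i] \<theta>_in_R[OF i] \<theta>_inv_\<theta>[OF i] by metis
  moreover have "h m \<in> carrier N" if "h \<in> carrier M \<rightarrow>\<^sub>E carrier N" "m \<in> carrier M" for h m
    using that by auto
  ultimately show ?thesis
    unfolding module_maps_def using \<theta>_inv_in_R[OF i] by (auto cong: ball_cong)
qed

lemma twist_ftr_simps: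
  "M \<in> Obj A \<Longrightarrow> FObj (twist_ftr n R p i) M = twist R (\<theta> i) M"
  "M \<in> Obj A \<Longrightarrow> N \<in> Obj A \<Longrightarrow> h \<in> module_maps R M N \<Longrightarrow>
     FArr (twist_ftr n R p i) (M, h, N) = (twist R (\<theta> i) M, h, twist R (\<theta> i) N)"
proof -
  show "M \<in> Obj A \<Longrightarrow> FObj (twist_ftr n R p i) M = twist R (\<theta> i) M"
    by (simp add: twist_ftr_def A)
  assume "M \<in> Obj A" "N \<in> Obj A" "h \<in> module_maps R M N"
  then have "(M, h, N) \<in> Arr (A_cat n R p)"
    unfolding A[symmetric] A_arr by blast
  then show "FArr (twist_ftr n R p i) (M, h, N) = (twist R (\<theta> i) M, h, twist R (\<theta> i) N)"
    by (simp add: twist_ftr_def)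
qed

lemma twist_automorphism:
  assumes i: "i \<in> {1..n}"
  shows "automorphism A (twist_ftr n R p i)" (is "automorphism A ?T")
  unfolding automorphism_def
proof (intro conjI)
  interpret small_category A by standard (rule A_category)
  let ?t = "twist R (\<theta> i)" and ?u = "untwist (\<theta> i)"
  note t = twist_in_A[OF i] and u = untwist_in_A[OF i] and ut = untwist_twist[OF i] and tu = twist_untwist[OF i]
  note maps = module_maps_twist[OF i]
  have maps_u: "h \<in> module_maps R (?u M) (?u N) \<longleftrightarrow> h \<in> module_maps R M N" if "M \<in> Obj A" "N \<in> Obj A" for h M N
    using maps[of "?u M" "?u N"] tu that by simp
  show "bij_betw (FObj ?T) (Obj A) (Obj A)"
    by (rule bij_betw_byWitness[of _ ?u]) (auto simp: twist_ftr_simps t u ut tu)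
  show "bij_betw (FArr ?T) (Arr A) (Arr A)"
    by (rule bij_betw_byWitness[of _ "\<lambda>(M, h, N). (?u M, h, ?u N)"])
      (auto simp: A_arr twist_ftr_simps t u ut tu maps maps_u)
  show "is_functor A A ?T"
    unfolding is_functor_def
  proof (intro conjI ballI)
    fix M assume M: "M \<in> Obj A"
    show "FArr ?T (Idt A M) = Idt A (FObj ?T M)"
      using M module_maps_id[OF A_left_module[OF M]] by (simp add: A_simps(3) twist_ftr_simps)
  next
    fix L M N f g assume o: "L \<in> Obj A" "M \<in> Obj A" "N \<in> Obj A" and "f \<in> Hom A L M" "g \<in> Hom A M N"
    then obtain h k where "f = (L, h, M)" "g = (M, k, N)" "h \<in> module_maps R L M" "k \<in> module_maps R M N"
      by (auto simp: A_simps(2))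
    then show "FArr ?T (Cmp A g f) = Cmp A (FArr ?T g) (FArr ?T f)"
      using o module_maps_compose[of h R L M k N] A_left_module by (simp add: A_simps(4) twist_ftr_simps)
  qed (auto simp: twist_ftr_simps t maps A_simps(2))
qed

lemma twist_ftr_commute:
  assumes "i \<in> {1..n}" "j \<in> {1..n}"
  shows "commuting A (twist_ftr n R p i) (twist_ftr n R p j)"
  unfolding commuting_def using assms
  by (auto simp: A_arr twist_ftr_simps twist_in_A module_maps_twist twist_commute[of i j])

lemma \<xi>_natural:
  assumes i: "i \<in> {1..n}"
  shows "natural_iso A A id_ftr id_ftr (Xi W i)"
proof -
  have "Cmp A (Xi W i N) (M, h, N) = Cmp A (M, h, N) (Xi W i M)"
    if "M \<in> Obj A" "N \<in> Obj A" and h: "h \<in> module_maps R M N" for M N h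
    using \<xi>_in_R[OF i] module_mapsD(2,4)[OF h]
    by (auto simp: W_simps A_simps(4) compose_def action_map_def fun_eq_iff left_moduleD(2)[OF A_left_module[OF that(1)]])
  then show ?thesis
    using inverses i by (auto simp: natural_iso_def id_ftr_def inverses_exist_def A_simps(2))
qed

lemma \<epsilon>_natural:
  assumes i: "i \<in> {1..n}"
  shows "natural_iso A A id_ftr id_ftr (eps A W i)"
proof -
  interpret category_automorphism A "Theta W i"
    by standard (use A_category twist_automorphism[OF i] in \<open>simp_all add: W_simps\<close>)
  have "Xi W i x \<in> Hom A x x" if "x \<in> Obj A" for x
    using inverses i that invertible_hom by (auto simp: inverses_exist_def)
  then have "Cmp A (eps A W i y) f = Cmp A f (eps A W i x)" if "x \<in> Obj A" "y \<in> Obj A" "f \<in> Hom A x y" for x y f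
    unfolding eps_def using that \<xi>_natural[OF i] by (intro conjugate_natural) (auto simp: natural_iso_def id_ftr_def)
  then show ?thesis
    using inverses i by (auto simp: natural_iso_def id_ftr_def inverses_exist_def)
qed

sublocale seed_mutation A n W
  by standard (use A_category n \<xi>_natural \<epsilon>_natural in auto)

abbreviation "alpha \<equiv> alpha_obj n R p :: ('d, 'm) module \<Rightarrow> _"

lemma alpha_simps:
  "fst (alpha N) = forget_to R N"
  "i \<in> {1..n} \<Longrightarrow> snd (alpha N) i = (twist R (\<theta> i) (forget_to R N), action_map N (x i), forget_to R N)"
  by (simp_all add: alpha_obj_def)

lemma W_laurent:
  "Obj (Laurent W) = alpha ` {N. left_module H N}"
  "Idt (Laurent W) X = (X, (\<lambda>i\<in>{1..n}. Idt A (fst X)), X)"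
  "Cmp (Laurent W) = tuple_cmp n A"
proof -
  have Cmp: "Cmp A = Cmp (modules_over R)" and Idt: "Idt A = Idt (modules_over R)"
    by (simp_all add: A A_cat_def)
  show "Obj (Laurent W) = alpha ` {N. left_module H N}"
    by (simp add: W W0_def Let_def modules_over_def)
  show "Idt (Laurent W) X = (X, (\<lambda>i\<in>{1..n}. Idt A (fst X)), X)"
    by (simp add: W W0_def Let_def Idt)
  show "Cmp (Laurent W) = tuple_cmp n A"
    by (simp add: W W0_def Let_def tuple_cmp_def Cmp fun_eq_iff)
qed

lemma W_laurent_hom:
  "f \<in> Hom (Laurent W) X Y \<longleftrightarrow> (\<exists>h N N'. f = (X, (\<lambda>i\<in>{1..n}. (fst X, h, fst Y)), Y) \<and>
     left_module H N \<and> left_module H N' \<and> X = alpha N \<and> Y = alpha N' \<and> h \<in> module_maps H N N')"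
  by (simp add: W W0_def Let_def)

lemma alpha_component:
  fixes N :: "('d, 'm) module"
  assumes N: "left_module H N" and i: "i \<in> {1..n}"
  shows "action_map N (x i) \<in> module_maps R (twist R (\<theta> i) (forget_to R N)) (forget_to R N)"
proof -
  have cl: "u \<oplus>\<^bsub>N\<^esub> v \<in> carrier N" if "u \<in> carrier N" "v \<in> carrier N" for u v
    using that left_moduleD(1)[OF N] by (simp add: abelian_groupE(1))
  have "x i \<odot>\<^bsub>N\<^esub> (inv_into R (\<theta> i) r \<odot>\<^bsub>N\<^esub> m) = r \<odot>\<^bsub>N\<^esub> (x i \<odot>\<^bsub>N\<^esub> m)" "inv_into R (\<theta> i) r \<odot>\<^bsub>N\<^esub> m \<in> carrier N"
    if r: "r \<in> R" and m: "m \<in> carrier N" for r m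
  proof -
    have H: "r \<in> H" "inv_into R (\<theta> i) r \<in> H" "x i \<in> H"
      using r \<theta>_inv_in_R[OF i r] H_contains x_in_H[OF i] by auto
    show "x i \<odot>\<^bsub>N\<^esub> (inv_into R (\<theta> i) r \<odot>\<^bsub>N\<^esub> m) = r \<odot>\<^bsub>N\<^esub> (x i \<odot>\<^bsub>N\<^esub> m)"
      using left_moduleD(5)[OF N H(1,3) m] left_moduleD(5)[OF N H(3,2) m] x_\<theta>_inv[OF i r] by simp
    show "inv_into R (\<theta> i) r \<odot>\<^bsub>N\<^esub> m \<in> carrier N"
      by (rule left_moduleD(2)[OF N H(2) m])
  qed
  then show ?thesis
    using cl left_moduleD(2)[OF N x_in_H[OF i]] \<theta>_inv_in_R[OF i] x_additive[OF N i]
    by (auto simp: module_maps_def action_map_def)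
qed

text \<open>Compatibility with the components \<open>x\<^sub>i : \<Theta>\<^sub>i(M) \<rightarrow> M\<close> says that the \<open>R\<close>-linear map \<open>h\<close> commutes with the action of
  the initial variables, and by \<open>H_linear\<close> this is linearity over the cluster algebra.\<close>

lemma laurent_hom_alpha:
  fixes N N' :: "('d, 'm) module"
  assumes N: "left_module H N" and N': "left_module H N'"
  shows "a \<in> laurent_hom n A (Theta W) (alpha N) (alpha N') \<longleftrightarrow>
    (\<exists>h. a = (forget_to R N, h, forget_to R N') \<and> h \<in> module_maps H N N')"
proof -
  let ?M = "forget_to R N" and ?M' = "forget_to R N'"
  have "Cmp A (?M, h, ?M') (snd (alpha N) i) = Cmp A (snd (alpha N') i) (FArr (Theta W i) (?M, h, ?M'))
      \<longleftrightarrow> (\<forall>m\<in>carrier N. h (x i \<odot>\<^bsub>N\<^esub> m) = x i \<odot>\<^bsub>N'\<^esub> h m)"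
    if h: "h \<in> module_maps R ?M ?M'" and i: "i \<in> {1..n}" for h i
  proof -
    have "h m \<in> carrier N'" if "m \<in> carrier N" for m
      using module_mapsD(2)[OF h] that by simp
    then show ?thesis
      using h i forget_in_A[OF N] forget_in_A[OF N']
      by (auto simp: alpha_simps W_simps twist_ftr_simps A_simps(4) compose_def action_map_def fun_eq_iff)
  qed
  then have "(?M, h, ?M') \<in> laurent_hom n A (Theta W) (alpha N) (alpha N') \<longleftrightarrow> h \<in> module_maps H N N'" for h
    unfolding H_linear[OF N N'] by (auto simp: laurent_hom_def A_simps(2) alpha_simps(1))
  moreover have "\<exists>h. a = (?M, h, ?M')" if "a \<in> laurent_hom n A (Theta W) (alpha N) (alpha N')"
    using that by (auto simp: laurent_hom_def A_simps(2) alpha_simps(1))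
  ultimately show ?thesis by blast
qed

lemma W_seed: "skew_laurent_seed n A W"
  unfolding skew_laurent_seed_def
proof (intro conjI ballI)
  show "Obj (Laurent W) \<noteq> {}"
    using zero_module by (simp add: W_laurent)
next
  fix X assume "X \<in> Obj (Laurent W)"
  then obtain N where N: "left_module H N" "X = alpha N" by (auto simp: W_laurent)
  note M = forget_in_A[OF N(1)]
  show "fst X \<in> Obj A" using M by (simp add: N(2) alpha_simps)
  fix i assume i: "i \<in> {1..n}"
  have "bij_betw (action_map N (x i)) (carrier N) (carrier N)"
    by (rule bij_betw_cong[THEN iffD1, OF _ x_bij[OF N(1) i]]) (simp add: action_map_def)
  then show "invertible A (FObj (Theta W i) (fst X)) (fst X) (snd X i)"
    using bij_invertible[OF twist_in_A[OF i M] M alpha_component[OF N(1) i]] i M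
    by (simp add: N(2) alpha_simps W_simps twist_ftr_simps)
next
  fix X Y assume "X \<in> Obj (Laurent W)" "Y \<in> Obj (Laurent W)"
  then obtain N N' where N: "left_module H N" "left_module H N'" and XY: "X = alpha N" "Y = alpha N'"
    by (auto simp: W_laurent)
  show "Hom (Laurent W) X Y = {(X, (\<lambda>i\<in>{1..n}. a), Y) | a. a \<in> laurent_hom n A (Theta W) X Y}" (is "?l = ?r")
  proof (intro Set.set_eqI iffI)
    fix f assume "f \<in> ?l"
    then obtain h L L' where "left_module H L" "left_module H L'" "X = alpha L" "Y = alpha L'" "h \<in> module_maps H L L'"
        "f = (X, (\<lambda>i\<in>{1..n}. (fst X, h, fst Y)), Y)"
      unfolding W_laurent_hom by blast
    then show "f \<in> ?r"
      using laurent_hom_alpha[of L L'] alpha_simps(1) by blast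
  next
    fix f assume "f \<in> ?r"
    then obtain a where a: "f = (X, (\<lambda>i\<in>{1..n}. a), Y)" "a \<in> laurent_hom n A (Theta W) X Y" by blast
    then obtain h where "a = (fst X, h, fst Y)" "h \<in> module_maps H N N'"
      using laurent_hom_alpha[OF N] by (auto simp: XY alpha_simps(1))
    then show "f \<in> ?l"
      unfolding W_laurent_hom using a N XY by blast
  qed
qed (use twist_automorphism twist_ftr_commute in \<open>auto simp: W_laurent W_simps\<close>)

definition alpha_ftr where
  "alpha_ftr = \<lparr>FObj = alpha,
     FArr = (\<lambda>(N, h, N'). (alpha N, (\<lambda>i\<in>{1..n}. (forget_to R N, h, forget_to R N')), alpha N'))\<rparr>"

lemma alpha_ftr_ff_onto: "ff_onto (modules_over H) (Laurent W) alpha_ftr"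
proof -
  interpret laurent_seed A n W W by standard (rule W_seed)
  let ?D = "modules_over H :: ('d, 'm) module_category"
  have D: "Obj ?D = {N. left_module H N}" "Hom ?D N N' = {(N, h, N') | h. h \<in> module_maps H N N'}"
      "Idt ?D N = (N, (\<lambda>m\<in>carrier N. m), N)" "Cmp ?D (N1, k, N') (N, h, N2) = (N, compose (carrier N) k h, N')"
    for N N' N1 N2 h k
    by (simp_all add: modules_over_def)
  have F: "FObj alpha_ftr = alpha"
      "FArr alpha_ftr (N, h, N') = (alpha N, (\<lambda>i\<in>{1..n}. (forget_to R N, h, forget_to R N')), alpha N')" for N h N'
    by (simp_all add: alpha_ftr_def)
  have bij: "bij_betw (FArr alpha_ftr) (Hom ?D N N') (Hom L (alpha N) (alpha N'))"
    if N: "left_module H N" "left_module H N'" for N N'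
  proof -
    have "inj_on (FArr alpha_ftr) (Hom ?D N N')"
      unfolding inj_on_def D by (auto simp only: F prod.inject const_tuple_eq mem_Collect_eq)
    moreover have ob: "alpha N \<in> Obj L" "alpha N' \<in> Obj L"
      using N by (auto simp: W_laurent)
    moreover have "laurent_hom n A (Theta W) (alpha N) (alpha N') =
        (\<lambda>h. (forget_to R N, h, forget_to R N')) ` module_maps H N N'"
      using laurent_hom_alpha[OF N] by (auto simp: image_iff)
    then have "FArr alpha_ftr ` Hom ?D N N' = Hom L (alpha N) (alpha N')"
      by (simp only: L_hom[OF ob] D Setcompr_eq_image image_image F)
    ultimately show ?thesis by (simp add: bij_betw_def)
  qed
  have "is_functor ?D L alpha_ftr"
    unfolding is_functor_def
  proof (intro conjI ballI)
    fix N assume "N \<in> Obj ?D"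
    then show "FObj alpha_ftr N \<in> Obj L" by (simp add: F D W_laurent)
    show "FArr alpha_ftr (Idt ?D N) = Idt L (FObj alpha_ftr N)"
      by (simp only: F D W_laurent(2) A_simps(3) alpha_simps(1) forget_to_simps)
  next
    fix N N' f assume "N \<in> Obj ?D" "N' \<in> Obj ?D" "f \<in> Hom ?D N N'"
    then show "FArr alpha_ftr f \<in> Hom L (FObj alpha_ftr N) (FObj alpha_ftr N')"
      using bij_betwE[OF bij[of N N']] by (simp add: F D(1))
  next
    fix N1 N2 N3 f g assume "f \<in> Hom ?D N1 N2" "g \<in> Hom ?D N2 N3"
    then obtain h k where hk: "f = (N1, h, N2)" "g = (N2, k, N3)" by (auto simp: D)
    show "FArr alpha_ftr (Cmp ?D g f) = Cmp L (FArr alpha_ftr g) (FArr alpha_ftr f)"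
      by (simp only: hk D F W_laurent(3) tuple_cmp_const A_simps(4) forget_to_simps)
  qed
  then show ?thesis
    unfolding ff_onto_def using bij modules_H_category L_category by (simp add: F D(1) W_laurent(1))
qed

lemma hyperbolic_equivalences:
  assumes "B \<in> hyperbolic_categories n A W"
  shows "equivalent_categories B (modules_over H :: ('d, 'm) module_category)"
    and "B' \<in> hyperbolic_categories n A W \<Longrightarrow> equivalent_categories B B'"
proof -
  have F: "\<exists>F. ff_onto (modules_over H :: ('d, 'm) module_category) C F" if "C \<in> hyperbolic_categories n A W" for C
    using hyperbolic_ff_onto[OF W_seed that] ff_onto_comp[OF alpha_ftr_ff_onto] by blast
  show "equivalent_categories B (modules_over H :: ('d, 'm) module_category)"
    using F[OF assms] ff_onto_id[OF modules_H_category] equivalent_if_common_source by blast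
  show "B' \<in> hyperbolic_categories n A W \<Longrightarrow> equivalent_categories B B'"
    using F[OF assms] F[of B'] equivalent_if_common_source by blast
qed

end

theorem theorem1p2:
  fixes n :: nat
    and K P R :: "'d::{division_ring, ring_char_0} set"
    and F :: "nat \<Rightarrow> 'd set"
    and t :: "nat \<Rightarrow> 'd"
    and p :: "'d weyl_triple"
    and A H_mod :: "('d, 'm) module_category"
    and W :: "('d, 'm) module_preseed"
  assumes "n \<ge> 1"
    and "coefficients n K P F"
    and "R = group_ring K P"
    and "free_generators n R t"
    and "weyl_preseed n K P F p"
    and "A = A_cat n R p"
    and "W = W0 n R p"
    and "H_mod = modules_over (weyl_cluster_algebra n R p)"
    and "inverses_exist n A W"
  shows "\<exists>\<G>. \<G> \<subseteq> hyperbolic_categories n A W \<and>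
           generated_by (clustered_category n A W) \<G> \<and>
           (\<forall>B\<in>\<G>. \<forall>B'\<in>\<G>. equivalent_categories B B') \<and>
           (\<forall>B\<in>\<G>. equivalent_categories B H_mod)"
proof (intro exI conjI ballI)
  interpret weyl_modules n K P R F p A W
    by standard (use assms in auto)
  show "hyperbolic_categories n A W \<subseteq> hyperbolic_categories n A W" ..
  show "generated_by (clustered_category n A W) (hyperbolic_categories n A W)"
    unfolding clustered_category_def by (rule generated_by_hyperbolic_categories[OF W_seed])
  show "equivalent_categories B B'" if "B \<in> hyperbolic_categories n A W" "B' \<in> hyperbolic_categories n A W" for B B'
    using hyperbolic_equivalences that by blast
  show "equivalent_categories B H_mod" if "B \<in> hyperbolic_categories n A W" for B
    unfolding assms(8) by (rule hyperbolic_equivalences(1)[OF that])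
qed

end
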